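(* Let $d\ge 1$ and, for $K>0$ and $\varepsilon>0$, let $\nu_{K,\varepsilon}$ be the probability measure on $\mathbb{R}$ which is the limit in distribution, as $t\to+\infty$, of $\mathrm{Law}(\|\psi_1(t)-\psi_2(t)\|)$, where $(\psi_1,\psi_2)$ is the solution of $$\begin{cases}d\psi_1=i\Delta\psi_1\,dt+\frac K2\big(\psi_2-\langle\psi_1,\psi_2\rangle\psi_1\big)dt+i\varepsilon\,\psi_1\circ d\beta_1\\ d\psi_2=i\Delta\psi_2\,dt+\frac K2\big(\psi_1-\langle\psi_2,\psi_1\rangle\psi_2\big)dt+i\varepsilon\,\psi_2\circ d\beta_2\end{cases}$$ with initial data $(\psi_{1,0},\psi_{2,0})\in L^2(\mathbb{R}^d,\mathbb{C})\oplus L^2(\mathbb{R}^d,\mathbb{C})$, $\|\psi_{1,0}\|=\|\psi_{2,0}\|=1$. Then $\nu_{K,\varepsilon}$ converges in distribution to the Dirac measure $\delta_0$ when $\varepsilon^2/K\to0$.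
   Context: $(\Omega,\mathcal{F},\mathbb{P})$ is a probability space with a standard complete filtration $\{\mathcal{F}_t\}_{t\ge0}$; $\beta_1,\beta_2$ are independent one-dimensional Brownian motions associated to it. $\langle\psi,\varphi\rangle=\int_{\mathbb{R}^d}\psi\overline{\varphi}\,dx$, $\|\cdot\|$ is the $L^2(\mathbb{R}^d,\mathbb{C})$ norm, $\circ$ is the Stratonovich product. Solutions are the unique adapted processes with paths in $C([0,\infty),L^2(\mathbb{R}^d,\mathbb{C})\oplus L^2(\mathbb{R}^d,\mathbb{C}))$ such that $\phi_j=e^{-i\varepsilon\beta_j}\psi_j$ solve pathwise, in the mild sense (with the group $U(t)=e^{it\Delta}$), the random PDE $\partial_t\phi_j=i\Delta\phi_j+\frac K2\big(e^{-i\varepsilon(\beta_j-\beta_k)}\phi_k-e^{i\varepsilon(\beta_j-\beta_k)}\langle\phi_j,\phi_k\rangle\phi_j\big)$ for $(j,k)\in\{(1,2),(2,1)\}$. It is known that the limit $\nu_{K,\varepsilon}$ exists, does not depend on the initial data, and depends on $(K,\varepsilon)$ only through $\varepsilon^2/K$. *)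

theory Defs
  imports "HOL-Probability.Probability"
begin

section \<open>The Hilbert space of square integrable complex functions\<close>

definition sq_integrable :: "('a::euclidean_space \<Rightarrow> complex) \<Rightarrow> bool" where
  "sq_integrable f \<longleftrightarrow> f \<in> borel_measurable lborel \<and> integrable lborel (\<lambda>x. (cmod (f x))\<^sup>2)"

definition L2_rel :: "('a::euclidean_space \<Rightarrow> complex) \<Rightarrow> ('a \<Rightarrow> complex) \<Rightarrow> bool" where
  "L2_rel f g \<longleftrightarrow> sq_integrable f \<and> sq_integrable g \<and> (AE x in lborel. f x = g x)"

lemma sq_integrable_measurable [measurable_dest]:
  "sq_integrable f \<Longrightarrow> f \<in> borel_measurable lborel"
  by (simp add: sq_integrable_def)

lemma sq_integrable_bound:
  fixes f g h :: "'a::euclidean_space \<Rightarrow> complex"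
  assumes f: "sq_integrable f" and g: "sq_integrable g"
    and h: "h \<in> borel_measurable lborel"
    and le: "\<And>x. (cmod (h x))\<^sup>2 \<le> c * (cmod (f x))\<^sup>2 + d * (cmod (g x))\<^sup>2"
  shows "sq_integrable h"
proof -
  have "integrable lborel (\<lambda>x. c * (cmod (f x))\<^sup>2 + d * (cmod (g x))\<^sup>2)"
    using f g by (auto simp: sq_integrable_def)
  then have "integrable lborel (\<lambda>x. (cmod (h x))\<^sup>2)"
    by (rule Bochner_Integration.integrable_bound)
      (use h in measurable, use le in \<open>auto intro!: AE_I2 order_trans[OF _ abs_ge_self]\<close>)
  with h show ?thesis by (simp add: sq_integrable_def)
qed

lemma sq_integrable_zero: "sq_integrable (\<lambda>_. 0)"
  by (simp add: sq_integrable_def)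

lemma sq_integrable_add:
  assumes f: "sq_integrable f" and g: "sq_integrable g"
  shows "sq_integrable (\<lambda>x. f x + g x)"
proof (rule sq_integrable_bound[OF f g, where c=2 and d=2])
  show "(\<lambda>x. f x + g x) \<in> borel_measurable lborel" using f g by measurable
  fix x
  have "(cmod (f x + g x))\<^sup>2 \<le> (cmod (f x) + cmod (g x))\<^sup>2"
    by (intro power_mono norm_triangle_ineq) auto
  also have "\<dots> \<le> 2 * (cmod (f x))\<^sup>2 + 2 * (cmod (g x))\<^sup>2"
    using sum_squares_bound[of "cmod (f x)" "cmod (g x)"] by (simp add: power2_sum)
  finally show "(cmod (f x + g x))\<^sup>2 \<le> 2 * (cmod (f x))\<^sup>2 + 2 * (cmod (g x))\<^sup>2" .
qed

lemma sq_integrable_mult_bounded: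
  assumes f: "sq_integrable f" and m: "m \<in> borel_measurable lborel"
    and B: "\<And>x. cmod (m x) \<le> B"
  shows "sq_integrable (\<lambda>x. m x * f x)"
proof (rule sq_integrable_bound[OF f f, where c="B\<^sup>2" and d=0])
  show "(\<lambda>x. m x * f x) \<in> borel_measurable lborel" using f m by measurable
  fix x
  have "(cmod (m x))\<^sup>2 \<le> B\<^sup>2" by (intro power_mono B) auto
  then show "(cmod (m x * f x))\<^sup>2 \<le> B\<^sup>2 * (cmod (f x))\<^sup>2 + 0 * (cmod (f x))\<^sup>2"
    by (simp add: norm_mult power_mult_distrib mult_right_mono)
qed

lemma sq_integrable_cmult:
  "sq_integrable f \<Longrightarrow> sq_integrable (\<lambda>x. c * f x)"
  by (rule sq_integrable_mult_bounded[where B="cmod c"]) auto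

lemma borel_measurable_cnj_comp [measurable (raw)]:
  fixes f :: "'b \<Rightarrow> complex"
  assumes "f \<in> borel_measurable N"
  shows "(\<lambda>x. cnj (f x)) \<in> borel_measurable N"
  by (rule borel_measurable_continuous_on[OF _ assms]) (intro continuous_intros)

lemma sq_integrable_integrable_mult_cnj:
  assumes f: "sq_integrable f" and g: "sq_integrable g"
  shows "integrable lborel (\<lambda>x. f x * cnj (g x))"
proof (rule Bochner_Integration.integrable_bound)
  show "integrable lborel (\<lambda>x. (cmod (f x))\<^sup>2 + (cmod (g x))\<^sup>2)"
    using f g by (auto simp: sq_integrable_def)
  have "cmod (f x * cnj (g x)) \<le> norm ((cmod (f x))\<^sup>2 + (cmod (g x))\<^sup>2)" for x
  proof -
    have "2 * (cmod (f x) * cmod (g x)) \<le> (cmod (f x))\<^sup>2 + (cmod (g x))\<^sup>2"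
      using sum_squares_bound[of "cmod (f x)" "cmod (g x)"] by simp
    moreover have "0 \<le> cmod (f x) * cmod (g x)" by simp
    ultimately show ?thesis unfolding norm_mult complex_mod_cnj real_norm_def by linarith
  qed
  then show "AE x in lborel. norm (f x * cnj (g x)) \<le> norm ((cmod (f x))\<^sup>2 + (cmod (g x))\<^sup>2)"
    by simp
qed (use f g in measurable)

quotient_type (overloaded) 'a L2 = "'a::euclidean_space \<Rightarrow> complex" / partial: L2_rel
proof (rule part_equivpI)
  show "\<exists>f. L2_rel f f"
    by (rule exI[of _ "\<lambda>_. 0"]) (simp add: L2_rel_def sq_integrable_zero)
  show "symp L2_rel"
    by (auto simp: symp_def L2_rel_def)
  show "transp L2_rel"
    by (auto simp: transp_def L2_rel_def)
qed

text \<open>The scalar product is linear in its first argument.\<close>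

lift_definition cinner :: "'a::euclidean_space L2 \<Rightarrow> 'a L2 \<Rightarrow> complex"
  is "\<lambda>f g. \<integral>x. f x * cnj (g x) \<partial>lborel"
proof -
  fix f f' g g' :: "'a \<Rightarrow> complex"
  assume *: "L2_rel f f'" "L2_rel g g'"
  then have [measurable]: "f \<in> borel_measurable lborel" "f' \<in> borel_measurable lborel"
      "g \<in> borel_measurable lborel" "g' \<in> borel_measurable lborel"
    by (auto simp: L2_rel_def sq_integrable_def)
  from * have "AE x in lborel. f x = f' x" "AE x in lborel. g x = g' x"
    by (auto simp: L2_rel_def)
  then show "(\<integral>x. f x * cnj (g x) \<partial>lborel) = (\<integral>x. f' x * cnj (g' x) \<partial>lborel)"
    by (intro integral_cong_AE) auto
qed

lift_definition scaleC :: "complex \<Rightarrow> 'a::euclidean_space L2 \<Rightarrow> 'a L2"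
  is "\<lambda>c f x. c * f x"
  by (auto simp: L2_rel_def sq_integrable_cmult)

instantiation L2 :: (euclidean_space) real_vector
begin

lift_definition zero_L2 :: "'a L2" is "\<lambda>_. 0"
  by (simp add: L2_rel_def sq_integrable_zero)

lift_definition plus_L2 :: "'a L2 \<Rightarrow> 'a L2 \<Rightarrow> 'a L2" is "\<lambda>f g x. f x + g x"
  by (auto simp: L2_rel_def sq_integrable_add)

definition "scaleR_L2 r f = scaleC (of_real r) f" for f :: "'a L2"
definition "uminus_L2 f = scaleC (- 1) f" for f :: "'a L2"
definition "minus_L2 f g = f + - g" for f g :: "'a L2"
instance
proof
  fix f g h :: "'a L2" and a b :: real
  show "f + g + h = f + (g + h)"
    by transfer (auto simp: L2_rel_def sq_integrable_add algebra_simps)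
  show "f + g = g + f"
    by transfer (auto simp: L2_rel_def sq_integrable_add algebra_simps)
  show "0 + f = f"
    by transfer (auto simp: L2_rel_def)
  show "- f + f = 0"
    unfolding uminus_L2_def
    by transfer (auto simp: L2_rel_def sq_integrable_zero)
  show "f - g = f + - g" by (simp add: minus_L2_def)
  show "a *\<^sub>R (f + g) = a *\<^sub>R f + a *\<^sub>R g"
    unfolding scaleR_L2_def
    by transfer (auto simp: L2_rel_def distrib_left distrib_right mult.assoc intro!: sq_integrable_add sq_integrable_cmult)
  show "(a + b) *\<^sub>R f = a *\<^sub>R f + b *\<^sub>R f"
    unfolding scaleR_L2_def
    by transfer (auto simp: L2_rel_def distrib_left distrib_right mult.assoc intro!: sq_integrable_add sq_integrable_cmult)
  show "a *\<^sub>R b *\<^sub>R f = (a * b) *\<^sub>R f"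
    unfolding scaleR_L2_def
    by transfer (auto simp: L2_rel_def distrib_left distrib_right mult.assoc intro!: sq_integrable_cmult)
  show "1 *\<^sub>R f = f"
    unfolding scaleR_L2_def by transfer (auto simp: L2_rel_def)
qed

end

instantiation L2 :: (euclidean_space) real_inner
begin

definition "inner_L2 f g = Re (cinner f g)" for f g :: "'a L2"
definition "norm_L2 f = sqrt (Re (cinner f f))" for f :: "'a L2"
definition "sgn_L2 f = f /\<^sub>R norm f" for f :: "'a L2"
definition "dist_L2 f g = norm (f - g)" for f g :: "'a L2"
definition [code del]:
  "(uniformity :: ('a L2 \<times> 'a L2) filter) = (INF e\<in>{0<..}. principal {(x, y). dist x y < e})"
definition [code del]:
  "open (S :: 'a L2 set) \<longleftrightarrow> (\<forall>x\<in>S. \<forall>\<^sub>F (x', y) in uniformity. x' = x \<longrightarrow> y \<in> S)"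

instance
proof
  fix f g h :: "'a L2" and a :: real
  show "dist f g = norm (f - g)" by (simp add: dist_L2_def)
  show "sgn f = f /\<^sub>R norm f" by (simp add: sgn_L2_def)
  show "uniformity = (INF e\<in>{0<..}. principal {(x :: 'a L2, y). dist x y < e})"
    by (simp add: uniformity_L2_def)
  show "open S \<longleftrightarrow> (\<forall>x\<in>S. \<forall>\<^sub>F (x', y) in uniformity. x' = x \<longrightarrow> y \<in> S)" for S :: "'a L2 set"
    by (simp add: open_L2_def)
  show "inner f g = inner g f"
    unfolding inner_L2_def
  proof transfer
    fix f g :: "'a \<Rightarrow> complex"
    have "(\<integral>x. g x * cnj (f x) \<partial>lborel) = (\<integral>x. cnj (f x * cnj (g x)) \<partial>lborel)"
      by (simp add: mult.commute)
    also have "\<dots> = cnj (\<integral>x. f x * cnj (g x) \<partial>lborel)"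
      by (rule Bochner_Integration.integral_cnj)
    finally show "Re (\<integral>x. f x * cnj (g x) \<partial>lborel) = Re (\<integral>x. g x * cnj (f x) \<partial>lborel)"
      by simp
  qed
  show "inner (f + g) h = inner f h + inner g h"
    unfolding inner_L2_def
    by transfer (simp add: L2_rel_def algebra_simps sq_integrable_integrable_mult_cnj)
  show "inner (a *\<^sub>R f) g = a * inner f g"
    unfolding inner_L2_def scaleR_L2_def
    by transfer (simp add: mult.assoc)
  have self: "Re (\<integral>x. f x * cnj (f x) \<partial>lborel) = (\<integral>x. (cmod (f x))\<^sup>2 \<partial>lborel)"
    if "sq_integrable f" for f :: "'a \<Rightarrow> complex"
    using sq_integrable_integrable_mult_cnj[OF that that]
    by (subst integral_Re[symmetric]) (simp_all add: complex_mult_cnj cmod_power2)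
  show "0 \<le> inner f f"
    unfolding inner_L2_def
    by transfer (simp add: self L2_rel_def)
  show "inner f f = 0 \<longleftrightarrow> f = 0"
    unfolding inner_L2_def
  proof transfer
    fix f :: "'a \<Rightarrow> complex"
    assume "L2_rel f f"
    then have f: "sq_integrable f" by (simp add: L2_rel_def)
    then have "(\<integral>x. (cmod (f x))\<^sup>2 \<partial>lborel) = 0 \<longleftrightarrow> (AE x in lborel. (cmod (f x))\<^sup>2 = 0)"
      by (intro integral_nonneg_eq_0_iff_AE) (auto simp: sq_integrable_def)
    with f show "(Re (\<integral>x. f x * cnj (f x) \<partial>lborel) = 0) = L2_rel f (\<lambda>_. 0)"
      by (simp add: self L2_rel_def sq_integrable_zero)
  qed
  show "norm f = sqrt (inner f f)"
    by (simp add: norm_L2_def inner_L2_def)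
qed

end


section \<open>The group generated by \<open>\<i>\<Delta>\<close>\<close>

text \<open>
  The Fourier transform on the whole of \<open>L\<^sup>2\<close> (non-unitary normalisation, kernel
  \<open>exp (- \<i> x \<bullet> \<xi>)\<close>) is the \<open>L\<^sup>2\<close>-limit of the transforms of the truncations to balls.
  Writing the squared \<open>L\<^sup>2\<close> distance as an extended nonnegative integral makes the
  relation meaningful before one knows that the truncated transforms are in \<open>L\<^sup>2\<close>.
\<close>

lift_definition fourier_ball :: "real \<Rightarrow> 'a::euclidean_space L2 \<Rightarrow> 'a \<Rightarrow> complex"
  is "\<lambda>R f \<xi>. \<integral>x\<in>cball 0 R. exp (- \<i> * of_real (x \<bullet> \<xi>)) * f x \<partial>lborel"
proof -
  fix R :: real and f g :: "'a \<Rightarrow> complex"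
  assume "L2_rel f g"
  then have fg: "f \<in> borel_measurable lborel" "g \<in> borel_measurable lborel"
    and eq: "AE x in lborel. f x = g x"
    by (auto simp: L2_rel_def sq_integrable_def)
  have e: "(\<lambda>x::'a. exp (- \<i> * of_real (x \<bullet> \<xi>))) \<in> borel_measurable lborel" for \<xi>
    by simp
  have m: "(\<lambda>x. indicat_real (cball 0 R) x *\<^sub>R (exp (- \<i> * of_real (x \<bullet> \<xi>)) * h x))
      \<in> borel_measurable lborel" if "h \<in> borel_measurable lborel"
    for h :: "'a \<Rightarrow> complex" and \<xi>
    by (intro borel_measurable_scaleR borel_measurable_times e that borel_measurable_indicator) simp
  show "(\<lambda>\<xi>. \<integral>x\<in>cball 0 R. exp (- \<i> * of_real (x \<bullet> \<xi>)) * f x \<partial>lborel) =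
      (\<lambda>\<xi>. \<integral>x\<in>cball 0 R. exp (- \<i> * of_real (x \<bullet> \<xi>)) * g x \<partial>lborel)"
    unfolding set_lebesgue_integral_def
    by (intro ext integral_cong_AE m fg) (use eq in auto)
qed

lift_definition is_fourier_transform :: "'a::euclidean_space L2 \<Rightarrow> 'a L2 \<Rightarrow> bool"
  is "\<lambda>f g. ((\<lambda>R. \<integral>\<^sup>+\<xi>. ennreal ((cmod (fourier_ball R (abs_L2 f) \<xi> - g \<xi>))\<^sup>2) \<partial>lborel)
    \<longlongrightarrow> 0) at_top"
proof -
  fix f f' g g' :: "'a \<Rightarrow> complex"
  assume *: "L2_rel f f'" "L2_rel g g'"
  then have "abs_L2 f = abs_L2 f'"
    using Quotient_L2 by (metis Quotient_rel)
  moreover have "(\<integral>\<^sup>+\<xi>. ennreal ((cmod (F \<xi> - g \<xi>))\<^sup>2) \<partial>lborel) =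
      (\<integral>\<^sup>+\<xi>. ennreal ((cmod (F \<xi> - g' \<xi>))\<^sup>2) \<partial>lborel)" for F :: "'a \<Rightarrow> complex"
    using * by (intro nn_integral_cong_AE) (auto simp: L2_rel_def)
  ultimately show "((\<lambda>R. \<integral>\<^sup>+\<xi>. ennreal ((cmod (fourier_ball R (abs_L2 f) \<xi> - g \<xi>))\<^sup>2) \<partial>lborel)
      \<longlongrightarrow> 0) at_top =
    ((\<lambda>R. \<integral>\<^sup>+\<xi>. ennreal ((cmod (fourier_ball R (abs_L2 f') \<xi> - g' \<xi>))\<^sup>2) \<partial>lborel)
      \<longlongrightarrow> 0) at_top"
    by simp
qed

lift_definition schroedinger_symbol :: "real \<Rightarrow> 'a::euclidean_space L2 \<Rightarrow> 'a L2"
  is "\<lambda>t f \<xi>. exp (- \<i> * of_real (t * (norm \<xi>)\<^sup>2)) * f \<xi>"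
proof -
  fix t :: real and f g :: "'a \<Rightarrow> complex"
  define m where "m = (\<lambda>\<xi>::'a. exp (- \<i> * of_real (t * (norm \<xi>)\<^sup>2)))"
  have "m \<in> borel_measurable lborel" "cmod (m \<xi>) \<le> 1" for \<xi>
    by (simp_all add: m_def)
  note bd = sq_integrable_mult_bounded[OF _ this]
  assume "L2_rel f g"
  then have "L2_rel (\<lambda>\<xi>. m \<xi> * f \<xi>) (\<lambda>\<xi>. m \<xi> * g \<xi>)"
    by (auto simp: L2_rel_def intro: bd)
  then show "L2_rel (\<lambda>\<xi>. exp (- \<i> * of_real (t * (norm \<xi>)\<^sup>2)) * f \<xi>)
      (\<lambda>\<xi>. exp (- \<i> * of_real (t * (norm \<xi>)\<^sup>2)) * g \<xi>)"
    by (simp add: m_def)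
qed

text \<open>
  By Plancherel's theorem the Fourier transform is a bijection of \<open>L\<^sup>2\<close>, so exactly one \<open>g\<close>
  satisfies the description.
\<close>

definition schroedinger_group :: "real \<Rightarrow> 'a::euclidean_space L2 \<Rightarrow> 'a L2" where
  "schroedinger_group t f =
    (THE g. \<exists>h. is_fourier_transform f h \<and> is_fourier_transform g (schroedinger_symbol t h))"


section \<open>Probabilistic setting\<close>

text \<open>The usual conditions; only the \<open>F t\<close> with \<open>t \<ge> 0\<close> are constrained.\<close>

locale stochastic_basis = prob_space M + complete_measure M
  for M :: "'w measure" and F :: "real \<Rightarrow> 'w measure" +
  assumes filtration_subalgebra: "0 \<le> t \<Longrightarrow> subalgebra M (F t)"
    and filtration_mono: "0 \<le> s \<Longrightarrow> s \<le> t \<Longrightarrow> sets (F s) \<subseteq> sets (F t)"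
    and filtration_complete: "null_sets M \<subseteq> sets (F 0)"
    and filtration_right_continuous: "0 \<le> t \<Longrightarrow> sets (F t) = (\<Inter>s\<in>{t<..}. sets (F s))"

definition brownian_motion ::
  "'w measure \<Rightarrow> (real \<Rightarrow> 'w measure) \<Rightarrow> (real \<Rightarrow> 'w \<Rightarrow> real) \<Rightarrow> bool" where
  "brownian_motion M F \<beta> \<longleftrightarrow>
    (\<forall>t\<ge>0. \<beta> t \<in> borel_measurable (F t)) \<and>
    (AE \<omega> in M. \<beta> 0 \<omega> = 0) \<and>
    (AE \<omega> in M. continuous_on {0..} (\<lambda>t. \<beta> t \<omega>)) \<and>
    (\<forall>s t. 0 \<le> s \<and> s < t \<longrightarrow>
      distributed M lborel (\<lambda>\<omega>. \<beta> t \<omega> - \<beta> s \<omega>) (normal_density 0 (sqrt (t - s))) \<and>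
      prob_space.indep_set M (sets (F s))
        {(\<lambda>\<omega>. \<beta> t \<omega> - \<beta> s \<omega>) -` A \<inter> space M | A. A \<in> sets borel})"

definition independent_processes ::
  "'w measure \<Rightarrow> (real \<Rightarrow> 'w \<Rightarrow> real) \<Rightarrow> (real \<Rightarrow> 'w \<Rightarrow> real) \<Rightarrow> bool" where
  "independent_processes M X Y \<longleftrightarrow>
    prob_space.indep_var M
      (PiM {0..} (\<lambda>_. borel)) (\<lambda>\<omega>. \<lambda>t\<in>{0..}. X t \<omega>)
      (PiM {0..} (\<lambda>_. borel)) (\<lambda>\<omega>. \<lambda>t\<in>{0..}. Y t \<omega>)"

text \<open>
  Convergence in distribution along an arbitrary filter. The library's \<^const>\<open>weak_conv_m\<close>
  is only available for sequences; the two notions agree there.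
\<close>

definition conv_in_distribution :: "('i \<Rightarrow> real measure) \<Rightarrow> real measure \<Rightarrow> 'i filter \<Rightarrow> bool" where
  "conv_in_distribution \<mu> \<nu> \<F> \<longleftrightarrow>
    (\<forall>f :: real \<Rightarrow> real. continuous_on UNIV f \<longrightarrow> bounded (range f) \<longrightarrow>
      ((\<lambda>i. \<integral>x. f x \<partial>\<mu> i) \<longlongrightarrow> (\<integral>x. f x \<partial>\<nu>)) \<F>)"

lemma conv_in_distribution_sequentially:
  assumes \<mu>: "\<And>n. real_distribution (\<mu> n)" and \<nu>: "real_distribution \<nu>"
  shows "conv_in_distribution \<mu> \<nu> sequentially \<longleftrightarrow> weak_conv_m \<mu> \<nu>"
proof
  assume *: "conv_in_distribution \<mu> \<nu> sequentially"
  show "weak_conv_m \<mu> \<nu>"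
  proof (rule integral_bdd_continuous_conv_imp_weak_conv[OF \<mu> \<nu>])
    fix f :: "real \<Rightarrow> real"
    assume "\<And>x. isCont f x" "\<And>x. \<bar>f x\<bar> \<le> 1"
    then show "(\<lambda>n. integral\<^sup>L (\<mu> n) f) \<longlonglongrightarrow> integral\<^sup>L \<nu> f"
      using * by (auto simp: conv_in_distribution_def bounded_iff continuous_on_eq_continuous_at)
  qed
next
  assume *: "weak_conv_m \<mu> \<nu>"
  show "conv_in_distribution \<mu> \<nu> sequentially"
    unfolding conv_in_distribution_def
  proof (intro allI impI)
    fix f :: "real \<Rightarrow> real"
    assume cont: "continuous_on UNIV f" and "bounded (range f)"
    then obtain B where B: "\<And>x. norm (f x) \<le> B" by (auto simp: bounded_iff)
    show "(\<lambda>n. integral\<^sup>L (\<mu> n) f) \<longlonglongrightarrow> integral\<^sup>L \<nu> f"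
      by (rule weak_conv_imp_integral_bdd_continuous_conv[OF \<mu> \<nu> * _ B])
        (use cont in \<open>simp add: continuous_on_eq_continuous_at\<close>)
  qed
qed


section \<open>The stochastic Schroedinger--Lohe system\<close>

text \<open>
  \<open>\<partial>\<^sub>t \<phi> = \<i>\<Delta>\<phi> + G\<close> with initial datum \<open>u\<close> in the mild (Duhamel) sense. For a continuous
  integrand the gauge integral coincides with the Bochner integral in \<open>L\<^sup>2\<close>.
\<close>

definition mild_solution ::
  "'a::euclidean_space L2 \<Rightarrow> (real \<Rightarrow> 'a L2) \<Rightarrow> (real \<Rightarrow> 'a L2) \<Rightarrow> bool" where
  "mild_solution u G \<phi> \<longleftrightarrow>
    (\<forall>t\<ge>0. ((\<lambda>s. schroedinger_group (t - s) (G s)) has_integral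
      (\<phi> t - schroedinger_group t u)) {0..t})"

text \<open>Here \<open>\<theta>\<close> stands for \<open>\<epsilon> (\<beta>\<^sub>j - \<beta>\<^sub>k)\<close>, \<open>x\<close> for \<open>\<phi>\<^sub>j\<close> and \<open>y\<close> for \<open>\<phi>\<^sub>k\<close>.\<close>

definition coupling ::
  "real \<Rightarrow> real \<Rightarrow> 'a::euclidean_space L2 \<Rightarrow> 'a L2 \<Rightarrow> 'a L2" where
  "coupling K \<theta> x y =
    (K / 2) *\<^sub>R (scaleC (exp (- \<i> * of_real \<theta>)) y
      - scaleC (exp (\<i> * of_real \<theta>) * cinner x y) x)"

text \<open>
  The Stratonovich equation is understood through the gauge transform
  \<open>\<phi>\<^sub>j = exp (- \<i> \<epsilon> \<beta>\<^sub>j) \<psi>\<^sub>j\<close>, which turns it into a random PDE solved path by path.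
\<close>

definition schroedinger_lohe_solution ::
  "'w measure \<Rightarrow> (real \<Rightarrow> 'w measure) \<Rightarrow> (real \<Rightarrow> 'w \<Rightarrow> real) \<Rightarrow> (real \<Rightarrow> 'w \<Rightarrow> real) \<Rightarrow>
    real \<Rightarrow> real \<Rightarrow> 'a::euclidean_space L2 \<times> 'a L2 \<Rightarrow> (real \<Rightarrow> 'w \<Rightarrow> 'a L2 \<times> 'a L2) \<Rightarrow> bool" where
  "schroedinger_lohe_solution M F \<beta>1 \<beta>2 K \<epsilon> u \<psi> \<longleftrightarrow>
    (\<forall>t\<ge>0. \<psi> t \<in> borel_measurable (F t)) \<and>
    (AE \<omega> in M. continuous_on {0..} (\<lambda>t. \<psi> t \<omega>)) \<and>
    (AE \<omega> in M.
      let \<phi>1 = (\<lambda>t. scaleC (exp (- \<i> * of_real (\<epsilon> * \<beta>1 t \<omega>))) (fst (\<psi> t \<omega>)));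
          \<phi>2 = (\<lambda>t. scaleC (exp (- \<i> * of_real (\<epsilon> * \<beta>2 t \<omega>))) (snd (\<psi> t \<omega>)))
      in mild_solution (fst u) (\<lambda>s. coupling K (\<epsilon> * (\<beta>1 s \<omega> - \<beta>2 s \<omega>)) (\<phi>1 s) (\<phi>2 s)) \<phi>1 \<and>
         mild_solution (snd u) (\<lambda>s. coupling K (\<epsilon> * (\<beta>2 s \<omega> - \<beta>1 s \<omega>)) (\<phi>2 s) (\<phi>1 s)) \<phi>2)"

end

theory Submission
  imports Defs
begin

text \<open>
  Along a solution the vectors \<open>\<psi>\<^sub>1, \<psi>\<^sub>2\<close> keep norm one, so the distance is governed by
  \<open>z = \<langle>\<psi>\<^sub>1, \<psi>\<^sub>2\<rangle>\<close>, which solves the scalar equation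
  \<open>dz = K (1 - z\<^sup>2) dt + \<i> \<epsilon> z \<circ> dB\<close> with \<open>B = \<beta>\<^sub>1 - \<beta>\<^sub>2\<close>; the unitary group drops out because it
  commutes with the coupling. For \<open>\<gamma> = K / \<epsilon>\<^sup>2\<close> the generator maps \<open>- exp (- \<gamma> Re z)\<close> to
  \<open>\<gamma> \<epsilon>\<^sup>2 exp (- \<gamma> x) (\<gamma> (1 - x\<^sup>2) - x)\<close> with \<open>x = Re z\<close>, so the mean of the latter function under the
  limit law is at most zero. Up to the factor \<open>\<gamma> \<epsilon>\<^sup>2\<close> this function is at
  least \<open>- exp (2 - \<gamma>)\<close> everywhere and, if \<open>\<gamma> \<kappa> \<ge> 2\<close>, at least \<open>exp (\<gamma> (\<kappa> - 1))\<close> for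
  \<open>x \<le> 1 - \<kappa>\<close>, so the limit law gives mass at most
  \<open>exp (2 - \<gamma> \<kappa>)\<close> to \<open>x \<le> 1 - \<kappa>\<close>, and this vanishes as \<open>\<gamma> \<rightarrow> \<infinity>\<close>.

  No stochastic integral is needed: convergence in law turns an estimate of a single time step of
  length \<open>h\<close>, with error \<open>O (h\<^bsup>3/2\<^esup>)\<close> uniform in the starting time, into the inequality for the
  limit law after division by \<open>h\<close>.
\<close>


section \<open>The Hilbert space structure\<close>

text \<open>The exponential is dictated by what is known to converge. Only the law of the distance
  has a limit, hence only that of \<open>x = Re z\<close>; nothing is assumed about
  \<open>y = Im z\<close>. In Ito form the generator sends \<open>g(x)\<close> to \<open>(K (1 - x^2
  + y^2) - \<epsilon>^2 x) g' + \<epsilon>^2 y^2 g''\<close>, because \<open>B\<close> has quadratic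
  variation \<open>2 t\<close>. The terms in \<open>y^2\<close> cancel exactly when
  \<open>K g' + \<epsilon>^2 g'' = 0\<close>, which up to constants leaves
  \<open>g = exp(- \<gamma> x)\<close>.

  The scalar equation presupposes that the group is unitary, but the group is a definite description
  over the \<open>L^2\<close> Fourier transform, and this is informative only once the transform is
  known to be a bijection. Hence the need for completeness of \<open>L2\<close>, Plancherel's
  identity and surjectivity. Plancherel amounts to a Gaussian-regularised inversion formula for the
  autocorrelation at the origin, and the continuity required there is exactly that of translations
  in \<open>L^2\<close>.\<close>

lemma L2_cases:
  obtains f where "sq_integrable f" "F = abs_L2 f"
proof -
  have "L2_rel (rep_L2 F) (rep_L2 F)"
    using Quotient_rep_reflp[OF Quotient_L2] .
  moreover have "F = abs_L2 (rep_L2 F)"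
    using Quotient_abs_rep[OF Quotient_L2] by metis
  ultimately show thesis using that by (auto simp: L2_rel_def)
qed

lemma L2_rel_self: "sq_integrable f \<Longrightarrow> L2_rel f f"
  by (simp add: L2_rel_def)

lemma abs_L2_add:
  assumes "sq_integrable f" "sq_integrable g"
  shows "abs_L2 f + abs_L2 g = abs_L2 (\<lambda>x. f x + g x)"
  using assms by (simp add: plus_L2.abs_eq L2_rel_self)

lemma abs_L2_scaleC:
  assumes "sq_integrable f"
  shows "scaleC c (abs_L2 f) = abs_L2 (\<lambda>x. c * f x)"
  using assms by (simp add: scaleC.abs_eq L2_rel_self)

lemma sq_integrable_diff:
  assumes "sq_integrable f" "sq_integrable g"
  shows "sq_integrable (\<lambda>x. f x - g x)"
  using sq_integrable_add[OF assms(1) sq_integrable_cmult[OF assms(2), of "-1"]] by simp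

lemma abs_L2_diff:
  assumes "sq_integrable f" "sq_integrable g"
  shows "abs_L2 f - abs_L2 g = abs_L2 (\<lambda>x. f x - g x)"
  using assms abs_L2_add[OF assms(1) sq_integrable_cmult[OF assms(2), of "-1"]]
  by (simp add: minus_L2_def uminus_L2_def abs_L2_scaleC)
 
lemma abs_L2_cinner:
  assumes "sq_integrable f" "sq_integrable g"
  shows "cinner (abs_L2 f) (abs_L2 g) = (\<integral>x. f x * cnj (g x) \<partial>lborel)"
  using assms by (simp add: cinner.abs_eq L2_rel_self)

section \<open>The complex scalar product and its Cauchy-Schwarz inequality\<close>

lemma cinner_add_left: "cinner (f + g) h = cinner f h + cinner g h"
  by transfer (simp add: L2_rel_def algebra_simps sq_integrable_integrable_mult_cnj)

lemma cinner_scaleC_left: "cinner (scaleC c f) g = c * cinner f g"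
  by transfer (simp add: mult.assoc)

lemma cinner_commute: "cinner g f = cnj (cinner f g)"
proof transfer
  fix f g :: "'a \<Rightarrow> complex"
  have "(\<integral>x. g x * cnj (f x) \<partial>lborel) = (\<integral>x. cnj (f x * cnj (g x)) \<partial>lborel)"
    by (simp add: mult.commute)
  also have "\<dots> = cnj (\<integral>x. f x * cnj (g x) \<partial>lborel)"
    by (rule Bochner_Integration.integral_cnj)
  finally show "(\<integral>x. g x * cnj (f x) \<partial>lborel) = cnj (\<integral>x. f x * cnj (g x) \<partial>lborel)" .
qed

lemma cinner_add_right: "cinner h (f + g) = cinner h f + cinner h g"
  by (metis cinner_add_left cinner_commute complex_cnj_add)

lemma cinner_scaleC_right: "cinner f (scaleC c g) = cnj c * cinner f g"
  by (metis cinner_scaleC_left cinner_commute complex_cnj_mult complex_cnj_cnj)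

lemma cinner_self: "cinner f f = of_real ((norm f)\<^sup>2)"
proof -
  have "Im (cinner f f) = 0"
    using cinner_commute[of f f] by (metis complex_cnj_cancel_iff Reals_cnj_iff complex_is_Real_iff)
  moreover have "Re (cinner f f) = (norm f)\<^sup>2"
    by (metis inner_L2_def power2_norm_eq_inner)
  ultimately show ?thesis by (simp add: complex_eq_iff)
qed

lemma scaleC_scaleC: "scaleC a (scaleC b f) = scaleC (a * b) f"
  by transfer (auto simp: L2_rel_def mult.assoc intro!: sq_integrable_cmult)

lemma scaleC_one: "scaleC 1 f = f"
  by transfer (auto simp: L2_rel_def)

lemma scaleC_add_right: "scaleC a (f + g) = scaleC a f + scaleC a g"
  by transfer (auto simp: L2_rel_def distrib_left intro!: sq_integrable_add sq_integrable_cmult)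

lemma scaleC_add_left: "scaleC (a + b) f = scaleC a f + scaleC b f"
  by transfer (auto simp: L2_rel_def distrib_right intro!: sq_integrable_add sq_integrable_cmult)

lemma scaleR_eq_scaleC: "r *\<^sub>R f = scaleC (of_real r) f" for f :: "'a::euclidean_space L2"
  by (simp add: scaleR_L2_def)

lemma scaleC_scaleR_right: "scaleC a (r *\<^sub>R f) = r *\<^sub>R scaleC a f"
  by (simp add: scaleR_eq_scaleC scaleC_scaleC mult.commute)

lemma scaleC_scaleR_left: "scaleC (r *\<^sub>R a) f = r *\<^sub>R scaleC a f"
  by (simp add: scaleR_eq_scaleC scaleC_scaleC scaleR_conv_of_real)

lemma norm_scaleC: "norm (scaleC c f) = cmod c * norm f"
proof -
  have "complex_of_real ((norm (scaleC c f))\<^sup>2) = of_real ((cmod c * norm f)\<^sup>2)"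
    unfolding cinner_self[symmetric] cinner_scaleC_left cinner_scaleC_right
    using complex_norm_square[of c] by (simp add: cinner_self power_mult_distrib mult.commute)
  then have "(norm (scaleC c f))\<^sup>2 = (cmod c * norm f)\<^sup>2"
    using of_real_eq_iff by blast
  then show ?thesis by (simp add: power2_eq_iff_nonneg)
qed

text \<open>Multiplying \<open>f\<close> by the conjugate phase of the product makes the product
  real and nonnegative, which reduces the claim to the real Cauchy-Schwarz inequality.\<close>

lemma norm_cinner_le: "cmod (cinner f g) \<le> norm f * norm g"
proof -
  define c where "c = cnj (sgn (cinner f g))"
  have "cmod c \<le> 1" by (simp add: c_def norm_sgn)
  have "c * cinner f g = of_real (cmod (cinner f g))"
  proof (cases "cinner f g = 0")
    case False
    then show ?thesis
      by (simp add: c_def sgn_eq complex_norm_square[symmetric] power2_eq_square mult.commute)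
  qed simp
  then have "cmod (cinner f g) = Re (cinner (scaleC c f) g)"
    by (simp add: cinner_scaleC_left)
  also have "\<dots> \<le> norm (scaleC c f) * norm g"
    using norm_cauchy_schwarz[of "scaleC c f" g] by (simp add: inner_L2_def)
  also have "\<dots> \<le> norm f * norm g"
    using \<open>cmod c \<le> 1\<close> by (simp add: norm_scaleC mult_right_mono mult_left_le_one_le)
  finally show ?thesis .
qed

lemma bounded_bilinear_cinner: "bounded_bilinear cinner"
proof (rule bounded_bilinear.intro)
  show "\<exists>K. \<forall>a b. norm (cinner a b) \<le> norm a * norm b * K"
    using norm_cinner_le by (metis mult.right_neutral)
qed (simp_all add: cinner_add_left cinner_add_right scaleR_eq_scaleC cinner_scaleC_left
    cinner_scaleC_right scaleR_conv_of_real)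

lemma bounded_bilinear_scaleC: "bounded_bilinear scaleC"
proof (rule bounded_bilinear.intro)
  show "\<exists>K. \<forall>a b. norm (scaleC a b) \<le> norm a * norm b * K"
    by (intro exI[of _ 1]) (simp add: norm_scaleC)
qed (simp_all add: scaleC_add_left scaleC_add_right scaleC_scaleR_left scaleC_scaleR_right)

section \<open>Norms as integrals, and completeness of \<open>L2\<close>\<close>

lemma norm_abs_L2:
  assumes "sq_integrable f"
  shows "(norm (abs_L2 f))\<^sup>2 = (\<integral>x. (cmod (f x))\<^sup>2 \<partial>lborel)"
proof -
  have "complex_of_real ((norm (abs_L2 f))\<^sup>2) = (\<integral>x. f x * cnj (f x) \<partial>lborel)"
    using assms by (simp only: cinner_self[symmetric] abs_L2_cinner)
  also have "\<dots> = (\<integral>x. complex_of_real ((cmod (f x))\<^sup>2) \<partial>lborel)"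
    by (intro Bochner_Integration.integral_cong refl) (simp add: complex_norm_square[symmetric])
  also have "\<dots> = of_real (\<integral>x. (cmod (f x))\<^sup>2 \<partial>lborel)"
    by (rule integral_complex_of_real)
  finally show ?thesis using of_real_eq_iff by blast
qed

lemma nn_integral_abs_L2:
  assumes "sq_integrable f"
  shows "(\<integral>\<^sup>+x. ennreal ((cmod (f x))\<^sup>2) \<partial>lborel) = ennreal ((norm (abs_L2 f))\<^sup>2)"
  using assms by (simp add: norm_abs_L2 nn_integral_eq_integral sq_integrable_def)

lemma nn_integral_abs_L2_diff:
  assumes "sq_integrable f" "sq_integrable g"
  shows "(\<integral>\<^sup>+x. ennreal ((cmod (f x - g x))\<^sup>2) \<partial>lborel) = ennreal ((norm (abs_L2 f - abs_L2 g))\<^sup>2)"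
  using nn_integral_abs_L2[OF sq_integrable_diff[OF assms]] assms by (simp add: abs_L2_diff)

lemma sq_integrableI_nn_integral:
  assumes "f \<in> borel_measurable lborel" "(\<integral>\<^sup>+x. ennreal ((cmod (f x))\<^sup>2) \<partial>lborel) < \<infinity>"
  shows "sq_integrable f"
  using assms by (auto simp: sq_integrable_def integrable_iff_bounded)

text \<open>On a space of infinite measure \<open>L^2\<close> bounds give no \<open>L^1\<close>
  bounds that could be summed directly. The weights \<open>2^k\<close> still leave a summable series
  of integrals, and the pointwise inequality \<open>2 |d| \<le> (1/2)^k + 2^k |d|^2\<close> turns
  finiteness of the weighted squares into absolute convergence.\<close>

lemma AE_summable_of_weighted_squares:
  fixes d :: "nat \<Rightarrow> 'b \<Rightarrow> complex"
  assumes meas: "\<And>k. d k \<in> borel_measurable N"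
    and le: "\<And>k. (\<integral>\<^sup>+x. ennreal ((cmod (d k x))\<^sup>2) \<partial>N) \<le> ennreal ((1/4) ^ k)"
  shows "AE x in N. summable (\<lambda>k. d k x)"
proof -
  note meas [measurable]
  have "(\<integral>\<^sup>+x. (\<Sum>k. ennreal (2 ^ k * (cmod (d k x))\<^sup>2)) \<partial>N)
      = (\<Sum>k. \<integral>\<^sup>+x. ennreal (2 ^ k * (cmod (d k x))\<^sup>2) \<partial>N)"
    by (rule nn_integral_suminf) measurable
  also have "\<dots> \<le> (\<Sum>k. ennreal ((1/2) ^ k))"
  proof (intro suminf_le summableI)
    fix k
    have "(\<integral>\<^sup>+x. ennreal (2 ^ k * (cmod (d k x))\<^sup>2) \<partial>N)
        = ennreal (2 ^ k) * (\<integral>\<^sup>+x. ennreal ((cmod (d k x))\<^sup>2) \<partial>N)"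
      by (simp add: ennreal_mult nn_integral_cmult)
    also have "\<dots> \<le> ennreal (2 ^ k) * ennreal ((1/4) ^ k)"
      by (intro mult_left_mono le) auto
    also have "\<dots> = ennreal ((1/2) ^ k)"
      by (simp add: ennreal_mult[symmetric] power_mult_distrib[symmetric])
    finally show "(\<integral>\<^sup>+x. ennreal (2 ^ k * (cmod (d k x))\<^sup>2) \<partial>N) \<le> ennreal ((1/2) ^ k)" .
  qed
  also have "\<dots> < \<infinity>"
  proof -
    have "(\<Sum>k. ennreal ((1/2::real) ^ k)) = ennreal (\<Sum>k. (1/2) ^ k)"
      by (rule suminf_ennreal2) (auto intro: summable_geometric)
    then show ?thesis by simp
  qed
  finally have "AE x in N. (\<Sum>k. ennreal (2 ^ k * (cmod (d k x))\<^sup>2)) \<noteq> \<infinity>"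
    by (intro nn_integral_PInf_AE) auto
  then show ?thesis
  proof eventually_elim
    fix x assume "(\<Sum>k. ennreal (2 ^ k * (cmod (d k x))\<^sup>2)) \<noteq> \<infinity>"
    then have "summable (\<lambda>k. 2 ^ k * (cmod (d k x))\<^sup>2)"
      by (intro summable_suminf_not_top) auto
    then have s: "summable (\<lambda>k. (1/2) ^ k + 2 ^ k * (cmod (d k x))\<^sup>2)"
      by (intro summable_add summable_geometric) auto
    show "summable (\<lambda>k. d k x)"
    proof (rule summable_comparison_test'[OF s, where N=0])
      fix k
      define p :: real where "p = (1/2) ^ k"
      have p: "p > 0" "2 ^ k = 1 / p" by (auto simp: p_def power_divide)
      let ?c = "cmod (d k x)"
      have "0 \<le> (p - ?c)\<^sup>2 / p" using p by simp
      also have "(p - ?c)\<^sup>2 / p = p - 2 * ?c + ?c\<^sup>2 / p"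
        using p by (simp add: field_simps power2_eq_square)
      finally have "2 * ?c \<le> p + 1 / p * ?c\<^sup>2" by simp
      moreover have "0 \<le> ?c" by simp
      ultimately show "norm (d k x) \<le> (1/2) ^ k + 2 ^ k * (cmod (d k x))\<^sup>2"
        unfolding p(2) p_def[symmetric] by linarith
    qed
  qed
qed

text \<open>Riesz-Fischer: a subsequence with steps below \<open>(1/2)^k\<close> converges almost
  everywhere, and Fatou's lemma turns this into norm convergence of the whole sequence. Completeness
  serves twice, for the limit defining the Fourier transform and for the calculus of primitives with
  values in \<open>L2\<close>.\<close>

lemma L2_Cauchy_convergent:
  fixes X :: "nat \<Rightarrow> 'a::euclidean_space L2"
  assumes "Cauchy X"
  shows "convergent X"
proof -
  have "\<exists>f. sq_integrable f \<and> X n = abs_L2 f" for n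
    by (meson L2_cases)
  then obtain f where f: "\<And>n. sq_integrable (f n)" and Xf: "\<And>n. X n = abs_L2 (f n)"
    by metis
  have fm [measurable]: "f n \<in> borel_measurable borel" for n
    using f[of n] by (simp add: sq_integrable_def)
  have nn: "(\<integral>\<^sup>+x. ennreal ((cmod (f m x - f n x))\<^sup>2) \<partial>lborel) = ennreal ((dist (X m) (X n))\<^sup>2)" for m n
    by (simp add: nn_integral_abs_L2_diff[OF f f] Xf dist_norm)
  have "\<exists>N. \<forall>m\<ge>N. \<forall>n\<ge>N. dist (X m) (X n) < (1/2) ^ k" for k
    using assms by (auto simp: Cauchy_def)
  then obtain N where N: "\<And>k m n. m \<ge> N k \<Longrightarrow> n \<ge> N k \<Longrightarrow> dist (X m) (X n) < (1/2) ^ k"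
    by metis
  \<comment> \<open>\<open>N\<close> need not be monotone; the partial sums dominate every
    \<open>N i\<close> with \<open>i \<le> k\<close> at once, so that indices beyond stage
    \<open>k\<close> stay beyond it.\<close>
  define r where "r k = (\<Sum>i\<le>k. N i)" for k
  have rN: "N k \<le> r k" for k unfolding r_def by (rule member_le_sum) auto
  have rN': "N k \<le> r j" if "k \<le> j" for k j unfolding r_def by (rule member_le_sum) (use that in auto)
  define d where "d k x = f (r (Suc k)) x - f (r k) x" for k x
  have "AE x in lborel. summable (\<lambda>k. d k x)"
  proof (rule AE_summable_of_weighted_squares)
    show "d k \<in> borel_measurable lborel" for k unfolding d_def by measurable
    fix k
    have "dist (X (r (Suc k))) (X (r k)) < (1/2) ^ k"
      using N rN' by auto
    then have "(dist (X (r (Suc k))) (X (r k)))\<^sup>2 \<le> ((1/2) ^ k)\<^sup>2"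
      by (intro power_mono) auto
    also have "\<dots> = ((1/2)\<^sup>2) ^ k" by (simp only: power_mult[symmetric] mult.commute)
    also have "\<dots> = (1/4) ^ k" by (simp add: power2_eq_square)
    finally show "(\<integral>\<^sup>+x. ennreal ((cmod (d k x))\<^sup>2) \<partial>lborel) \<le> ennreal ((1/4) ^ k)"
      unfolding d_def nn by (intro ennreal_leI)
  qed
  then have conv: "AE x in lborel. convergent (\<lambda>n. f (r n) x)"
  proof eventually_elim
    fix x assume "summable (\<lambda>k. d k x)"
    then have "(\<lambda>n. (\<Sum>k<n. d k x) + f (r 0) x) \<longlonglongrightarrow> (\<Sum>k. d k x) + f (r 0) x"
      by (intro tendsto_add summable_LIMSEQ) auto
    moreover have "(\<Sum>k<n. d k x) = f (r n) x - f (r 0) x" for n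
      unfolding d_def by (rule sum_lessThan_telescope)
    ultimately show "convergent (\<lambda>n. f (r n) x)"
      by (auto simp: convergent_def)
  qed
  define g where "g x = lim (\<lambda>n. f (r n) x)" for x
  have gm [measurable]: "g \<in> borel_measurable borel"
    unfolding g_def by (rule borel_measurable_lim_metric) measurable
  have le: "(\<integral>\<^sup>+x. ennreal ((cmod (g x - f m x))\<^sup>2) \<partial>lborel) \<le> ennreal (((1/2) ^ k)\<^sup>2)" if "m \<ge> N k" for m k
  proof -
    have "(\<integral>\<^sup>+x. ennreal ((cmod (g x - f m x))\<^sup>2) \<partial>lborel)
        = (\<integral>\<^sup>+x. liminf (\<lambda>n. ennreal ((cmod (f (r n) x - f m x))\<^sup>2)) \<partial>lborel)"
    proof (rule nn_integral_cong_AE, use conv in eventually_elim)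
      fix x assume "convergent (\<lambda>n. f (r n) x)"
      then have "(\<lambda>n. f (r n) x) \<longlonglongrightarrow> g x" by (simp add: g_def convergent_LIMSEQ_iff)
      then have "(\<lambda>n. ennreal ((cmod (f (r n) x - f m x))\<^sup>2)) \<longlonglongrightarrow> ennreal ((cmod (g x - f m x))\<^sup>2)"
        by (intro tendsto_intros)
      then show "ennreal ((cmod (g x - f m x))\<^sup>2) = liminf (\<lambda>n. ennreal ((cmod (f (r n) x - f m x))\<^sup>2))"
        by (metis lim_imp_Liminf trivial_limit_sequentially)
    qed
    also have "\<dots> \<le> liminf (\<lambda>n. \<integral>\<^sup>+x. ennreal ((cmod (f (r n) x - f m x))\<^sup>2) \<partial>lborel)"
      by (rule nn_integral_liminf) measurable
    also have "\<dots> = liminf (\<lambda>n. ennreal ((dist (X (r n)) (X m))\<^sup>2))" by (simp only: nn)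
    also have "\<dots> \<le> liminf (\<lambda>n. ennreal (((1/2) ^ k)\<^sup>2))"
    proof (rule Liminf_mono)
      show "\<forall>\<^sub>F n in sequentially. ennreal ((dist (X (r n)) (X m))\<^sup>2) \<le> ennreal (((1/2) ^ k)\<^sup>2)"
        using eventually_ge_at_top[of k]
      proof eventually_elim
        fix n assume "k \<le> n"
        then have "dist (X (r n)) (X m) < (1/2) ^ k" using N[OF rN' that] by blast
        then show "ennreal ((dist (X (r n)) (X m))\<^sup>2) \<le> ennreal (((1/2) ^ k)\<^sup>2)"
          by (intro ennreal_leI power_mono) auto
      qed
    qed
    also have "\<dots> = ennreal (((1/2) ^ k)\<^sup>2)" by (simp add: Liminf_const)
    finally show ?thesis .
  qed
  \<comment> \<open>\<open>g\<close> itself is not yet known to be square integrable; its difference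
    from one member of the sequence is, by the Fatou bound with \<open>k = 0\<close>.\<close>
  have "sq_integrable (\<lambda>x. g x - f (N 0) x)"
    by (rule sq_integrableI_nn_integral) (use le[of 0 "N 0"] in \<open>auto simp: order_le_less_trans\<close>)
  from sq_integrable_add[OF this f[of "N 0"]] have g: "sq_integrable g" by simp
  have "X \<longlonglongrightarrow> abs_L2 g"
  proof (rule metric_LIMSEQ_I)
    fix e :: real assume "0 < e"
    then obtain k where k: "(1/2) ^ k < e" using real_arch_pow_inv[of e "1/2"] by auto
    have "dist (X m) (abs_L2 g) < e" if "m \<ge> N k" for m
    proof -
      have "ennreal ((norm (abs_L2 g - X m))\<^sup>2) \<le> ennreal (((1/2) ^ k)\<^sup>2)"
        using le[OF that] nn_integral_abs_L2_diff[OF g f[of m]] Xf[of m] by simp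
      then have "(norm (abs_L2 g - X m))\<^sup>2 \<le> ((1/2) ^ k)\<^sup>2" by (simp add: ennreal_le_iff)
      then have "norm (abs_L2 g - X m) \<le> (1/2) ^ k"
        by (rule power2_le_imp_le) auto
      then show ?thesis using k by (simp add: dist_norm norm_minus_commute)
    qed
    then show "\<exists>no. \<forall>n\<ge>no. dist (X n) (abs_L2 g) < e" by blast
  qed
  then show ?thesis by (auto simp: convergent_def)
qed

instance L2 :: (euclidean_space) banach
  by standard (rule L2_Cauchy_convergent)


section \<open>Continuity of translations\<close>

lemma lborel_integral_translate:
  fixes f :: "'a::euclidean_space \<Rightarrow> 'b::{banach, second_countable_topology}"
  assumes "f \<in> borel_measurable borel"
  shows "(\<integral>x. f (v + x) \<partial>lborel) = (\<integral>x. f x \<partial>lborel)"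
proof -
  have "(\<integral>x. f x \<partial>lborel) = (\<integral>x. f x \<partial>distr lborel borel ((+) v))"
    by (simp add: lborel_distr_plus)
  also have "\<dots> = (\<integral>x. f (v + x) \<partial>lborel)"
    by (rule integral_distr) (use assms in auto)
  finally show ?thesis by simp
qed

lemma lborel_integrable_translate:
  fixes f :: "'a::euclidean_space \<Rightarrow> 'b::{banach, second_countable_topology}"
  assumes "integrable lborel f"
  shows "integrable lborel (\<lambda>x. f (v + x))"
proof -
  have "integrable (distr lborel borel ((+) v)) f"
    using assms by (simp add: lborel_distr_plus)
  then show ?thesis
    by (subst (asm) integrable_distr_eq) (use borel_measurable_integrable[OF assms] in auto)
qed

text \<open>An \<open>L^1\<close> quantity, so that induction over integrable functions applies;
  \<open>L^2\<close> is reached afterwards through the map sending \<open>u\<close> to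
  \<open>|u| u\<close>.\<close>

definition translation_modulus ::
  "('a::euclidean_space \<Rightarrow> 'b::{banach, second_countable_topology}) \<Rightarrow> 'a \<Rightarrow> real" where
  "translation_modulus f v = (\<integral>x. norm (f (v + x) - f x) \<partial>lborel)"

lemma translation_modulus_nonneg: "0 \<le> translation_modulus f v"
  by (simp add: translation_modulus_def)

text \<open>Translation invariance makes the translated approximation error equal to the
  untranslated one, whence the factor 2.\<close>

lemma translation_modulus_le:
  fixes f g :: "'a::euclidean_space \<Rightarrow> 'b::{banach, second_countable_topology}"
  assumes f: "integrable lborel f" and g: "integrable lborel g"
  shows "translation_modulus f v \<le> translation_modulus g v + 2 * (\<integral>x. norm (f x - g x) \<partial>lborel)"
proof -
  note fv = lborel_integrable_translate[OF f, of v] and gv = lborel_integrable_translate[OF g, of v]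
  have "translation_modulus f v
      \<le> (\<integral>x. norm (g (v + x) - g x) + (norm (f (v + x) - g (v + x)) + norm (f x - g x)) \<partial>lborel)"
    unfolding translation_modulus_def
  proof (rule integral_mono)
    fix x
    have "f (v + x) - f x = (g (v + x) - g x) + ((f (v + x) - g (v + x)) - (f x - g x))" by simp
    then have "norm (f (v + x) - f x)
        \<le> norm (g (v + x) - g x) + norm ((f (v + x) - g (v + x)) - (f x - g x))"
      by (metis norm_triangle_ineq)
    also have "norm ((f (v + x) - g (v + x)) - (f x - g x))
        \<le> norm (f (v + x) - g (v + x)) + norm (f x - g x)"
      by (rule norm_triangle_ineq4)
    finally show "norm (f (v + x) - f x)
        \<le> norm (g (v + x) - g x) + (norm (f (v + x) - g (v + x)) + norm (f x - g x))" by simp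
  qed (intro Bochner_Integration.integrable_add Bochner_Integration.integrable_diff
      integrable_norm f g fv gv)+
  also have "\<dots> = translation_modulus g v
      + ((\<integral>x. norm (f (v + x) - g (v + x)) \<partial>lborel) + (\<integral>x. norm (f x - g x) \<partial>lborel))"
    unfolding translation_modulus_def
    by (subst Bochner_Integration.integral_add Bochner_Integration.integral_add;
      (intro Bochner_Integration.integrable_add Bochner_Integration.integrable_diff
      integrable_norm f g fv gv)?)+ simp
  also have "(\<integral>x. norm (f (v + x) - g (v + x)) \<partial>lborel) = (\<integral>x. norm (f x - g x) \<partial>lborel)"
    by (rule lborel_integral_translate[where f="\<lambda>x. norm (f x - g x)"])
      (use borel_measurable_integrable[OF f] borel_measurable_integrable[OF g] in measurable)
  finally show ?thesis by simp
qed

text \<open>Functions whose modulus vanishes along \<open>v\<close> form an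
  \<open>L^1\<close>-closed set. This carries the claim from open sets to measurable sets and then
  to limits of simple functions.\<close>

lemma translation_modulus_approx:
  fixes f :: "'a::euclidean_space \<Rightarrow> 'b::{banach, second_countable_topology}"
  assumes f: "integrable lborel f"
    and approx: "\<And>e. e > 0 \<Longrightarrow> \<exists>g. integrable lborel g \<and>
      (\<lambda>n. translation_modulus g (v n)) \<longlonglongrightarrow> 0 \<and> (\<integral>x. norm (f x - g x) \<partial>lborel) \<le> e"
  shows "(\<lambda>n. translation_modulus f (v n)) \<longlonglongrightarrow> 0"
proof (rule LIMSEQ_I)
  fix e :: real assume "e > 0"
  then obtain g where g: "integrable lborel g" "(\<lambda>n. translation_modulus g (v n)) \<longlonglongrightarrow> 0"
    and le: "(\<integral>x. norm (f x - g x) \<partial>lborel) \<le> e / 4"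
    using approx[of "e / 4"] by auto
  obtain N where N: "\<And>n. n \<ge> N \<Longrightarrow> norm (translation_modulus g (v n) - 0) < e / 2"
    using LIMSEQ_D[OF g(2), of "e / 2"] \<open>e > 0\<close> by auto
  show "\<exists>no. \<forall>n\<ge>no. norm (translation_modulus f (v n) - 0) < e"
  proof (intro exI allI impI)
    fix n assume "n \<ge> N"
    from N[OF this] translation_modulus_le[OF f g(1), of "v n"] le
    show "norm (translation_modulus f (v n) - 0) < e"
      using translation_modulus_nonneg[of f "v n"] by auto
  qed
qed

lemma integrable_indicator_scaleR:
  fixes c :: "'b::{banach, second_countable_topology}"
  assumes "A \<in> sets N" "emeasure N A < \<infinity>"
  shows "integrable N (\<lambda>x. indicat_real A x *\<^sub>R c)"
  using assms by (intro integrable_scaleR_left integrable_real_indicator) auto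

text \<open>At a point of an open set all small translates remain inside, whereas at a boundary
  point nothing is known. So only the positive part of \<open>1_U(x) - 1_U(v + x)\<close> converges
  pointwise; since both indicators have the same integral, it accounts for exactly half of the
  modulus.\<close>

lemma translation_modulus_open:
  fixes c :: "'b::{banach, second_countable_topology}"
  assumes U: "open U" "emeasure lborel U < \<infinity>" and v: "v \<longlonglongrightarrow> (0::'a::euclidean_space)"
  shows "(\<lambda>n. translation_modulus (\<lambda>x. indicat_real U x *\<^sub>R c) (v n)) \<longlonglongrightarrow> 0"
proof -
  let ?i = "indicat_real U"
  have meas [measurable]: "U \<in> sets borel" using U by simp
  have int: "integrable lborel ?i" using U by (intro integrable_real_indicator) auto
  have intv: "integrable lborel (\<lambda>x. ?i (w + x))" for w
    by (rule lborel_integrable_translate[OF int])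
  have eq: "translation_modulus (\<lambda>x. ?i x *\<^sub>R c) w
      = (2 * (\<integral>x. max 0 (?i x - ?i (w + x)) \<partial>lborel)) * norm c" for w
  proof -
    have "translation_modulus (\<lambda>x. ?i x *\<^sub>R c) w = (\<integral>x. \<bar>?i (w + x) - ?i x\<bar> * norm c \<partial>lborel)"
      unfolding translation_modulus_def by (simp add: scaleR_diff_left[symmetric])
    also have "\<dots> = (\<integral>x. \<bar>?i (w + x) - ?i x\<bar> \<partial>lborel) * norm c"
      by (rule integral_mult_left_zero)
    also have "(\<integral>x. \<bar>?i (w + x) - ?i x\<bar> \<partial>lborel)
        = (\<integral>x. 2 * max 0 (?i x - ?i (w + x)) + (?i (w + x) - ?i x) \<partial>lborel)"
      by (intro Bochner_Integration.integral_cong refl) (simp add: abs_real_def max_def)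
    also have "\<dots> = 2 * (\<integral>x. max 0 (?i x - ?i (w + x)) \<partial>lborel)
        + ((\<integral>x. ?i (w + x) \<partial>lborel) - (\<integral>x. ?i x \<partial>lborel))"
      using int intv[of w]
      by (subst Bochner_Integration.integral_add) (auto intro!: Bochner_Integration.integrable_diff Bochner_Integration.integrable_max)
    also have "(\<integral>x. ?i (w + x) \<partial>lborel) = (\<integral>x. ?i x \<partial>lborel)"
      by (rule lborel_integral_translate) simp
    finally show ?thesis by simp
  qed
  have "(\<lambda>n. \<integral>x. max 0 (?i x - ?i (v n + x)) \<partial>lborel) \<longlonglongrightarrow> (\<integral>x. 0 \<partial>(lborel :: 'a measure))"
  proof (rule integral_dominated_convergence[where w="?i"])
    show "AE x in lborel. (\<lambda>n. max 0 (?i x - ?i (v n + x))) \<longlonglongrightarrow> 0"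
    proof (intro AE_I2)
      fix x
      show "(\<lambda>n. max 0 (?i x - ?i (v n + x))) \<longlonglongrightarrow> 0"
      proof (cases "x \<in> U")
        case True
        have "(\<lambda>n. v n + x) \<longlonglongrightarrow> 0 + x" by (intro tendsto_intros v)
        then have "\<forall>\<^sub>F n in sequentially. v n + x \<in> U"
          using True U(1) by (auto simp: tendsto_def)
        then have "\<forall>\<^sub>F n in sequentially. max 0 (?i x - ?i (v n + x)) = 0"
          by eventually_elim (use True in auto)
        then show ?thesis by (rule tendsto_eventually)
      next
        case False
        then have "max 0 (?i x - ?i (v n + x)) = 0" for n by (auto simp: indicator_def)
        then show ?thesis by simp
      qed
    qed
    show "AE x in lborel. norm (max 0 (?i x - ?i (v n + x))) \<le> ?i x" for n
      by (auto simp: indicator_def)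
  qed (use int in \<open>auto intro!: borel_measurable_max\<close>)
  then have "(\<lambda>n. (2 * (\<integral>x. max 0 (?i x - ?i (v n + x)) \<partial>lborel)) * norm c) \<longlonglongrightarrow> (2 * 0) * norm c"
    by (intro tendsto_intros) simp
  then show ?thesis by (simp add: eq)
qed

lemma translation_modulus_tendsto:
  fixes f :: "'a::euclidean_space \<Rightarrow> 'b::{banach, second_countable_topology}"
  assumes "integrable lborel f" and v: "v \<longlonglongrightarrow> 0"
  shows "(\<lambda>n. translation_modulus f (v n)) \<longlonglongrightarrow> 0"
  using assms(1)
proof (induct rule: integrable_induct)
  case (base A c)
  show ?case
  proof (rule translation_modulus_approx)
    show "integrable lborel (\<lambda>x. indicat_real A x *\<^sub>R c)"
      using base by (rule integrable_indicator_scaleR)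
    fix e :: real assume "e > 0"
    \<comment> \<open>The 1 added to \<open>norm c\<close> keeps the quotient positive for
      \<open>c = 0\<close>.\<close>
    define e' where "e' = e / (norm c + 1)"
    have "e' > 0" using \<open>e > 0\<close> by (auto simp: e'_def intro!: divide_pos_pos add_nonneg_pos)
    have Al: "A \<in> sets lebesgue" using base by (simp add: sets_completionI_sets)
    \<comment> \<open>Outer regularity: the open set exceeds \<open>A\<close> by little measure,
      hence its indicator is close in \<open>L^1\<close>.\<close>
    obtain U where U: "open U" "A \<subseteq> U" "emeasure lebesgue (U - A) < ennreal e'"
      using sets_lebesgue_outer_open[OF Al \<open>e' > 0\<close>] by metis
    have [measurable]: "U \<in> sets borel" "A \<in> sets borel" using U base by auto
    have eUA: "emeasure lborel (U - A) < ennreal e'"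
      using U(3) by (simp add: emeasure_completion)
    have "emeasure lborel U = emeasure lborel A + emeasure lborel (U - A)"
      using U by (subst plus_emeasure) (auto intro!: arg_cong[where f="emeasure lborel"])
    also have "\<dots> < \<infinity>" 
      using base less_trans[OF eUA ennreal_less_top] by simp
    finally have Ufin: "emeasure lborel U < \<infinity>" .
    show "\<exists>g. integrable lborel g \<and> (\<lambda>n. translation_modulus g (v n)) \<longlonglongrightarrow> 0
        \<and> (\<integral>x. norm (indicat_real A x *\<^sub>R c - g x) \<partial>lborel) \<le> e"
    proof (intro exI conjI)
      show "integrable lborel (\<lambda>x. indicat_real U x *\<^sub>R c)"
        using Ufin by (intro integrable_indicator_scaleR) auto
      show "(\<lambda>n. translation_modulus (\<lambda>x. indicat_real U x *\<^sub>R c) (v n)) \<longlonglongrightarrow> 0"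
        by (rule translation_modulus_open[OF U(1) Ufin v])
      have "(\<integral>x. norm (indicat_real A x *\<^sub>R c - indicat_real U x *\<^sub>R c) \<partial>lborel)
          = (\<integral>x. indicat_real (U - A) x * norm c \<partial>lborel)"
        using U(2) by (intro Bochner_Integration.integral_cong) (auto simp: indicator_def scaleR_diff_left[symmetric])
      also have "\<dots> = measure lborel (U - A) * norm c" by simp
      also have "\<dots> \<le> e' * norm c"
        using eUA \<open>e' > 0\<close> by (intro mult_right_mono) (auto simp: measure_def enn2real_leI less_imp_le)
      also have "\<dots> \<le> e"
        using \<open>e > 0\<close> by (simp add: e'_def divide_simps add_nonneg_pos)
      finally show "(\<integral>x. norm (indicat_real A x *\<^sub>R c - indicat_real U x *\<^sub>R c) \<partial>lborel) \<le> e" .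
    qed
  qed
next
  case (add f g)
  have le: "translation_modulus (\<lambda>x. f x + g x) w \<le> translation_modulus f w + translation_modulus g w" for w
  proof -
    note i = lborel_integrable_translate[OF add(1), of w] lborel_integrable_translate[OF add(3), of w] add(1,3)
    have "translation_modulus (\<lambda>x. f x + g x) w
        \<le> (\<integral>x. norm (f (w + x) - f x) + norm (g (w + x) - g x) \<partial>lborel)"
      unfolding translation_modulus_def
    proof (rule integral_mono)
      show "norm (f (w + x) + g (w + x) - (f x + g x)) \<le> norm (f (w + x) - f x) + norm (g (w + x) - g x)" for x
        by (rule norm_diff_triangle_ineq)
    qed (intro integrable_norm Bochner_Integration.integrable_add Bochner_Integration.integrable_diff i)+
    also have "\<dots> = translation_modulus f w + translation_modulus g w"
      unfolding translation_modulus_def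
      by (rule Bochner_Integration.integral_add) (intro integrable_norm Bochner_Integration.integrable_diff i)+
    finally show ?thesis .
  qed
  have "(\<lambda>n. translation_modulus f (v n) + translation_modulus g (v n)) \<longlonglongrightarrow> 0 + 0"
    by (intro tendsto_add add)
  then have lim: "(\<lambda>n. translation_modulus f (v n) + translation_modulus g (v n)) \<longlonglongrightarrow> 0" by simp
  show ?case
    by (rule tendsto_sandwich[OF _ _ tendsto_const lim])
      (auto intro!: always_eventually le translation_modulus_nonneg)
next
  case (lim f s)
  show ?case
  proof (rule translation_modulus_approx[OF lim(5)])
    fix e :: real assume "e > 0"
    have "(\<lambda>i. \<integral>x. norm (f x - s i x) \<partial>lborel) \<longlonglongrightarrow> (\<integral>x. 0 \<partial>(lborel :: 'a measure))"
    proof (rule integral_dominated_convergence[where w="\<lambda>x. 3 * norm (f x)"])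
      show "AE x in lborel. (\<lambda>i. norm (f x - s i x)) \<longlonglongrightarrow> 0"
      proof (intro AE_I2)
        fix x :: 'a
        have "(\<lambda>i. norm (f x - s i x)) \<longlonglongrightarrow> norm (f x - f x)"
          using lim(3)[of x] by (intro tendsto_intros) auto
        then show "(\<lambda>i. norm (f x - s i x)) \<longlonglongrightarrow> 0" by simp
      qed
      show "AE x in lborel. norm (norm (f x - s i x)) \<le> 3 * norm (f x)" for i
      proof (intro AE_I2)
        fix x :: 'a
        show "norm (norm (f x - s i x)) \<le> 3 * norm (f x)"
          using lim(4)[of x i] norm_triangle_ineq4[of "f x" "s i x"] by simp
      qed
    qed (use lim(1,5) in \<open>auto intro!: borel_measurable_norm\<close>)
    then have "(\<lambda>i. \<integral>x. norm (f x - s i x) \<partial>lborel) \<longlonglongrightarrow> 0" by simp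
    from LIMSEQ_D[OF this \<open>e > 0\<close>] obtain i where "(\<integral>x. norm (f x - s i x) \<partial>lborel) < e"
      by force
    then show "\<exists>g. integrable lborel g \<and> (\<lambda>n. translation_modulus g (v n)) \<longlonglongrightarrow> 0
        \<and> (\<integral>x. norm (f x - g x) \<partial>lborel) \<le> e"
      using lim(1,2) by (intro exI[of _ "s i"]) auto
  qed
qed

text \<open>The field sending \<open>u\<close> to \<open>|u| u\<close> is monotone in a quantitative
  way: its increment paired with \<open>u - w\<close> equals
  \<open>(|u| + |w|) (|u - w|^2 + (|u| - |w|)^2) / 2\<close>. Cauchy-Schwarz and
  \<open>|u - w| \<le> |u| + |w|\<close> then give the bound, which transfers \<open>L^1\<close>
  continuity of translates of \<open>|f| f\<close> to \<open>L^2\<close> continuity of translates of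
  \<open>f\<close>.\<close>

lemma norm_diff_squared_le_norm_scaled_diff:
  fixes u w :: "'a::real_inner"
  shows "(norm (u - w))\<^sup>2 \<le> 2 * norm (norm u *\<^sub>R u - norm w *\<^sub>R w)"
proof (cases "u = w")
  case False
  define a where "a = norm u"
  define b where "b = norm w"
  define p where "p = inner u w"
  define n where "n = norm (u - w)"
  have n: "n > 0" using False by (simp add: n_def)
  have n2: "n\<^sup>2 = a\<^sup>2 + b\<^sup>2 - 2 * p"
    unfolding n_def a_def b_def p_def
    by (simp add: power2_norm_eq_inner inner_diff_left inner_diff_right inner_commute)
  have "inner (norm u *\<^sub>R u - norm w *\<^sub>R w) (u - w) = a * a\<^sup>2 + b * b\<^sup>2 - (a + b) * p"
    unfolding a_def b_def p_def
    by (simp add: power2_norm_eq_inner inner_diff_left inner_diff_right inner_commute algebra_simps)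
  also have "\<dots> = (a + b) * n\<^sup>2 / 2 + (a + b) * (a - b)\<^sup>2 / 2"
    unfolding n2 by (simp add: field_simps power2_eq_square)
  finally have "(a + b) * n\<^sup>2 / 2 \<le> inner (norm u *\<^sub>R u - norm w *\<^sub>R w) (u - w)"
    by (simp add: a_def b_def)
  also have "\<dots> \<le> norm (norm u *\<^sub>R u - norm w *\<^sub>R w) * n"
    unfolding n_def by (rule norm_cauchy_schwarz)
  finally have "(a + b) * n * n \<le> 2 * norm (norm u *\<^sub>R u - norm w *\<^sub>R w) * n"
    by (simp add: power2_eq_square mult_ac)
  then have "(a + b) * n \<le> 2 * norm (norm u *\<^sub>R u - norm w *\<^sub>R w)" using n by simp
  moreover have "n \<le> a + b" unfolding n_def a_def b_def by (rule norm_triangle_ineq4)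
  then have "n * n \<le> (a + b) * n" using n by (intro mult_right_mono) auto
  ultimately show ?thesis by (simp add: n_def power2_eq_square)
qed simp

lemma sq_integrable_translate:
  assumes "sq_integrable f"
  shows "sq_integrable (\<lambda>x. f (v + x))"
proof -
  have [measurable]: "f \<in> borel_measurable borel" using assms by (simp add: sq_integrable_def)
  have "integrable lborel (\<lambda>x. (cmod (f x))\<^sup>2)" using assms by (simp add: sq_integrable_def)
  from lborel_integrable_translate[OF this, of v] show ?thesis by (simp add: sq_integrable_def)
qed

lemma L2_translation_tendsto:
  fixes f :: "'a::euclidean_space \<Rightarrow> complex"
  assumes f: "sq_integrable f" and v: "v \<longlonglongrightarrow> 0"
  shows "(\<lambda>n. abs_L2 (\<lambda>x. f (v n + x))) \<longlonglongrightarrow> abs_L2 f"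
proof -
  \<comment> \<open>\<open>|g| = |f|^2\<close>, so \<open>g\<close> is integrable although
    \<open>f\<close> need not be.\<close>
  define g where "g x = cmod (f x) *\<^sub>R f x" for x
  have fm [measurable]: "f \<in> borel_measurable borel" using f by (simp add: sq_integrable_def)
  have g: "integrable lborel g"
    using f by (subst integrable_norm_cancel[of lborel g])
      (auto simp: g_def[abs_def] sq_integrable_def power2_eq_square cong: integrable_cong)
  have fv: "sq_integrable (\<lambda>x. f (w + x))" for w by (rule sq_integrable_translate[OF f])
  have le: "(norm (abs_L2 (\<lambda>x. f (w + x)) - abs_L2 f))\<^sup>2 \<le> 2 * translation_modulus g w" for w
  proof -
    have "(norm (abs_L2 (\<lambda>x. f (w + x)) - abs_L2 f))\<^sup>2 = (\<integral>x. (cmod (f (w + x) - f x))\<^sup>2 \<partial>lborel)"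
      unfolding abs_L2_diff[OF fv f] by (rule norm_abs_L2[OF sq_integrable_diff[OF fv f]])
    also have "\<dots> \<le> (\<integral>x. 2 * norm (g (w + x) - g x) \<partial>lborel)"
    proof (rule integral_mono)
      show "integrable lborel (\<lambda>x. (cmod (f (w + x) - f x))\<^sup>2)"
        using sq_integrable_diff[OF fv f] by (simp add: sq_integrable_def)
      show "integrable lborel (\<lambda>x. 2 * norm (g (w + x) - g x))"
        by (intro integrable_mult_right integrable_norm Bochner_Integration.integrable_diff g
            lborel_integrable_translate)
      show "(cmod (f (w + x) - f x))\<^sup>2 \<le> 2 * norm (g (w + x) - g x)" for x
        unfolding g_def by (rule norm_diff_squared_le_norm_scaled_diff)
    qed
    also have "\<dots> = 2 * translation_modulus g w" by (simp add: translation_modulus_def)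
    finally show ?thesis .
  qed
  have "(\<lambda>n. 2 * translation_modulus g (v n)) \<longlonglongrightarrow> 2 * 0"
    by (intro tendsto_intros translation_modulus_tendsto g v)
  then have lim: "(\<lambda>n. 2 * translation_modulus g (v n)) \<longlonglongrightarrow> 0" by simp
  have "(\<lambda>n. (norm (abs_L2 (\<lambda>x. f (v n + x)) - abs_L2 f))\<^sup>2) \<longlonglongrightarrow> 0"
    by (rule tendsto_sandwich[OF _ _ tendsto_const lim]) (auto intro!: always_eventually le)
  then have "(\<lambda>n. sqrt ((norm (abs_L2 (\<lambda>x. f (v n + x)) - abs_L2 f))\<^sup>2)) \<longlonglongrightarrow> sqrt 0"
    by (rule tendsto_real_sqrt)
  then have "(\<lambda>n. norm (abs_L2 (\<lambda>x. f (v n + x)) - abs_L2 f)) \<longlonglongrightarrow> 0" by simp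
  then show ?thesis using Lim_null tendsto_norm_zero_iff by blast
qed


section \<open>Fourier integrals and Plancherel's identity\<close>

definition fourier_integral :: "('a::euclidean_space \<Rightarrow> complex) \<Rightarrow> 'a \<Rightarrow> complex" where
  "fourier_integral f \<xi> = (\<integral>x. exp (- \<i> * of_real (x \<bullet> \<xi>)) * f x \<partial>lborel)"

lemma cmod_exp_minus_ii_of_real: "cmod (exp (- \<i> * of_real r)) = 1"
  by simp

lemma integrable_mult_exp_ii:
  fixes f :: "'a::euclidean_space \<Rightarrow> complex"
  assumes "integrable lborel f"
  shows "integrable lborel (\<lambda>x. exp (- \<i> * of_real (x \<bullet> \<xi>)) * f x)"
proof (rule Bochner_Integration.integrable_bound[OF assms])
  have [measurable]: "f \<in> borel_measurable borel" using assms by (auto dest: borel_measurable_integrable)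
  show "(\<lambda>x. exp (- \<i> * of_real (x \<bullet> \<xi>)) * f x) \<in> borel_measurable lborel" by measurable
qed (simp add: norm_mult)

lemma cmod_fourier_integral_le:
  assumes "integrable lborel f"
  shows "cmod (fourier_integral f \<xi>) \<le> (\<integral>x. cmod (f x) \<partial>lborel)"
proof -
  have "cmod (fourier_integral f \<xi>) \<le> (\<integral>x. cmod (exp (- \<i> * of_real (x \<bullet> \<xi>)) * f x) \<partial>lborel)"
    unfolding fourier_integral_def by (rule integral_norm_bound)
  also have "\<dots> = (\<integral>x. cmod (f x) \<partial>lborel)"
    by (simp add: norm_mult)
  finally show ?thesis .
qed

lemma borel_measurable_fourier_integral [measurable]:
  assumes [measurable]: "f \<in> borel_measurable borel"
  shows "fourier_integral f \<in> borel_measurable borel"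
proof -
  have "(\<lambda>(\<xi>, x). exp (- \<i> * of_real (x \<bullet> \<xi>)) * f x) \<in> borel_measurable (borel \<Otimes>\<^sub>M lborel)"
    by measurable
  from lborel.borel_measurable_lebesgue_integral[OF this]
  show ?thesis by (simp add: fourier_integral_def[abs_def])
qed

lemma fourier_integral_diff:
  assumes "integrable lborel f" "integrable lborel g"
  shows "fourier_integral (\<lambda>x. f x - g x) \<xi> = fourier_integral f \<xi> - fourier_integral g \<xi>"
  unfolding fourier_integral_def right_diff_distrib
  by (rule Bochner_Integration.integral_diff) (intro integrable_mult_exp_ii assms)+

lemma fourier_integral_cmult: "fourier_integral (\<lambda>x. c * f x) \<xi> = c * fourier_integral f \<xi>"
proof -
  have "fourier_integral (\<lambda>x. c * f x) \<xi> = (\<integral>x. c * (exp (- \<i> * of_real (x \<bullet> \<xi>)) * f x) \<partial>lborel)"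
    unfolding fourier_integral_def by (intro Bochner_Integration.integral_cong) (auto simp: mult_ac)
  then show ?thesis by (simp add: fourier_integral_def del: mult_minus_left)
qed

lemma integrable_lborel_pair_mult:
  fixes f :: "'a::euclidean_space \<Rightarrow> complex" and g :: "'b::euclidean_space \<Rightarrow> complex"
  assumes f: "integrable lborel f" and g: "integrable lborel g"
  shows "integrable (lborel \<Otimes>\<^sub>M lborel) (\<lambda>(x, y). f x * g y)"
proof (rule lborel_pair.Fubini_integrable)
  have [measurable]: "f \<in> borel_measurable borel" "g \<in> borel_measurable borel"
    using f g by (auto dest: borel_measurable_integrable)
  show "(\<lambda>(x, y). f x * g y) \<in> borel_measurable (lborel \<Otimes>\<^sub>M lborel)" by measurable
qed (use f g in \<open>auto simp: norm_mult\<close>)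

text \<open>Fubini, since the kernel is symmetric in its two arguments.\<close>

lemma fourier_integral_swap:
  fixes f g :: "'a::euclidean_space \<Rightarrow> complex"
  assumes f: "integrable lborel f" and g: "integrable lborel g"
  shows "(\<integral>\<xi>. fourier_integral f \<xi> * g \<xi> \<partial>lborel) = (\<integral>x. f x * fourier_integral g x \<partial>lborel)"
proof -
  have [measurable]: "f \<in> borel_measurable borel" "g \<in> borel_measurable borel"
    using f g by (auto dest: borel_measurable_integrable)
  let ?h = "\<lambda>x \<xi>. exp (- \<i> * of_real (x \<bullet> \<xi>)) * f x * g \<xi>"
  have int: "integrable (lborel \<Otimes>\<^sub>M lborel) (\<lambda>(x, \<xi>). ?h x \<xi>)"
    by (rule Bochner_Integration.integrable_bound[OF integrable_lborel_pair_mult[OF f g]])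
      (auto simp: norm_mult)
  have "(\<integral>\<xi>. fourier_integral f \<xi> * g \<xi> \<partial>lborel) = (\<integral>\<xi>. (\<integral>x. ?h x \<xi> \<partial>lborel) \<partial>lborel)"
    by (simp add: fourier_integral_def del: mult_minus_left)
  also have "\<dots> = (\<integral>x. (\<integral>\<xi>. ?h x \<xi> \<partial>lborel) \<partial>lborel)"
    by (rule lborel_pair.Fubini_integral[OF int])
  also have "\<dots> = (\<integral>x. (\<integral>\<xi>. f x * (exp (- \<i> * of_real (\<xi> \<bullet> x)) * g \<xi>) \<partial>lborel) \<partial>lborel)"
    by (simp only: mult_ac inner_commute)
  also have "\<dots> = (\<integral>x. f x * fourier_integral g x \<partial>lborel)"
    by (simp add: fourier_integral_def del: mult_minus_left)
  finally show ?thesis .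
qed

section \<open>The autocorrelation (convolution of \<open>f\<close> with its reflected conjugate)
  and its transform\<close>

definition autocorrelation :: "('a::euclidean_space \<Rightarrow> complex) \<Rightarrow> 'a \<Rightarrow> complex" where
  "autocorrelation f u = (\<integral>y. f (u + y) * cnj (f y) \<partial>lborel)"

text \<open>Translating the inner integration variable by \<open>y\<close> splits the character, so
  the double integral factors into the transform of \<open>f\<close> and its conjugate. The integral
  of \<open>|f|^2\<close> is the autocorrelation at the origin, which makes Plancherel an inversion
  statement at a single point.\<close>

lemma
  fixes f :: "'a::euclidean_space \<Rightarrow> complex"
  assumes f: "integrable lborel f"
  shows integrable_autocorrelation: "integrable lborel (autocorrelation f)"
    and fourier_integral_autocorrelation:
      "fourier_integral (autocorrelation f) \<xi> = of_real ((cmod (fourier_integral f \<xi>))\<^sup>2)"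
proof -
  have fm [measurable]: "f \<in> borel_measurable borel" using f by (auto dest: borel_measurable_integrable)
  have ft: "integrable lborel (\<lambda>u. f (u + y))" for y
    using lborel_integrable_translate[OF f, of y] by (simp add: add.commute)
  have "integrable (lborel \<Otimes>\<^sub>M lborel) (\<lambda>(y, u). f (u + y) * cnj (f y))"
  proof (rule lborel_pair.Fubini_integrable)
    show "(\<lambda>(y, u). f (u + y) * cnj (f y)) \<in> borel_measurable (lborel \<Otimes>\<^sub>M lborel)" by measurable
    have "(\<integral>u. cmod (f (u + y)) \<partial>lborel) = (\<integral>u. cmod (f u) \<partial>lborel)" for y
      using lborel_integral_translate[of "\<lambda>x. cmod (f x)" y] by (simp add: add.commute)
    then show "integrable lborel (\<lambda>y. \<integral>u. cmod (case (y, u) of (y, u) \<Rightarrow> f (u + y) * cnj (f y)) \<partial>lborel)"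
      using f by (simp add: norm_mult)
    show "AE y in lborel. integrable lborel (\<lambda>u. case (y, u) of (y, u) \<Rightarrow> f (u + y) * cnj (f y))"
      using ft by simp
  qed
  note int = this
  show "integrable lborel (autocorrelation f)"
    using lborel_pair.integrable_snd[OF int] by (simp add: autocorrelation_def[abs_def])
  let ?e = "\<lambda>u. exp (- \<i> * of_real (u \<bullet> \<xi>))"
  have int': "integrable (lborel \<Otimes>\<^sub>M lborel) (\<lambda>(y, u). ?e u * (f (u + y) * cnj (f y)))"
    by (rule Bochner_Integration.integrable_bound[OF int]) (auto simp: norm_mult)
  have "fourier_integral (autocorrelation f) \<xi>
      = (\<integral>u. (\<integral>y. ?e u * (f (u + y) * cnj (f y)) \<partial>lborel) \<partial>lborel)"
    by (simp add: fourier_integral_def autocorrelation_def del: mult_minus_left)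
  also have "\<dots> = (\<integral>y. (\<integral>u. ?e u * (f (u + y) * cnj (f y)) \<partial>lborel) \<partial>lborel)"
    by (rule lborel_pair.Fubini_integral[OF int'])
  also have "\<dots> = (\<integral>y. fourier_integral f \<xi> * cnj (?e y * f y) \<partial>lborel)"
  proof (intro Bochner_Integration.integral_cong refl)
    fix y
    have e: "?e u * (f (u + y) * cnj (f y)) = (cnj (?e y) * cnj (f y)) * (?e (y + u) * f (y + u))" for u
    proof -
      have "?e u = cnj (?e y) * ?e (y + u)"
        unfolding exp_cnj exp_add[symmetric] by (simp add: inner_add_left algebra_simps)
      then show ?thesis by (simp only: mult_ac add.commute[of u y])
    qed
    have "(\<integral>u. ?e u * (f (u + y) * cnj (f y)) \<partial>lborel)
        = (\<integral>u. (cnj (?e y) * cnj (f y)) * (?e (y + u) * f (y + u)) \<partial>lborel)"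
      by (intro Bochner_Integration.integral_cong refl) (rule e)
    also have "\<dots> = (cnj (?e y) * cnj (f y)) * (\<integral>u. ?e (y + u) * f (y + u) \<partial>lborel)"
      by (simp del: mult_minus_left)
    also have "(\<integral>u. ?e (y + u) * f (y + u) \<partial>lborel) = fourier_integral f \<xi>"
      unfolding fourier_integral_def by (rule lborel_integral_translate) measurable
    finally show "(\<integral>u. ?e u * (f (u + y) * cnj (f y)) \<partial>lborel) = fourier_integral f \<xi> * cnj (?e y * f y)"
      by (simp add: mult_ac)
  qed
  also have "\<dots> = fourier_integral f \<xi> * cnj (fourier_integral f \<xi>)"
    by (simp add: fourier_integral_def del: mult_minus_left complex_cnj_mult)
  finally show "fourier_integral (autocorrelation f) \<xi> = of_real ((cmod (fourier_integral f \<xi>))\<^sup>2)"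
    by (simp only: complex_norm_square)
qed

section \<open>The Gaussian and its Fourier transform, by reduction to one dimension\<close>

lemma
  fixes \<phi> :: "'a::euclidean_space \<Rightarrow> real \<Rightarrow> complex"
  assumes \<phi>: "\<And>b. b \<in> Basis \<Longrightarrow> integrable lborel (\<phi> b)"
  shows integrable_lborel_prod: "integrable lborel (\<lambda>x::'a. \<Prod>b\<in>Basis. \<phi> b (x \<bullet> b))"
    and integral_lborel_prod: "(\<integral>x. (\<Prod>b\<in>Basis. \<phi> b (x \<bullet> b)) \<partial>(lborel :: 'a measure))
      = (\<Prod>b\<in>Basis. \<integral>s. \<phi> b s \<partial>lborel)"
proof -
  interpret product_sigma_finite "\<lambda>_::'a. lborel :: real measure" ..
  have [measurable]: "b \<in> Basis \<Longrightarrow> \<phi> b \<in> borel_measurable borel" for b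
    using \<phi>[of b] by (auto dest: borel_measurable_integrable)
  let ?P = "\<Pi>\<^sub>M b\<in>Basis. lborel :: real measure"
  let ?T = "\<lambda>f. \<Sum>b\<in>Basis. f b *\<^sub>R b :: 'a"
  have T [measurable]: "?T \<in> ?P \<rightarrow>\<^sub>M borel" by measurable
  have meas: "(\<lambda>x::'a. \<Prod>b\<in>Basis. \<phi> b (x \<bullet> b)) \<in> borel_measurable borel" by measurable
  have eq: "(\<Prod>b\<in>Basis. \<phi> b (?T f \<bullet> b)) = (\<Prod>b\<in>Basis. \<phi> b (f b))" for f
    by (intro prod.cong refl) (simp add: inner_sum_left_Basis)
  have int: "integrable ?P (\<lambda>f. \<Prod>b\<in>Basis. \<phi> b (f b))"
    by (rule product_integrable_prod) (use \<phi> in auto)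
  have "integrable (distr ?P borel ?T) (\<lambda>x. \<Prod>b\<in>Basis. \<phi> b (x \<bullet> b))"
    using int by (subst integrable_distr_eq[OF T meas]) (simp add: eq)
  then show "integrable lborel (\<lambda>x::'a. \<Prod>b\<in>Basis. \<phi> b (x \<bullet> b))"
    by (simp add: lborel_eq[symmetric])
  have "(\<integral>x. (\<Prod>b\<in>Basis. \<phi> b (x \<bullet> b)) \<partial>(lborel :: 'a measure))
      = (\<integral>x. (\<Prod>b\<in>Basis. \<phi> b (x \<bullet> b)) \<partial>distr ?P borel ?T)"
    by (subst lborel_eq) simp
  also have "\<dots> = (\<integral>f. (\<Prod>b\<in>Basis. \<phi> b (f b)) \<partial>?P)"
    by (subst integral_distr[OF T meas]) (simp only: eq)
  also have "\<dots> = (\<Prod>b\<in>Basis. \<integral>s. \<phi> b s \<partial>lborel)"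
    by (rule product_integral_prod) (use \<phi> in auto)
  finally show "(\<integral>x. (\<Prod>b\<in>Basis. \<phi> b (x \<bullet> b)) \<partial>(lborel :: 'a measure))
      = (\<Prod>b\<in>Basis. \<integral>s. \<phi> b s \<partial>lborel)" .
qed

text \<open>Up to the factor \<open>sqrt (2 * pi)\<close> this is the characteristic function of the
  standard normal law at \<open>- t\<close>.\<close>

lemma
  fixes t :: real
  shows integrable_gaussian_kernel: "integrable lborel (\<lambda>s. exp (- \<i> * of_real (s * t)) * of_real (exp (- s\<^sup>2 / 2)))"
    and integral_gaussian_kernel: "(\<integral>s. exp (- \<i> * of_real (s * t)) * of_real (exp (- s\<^sup>2 / 2)) \<partial>lborel)
      = of_real (sqrt (2 * pi) * exp (- t\<^sup>2 / 2))"
proof -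
  let ?h = "\<lambda>s. exp (- \<i> * of_real (s * t)) * complex_of_real (exp (- s\<^sup>2 / 2))"
  have eq: "of_real (sqrt (2 * pi)) * (std_normal_density s *\<^sub>R iexp (- t * s)) = ?h s" for s
    by (simp add: std_normal_density_def scaleR_conv_of_real mult_ac)
  have "integrable lborel (\<lambda>s. std_normal_density s *\<^sub>R iexp (- t * s))"
    by (rule Bochner_Integration.integrable_bound[of _ std_normal_density]) auto
  then have "integrable lborel (\<lambda>s. of_real (sqrt (2 * pi)) * (std_normal_density s *\<^sub>R iexp (- t * s)))"
    by (rule integrable_mult_right)
  then show "integrable lborel ?h" unfolding eq .
  have "(\<integral>s. std_normal_density s *\<^sub>R iexp (- t * s) \<partial>lborel) = char std_normal_distribution (- t)"
    unfolding char_def by (rule integral_density[symmetric]) auto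
  also have "\<dots> = of_real (exp (- t\<^sup>2 / 2))" by (simp add: char_std_normal_distribution)
  finally have "of_real (sqrt (2 * pi)) * (\<integral>s. std_normal_density s *\<^sub>R iexp (- t * s) \<partial>lborel)
      = of_real (sqrt (2 * pi) * exp (- t\<^sup>2 / 2))" by simp
  then have "(\<integral>s. of_real (sqrt (2 * pi)) * (std_normal_density s *\<^sub>R iexp (- t * s)) \<partial>lborel)
      = of_real (sqrt (2 * pi) * exp (- t\<^sup>2 / 2))" by (simp only: integral_mult_right_zero)
  then show "(\<integral>s. ?h s \<partial>lborel) = of_real (sqrt (2 * pi) * exp (- t\<^sup>2 / 2))" unfolding eq .
qed

text \<open>Left unnormalised: its value at the origin is 1, so its dilations serve as cutoffs
  increasing to 1.\<close>

definition gaussian :: "'a::euclidean_space \<Rightarrow> complex" where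
  "gaussian x = of_real (exp (- (norm x)\<^sup>2 / 2))"

lemma borel_measurable_gaussian [measurable]: "gaussian \<in> borel_measurable borel"
  unfolding gaussian_def[abs_def] by measurable

text \<open>Character and Gaussian are both exponentials of sums over coordinates, which reduces the
  transform to a product of one-dimensional integrals.\<close>

lemma gaussian_kernel_eq_prod:
  fixes x \<xi> :: "'a::euclidean_space"
  shows "exp (- \<i> * of_real (x \<bullet> \<xi>)) * gaussian x
    = (\<Prod>b\<in>Basis. exp (- \<i> * of_real ((x \<bullet> b) * (\<xi> \<bullet> b))) * of_real (exp (- (x \<bullet> b)\<^sup>2 / 2)))"
proof -
  have "(norm x)\<^sup>2 = (\<Sum>b\<in>Basis. (x \<bullet> b)\<^sup>2)"
    unfolding power2_norm_eq_inner euclidean_inner[of x x] by (simp add: power2_eq_square)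
  then have "gaussian x = of_real (exp (\<Sum>b\<in>Basis. - (x \<bullet> b)\<^sup>2 / 2))"
    by (simp add: gaussian_def sum_negf sum_divide_distrib)
  also have "\<dots> = (\<Prod>b\<in>Basis. of_real (exp (- (x \<bullet> b)\<^sup>2 / 2)))"
    by (simp only: exp_sum[OF finite_Basis] of_real_prod)
  finally have g: "gaussian x = (\<Prod>b\<in>Basis. of_real (exp (- (x \<bullet> b)\<^sup>2 / 2)))" .
  have "- \<i> * of_real (x \<bullet> \<xi>) = (\<Sum>b\<in>Basis. - \<i> * of_real ((x \<bullet> b) * (\<xi> \<bullet> b)))"
    unfolding euclidean_inner[of x \<xi>] of_real_sum by (simp only: sum_distrib_left)
  then have "exp (- \<i> * of_real (x \<bullet> \<xi>)) = (\<Prod>b\<in>Basis. exp (- \<i> * of_real ((x \<bullet> b) * (\<xi> \<bullet> b))))"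
    by (simp only: exp_sum[OF finite_Basis])
  with g show ?thesis by (simp only: prod.distrib)
qed

lemma integrable_gaussian: "integrable lborel (gaussian :: 'a::euclidean_space \<Rightarrow> complex)"
proof -
  have "integrable lborel (\<lambda>x::'a. exp (- \<i> * of_real (x \<bullet> 0)) * gaussian x)"
    unfolding gaussian_kernel_eq_prod by (rule integrable_lborel_prod[OF integrable_gaussian_kernel])
  then show ?thesis by simp
qed

lemma fourier_integral_gaussian:
  "fourier_integral gaussian \<xi> = of_real (sqrt (2 * pi) ^ DIM('a)) * gaussian (\<xi> :: 'a::euclidean_space)"
proof -
  have "fourier_integral gaussian \<xi> = (\<Prod>b\<in>(Basis :: 'a set). of_real (sqrt (2 * pi) * exp (- (\<xi> \<bullet> b)\<^sup>2 / 2)))"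
    unfolding fourier_integral_def gaussian_kernel_eq_prod
    by (subst integral_lborel_prod[OF integrable_gaussian_kernel]) (simp only: integral_gaussian_kernel)
  also have "\<dots> = of_real (sqrt (2 * pi) ^ DIM('a)) * (\<Prod>b\<in>(Basis :: 'a set). of_real (exp (- (\<xi> \<bullet> b)\<^sup>2 / 2)))"
    by (simp add: prod.distrib)
  also have "(\<Prod>b\<in>(Basis :: 'a set). of_real (exp (- (\<xi> \<bullet> b)\<^sup>2 / 2))) = gaussian \<xi>"
    using gaussian_kernel_eq_prod[of \<xi> 0] by simp
  finally show ?thesis .
qed

lemma integral_gaussian: "(\<integral>x. gaussian x \<partial>(lborel :: 'a measure)) = of_real (sqrt (2 * pi) ^ DIM('a::euclidean_space))"
  using fourier_integral_gaussian[of "0::'a"] by (simp add: fourier_integral_def gaussian_def)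

section \<open>Dilations, and Plancherel's identity by Gaussian regularisation\<close>

lemma lborel_integral_scaleR:
  fixes f :: "'a::euclidean_space \<Rightarrow> complex"
  assumes [measurable]: "f \<in> borel_measurable borel" and c: "c > 0"
  shows "(\<integral>x. f x \<partial>lborel) = of_real (c ^ DIM('a)) * (\<integral>x. f (c *\<^sub>R x) \<partial>lborel)"
proof -
  let ?D = "distr lborel borel (\<lambda>x. 0 + c *\<^sub>R x) :: 'a measure"
  have "(\<integral>x. f x \<partial>lborel) = (\<integral>x. f x \<partial>density ?D (\<lambda>_. ennreal (c ^ DIM('a))))"
    using lborel_affine[of c "0::'a"] c by (simp add: ennreal_power)
  also have "\<dots> = (\<integral>x. (c ^ DIM('a)) *\<^sub>R f x \<partial>?D)"
    by (rule integral_density) (use c in auto)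
  also have "\<dots> = (c ^ DIM('a)) *\<^sub>R (\<integral>x. f (c *\<^sub>R x) \<partial>lborel)"
    by (subst integral_distr) auto
  finally show ?thesis by (simp add: scaleR_conv_of_real)
qed

lemma integrable_lborel_scaleR:
  fixes f :: "'a::euclidean_space \<Rightarrow> complex"
  assumes "integrable lborel f" and c: "c > 0"
  shows "integrable lborel (\<lambda>x. f (c *\<^sub>R x))"
proof -
  have [measurable]: "f \<in> borel_measurable borel"
    using assms by (auto dest: borel_measurable_integrable)
  let ?D = "distr lborel borel (\<lambda>x. 0 + c *\<^sub>R x) :: 'a measure"
  have "integrable (density ?D (\<lambda>_. ennreal (c ^ DIM('a)))) f"
    using lborel_affine[of c "0::'a"] c assms(1) by (simp add: ennreal_power)
  then have "integrable ?D (\<lambda>x. (c ^ DIM('a)) *\<^sub>R f x)"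
    by (subst (asm) integrable_density) (use c in auto)
  then have "integrable ?D (\<lambda>x. inverse (c ^ DIM('a)) *\<^sub>R ((c ^ DIM('a)) *\<^sub>R f x))"
    by (rule integrable_scaleR_right)
  then have "integrable ?D f" using c by simp
  then show ?thesis by (subst (asm) integrable_distr_eq) auto
qed

lemma fourier_integral_gaussian_scaled:
  fixes u :: "'a::euclidean_space"
  assumes c: "c > 0"
  shows "of_real (c ^ DIM('a)) * fourier_integral (\<lambda>x. gaussian (c *\<^sub>R x)) u
    = of_real (sqrt (2 * pi) ^ DIM('a)) * gaussian (u /\<^sub>R c)"
proof -
  have "fourier_integral gaussian (u /\<^sub>R c) = of_real (c ^ DIM('a)) *
      (\<integral>x. exp (- \<i> * of_real ((c *\<^sub>R x) \<bullet> (u /\<^sub>R c))) * gaussian (c *\<^sub>R x) \<partial>lborel)"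
    unfolding fourier_integral_def by (rule lborel_integral_scaleR[OF _ c]) measurable
  moreover have "(c *\<^sub>R x) \<bullet> (u /\<^sub>R c) = x \<bullet> u" for x using c by simp
  ultimately show ?thesis
    unfolding fourier_integral_gaussian by (simp only: fourier_integral_def[of "\<lambda>x. gaussian (c *\<^sub>R x)"])
qed

text \<open>The squared transform is the transform of the autocorrelation. Moving that transform
  onto the Gaussian leaves a Gaussian of width \<open>c\<close>, and the substitution
  \<open>u = c v\<close> exhibits the result as an average of the autocorrelation near the
  origin.\<close>

lemma integral_fourier_times_gaussian:
  fixes f :: "'a::euclidean_space \<Rightarrow> complex"
  assumes f: "integrable lborel f" and c: "c > 0"
  shows "(\<integral>\<xi>. of_real ((cmod (fourier_integral f \<xi>))\<^sup>2) * gaussian (c *\<^sub>R \<xi>) \<partial>lborel)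
    = of_real (sqrt (2 * pi) ^ DIM('a)) * (\<integral>v. autocorrelation f (c *\<^sub>R v) * gaussian v \<partial>lborel)"
proof -
  let ?A = "autocorrelation f" and ?k = "complex_of_real (sqrt (2 * pi) ^ DIM('a))"
  let ?c = "complex_of_real (c ^ DIM('a))"
  have A: "integrable lborel ?A" by (rule integrable_autocorrelation[OF f])
  then have [measurable]: "?A \<in> borel_measurable borel" by (auto dest: borel_measurable_integrable)
  have nz: "?c \<noteq> 0" using c by simp
  have "?c * (\<integral>\<xi>. of_real ((cmod (fourier_integral f \<xi>))\<^sup>2) * gaussian (c *\<^sub>R \<xi>) \<partial>lborel)
      = ?c * (\<integral>\<xi>. fourier_integral ?A \<xi> * gaussian (c *\<^sub>R \<xi>) \<partial>lborel)"
    by (simp only: fourier_integral_autocorrelation[OF f])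
  also have "\<dots> = ?c * (\<integral>u. ?A u * fourier_integral (\<lambda>x. gaussian (c *\<^sub>R x)) u \<partial>lborel)"
    by (simp only: fourier_integral_swap[OF A integrable_lborel_scaleR[OF integrable_gaussian c]])
  also have "\<dots> = (\<integral>u. ?c * (?A u * fourier_integral (\<lambda>x. gaussian (c *\<^sub>R x)) u) \<partial>lborel)"
    by (rule integral_mult_right_zero[symmetric])
  also have "\<dots> = (\<integral>u. ?k * (?A u * gaussian (u /\<^sub>R c)) \<partial>lborel)"
    by (intro Bochner_Integration.integral_cong refl)
      (metis fourier_integral_gaussian_scaled[OF c] mult.left_commute)
  also have "\<dots> = ?k * (\<integral>u. ?A u * gaussian (u /\<^sub>R c) \<partial>lborel)"
    by (rule integral_mult_right_zero)
  also have "(\<integral>u. ?A u * gaussian (u /\<^sub>R c) \<partial>lborel)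
      = ?c * (\<integral>v. ?A (c *\<^sub>R v) * gaussian ((c *\<^sub>R v) /\<^sub>R c) \<partial>lborel)"
    by (rule lborel_integral_scaleR[OF _ c]) measurable
  also have "(\<integral>v. ?A (c *\<^sub>R v) * gaussian ((c *\<^sub>R v) /\<^sub>R c) \<partial>lborel)
      = (\<integral>v. ?A (c *\<^sub>R v) * gaussian v \<partial>lborel)" using c by simp
  finally have "?c * (\<integral>\<xi>. of_real ((cmod (fourier_integral f \<xi>))\<^sup>2) * gaussian (c *\<^sub>R \<xi>) \<partial>lborel)
      = ?c * (?k * (\<integral>v. ?A (c *\<^sub>R v) * gaussian v \<partial>lborel))"
    by (simp only: mult_ac)
  with nz show ?thesis by simp
qed

lemma autocorrelation_eq_cinner:
  assumes "sq_integrable f"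
  shows "autocorrelation f v = cinner (abs_L2 (\<lambda>x. f (v + x))) (abs_L2 f)"
  using assms by (simp add: autocorrelation_def abs_L2_cinner sq_integrable_translate)

lemma norm_abs_L2_translate:
  assumes f: "sq_integrable f"
  shows "norm (abs_L2 (\<lambda>x. f (v + x))) = norm (abs_L2 f)"
proof -
  have [measurable]: "f \<in> borel_measurable borel" using f by (simp add: sq_integrable_def)
  have "(norm (abs_L2 (\<lambda>x. f (v + x))))\<^sup>2 = (norm (abs_L2 f))\<^sup>2"
    unfolding norm_abs_L2[OF f] norm_abs_L2[OF sq_integrable_translate[OF f]]
    by (rule lborel_integral_translate) measurable
  then show ?thesis by simp
qed

text \<open>Let \<open>c\<close> tend to 0 in \<open>integral_fourier_times_gaussian\<close>. On the
  left the Gaussian cutoffs increase to 1; on the right the autocorrelation tends to its value at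
  the origin, the squared norm of \<open>f\<close>, because translations are continuous in
  \<open>L^2\<close>.\<close>

lemma plancherel_integrable:
  fixes f :: "'a::euclidean_space \<Rightarrow> complex"
  assumes f: "sq_integrable f" and f1: "integrable lborel f"
  shows "sq_integrable (fourier_integral f)"
    and "(norm (abs_L2 (fourier_integral f)))\<^sup>2 = (2 * pi) ^ DIM('a) * (norm (abs_L2 f))\<^sup>2"
proof -
  let ?F = "fourier_integral f" and ?A = "autocorrelation f"
  define k where "k = sqrt (2 * pi) ^ DIM('a)"
  define L where "L = (norm (abs_L2 f))\<^sup>2"
  have [measurable]: "f \<in> borel_measurable borel" using f by (simp add: sq_integrable_def)
  have [measurable]: "?A \<in> borel_measurable borel"
    using integrable_autocorrelation[OF f1] by (auto dest: borel_measurable_integrable)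
  define c where "c n = 1 / real (Suc n)" for n
  have c0: "c n > 0" for n by (simp add: c_def)
  have c_lim: "c \<longlonglongrightarrow> 0" 
    using LIMSEQ_inverse_real_of_nat by (simp add: c_def[abs_def] inverse_eq_divide)
  define g where "g n \<xi> = exp (- (norm (c n *\<^sub>R \<xi>))\<^sup>2 / 2)" for n and \<xi> :: 'a
  have gg: "gaussian (c n *\<^sub>R \<xi>) = of_real (g n \<xi>)" for n \<xi> by (simp add: gaussian_def g_def)
  have [measurable]: "g n \<in> borel_measurable borel" for n unfolding g_def by measurable
  have gint: "integrable lborel (g n)" for n
  proof -
    have "integrable lborel (\<lambda>\<xi>::'a. gaussian (c n *\<^sub>R \<xi>))"
      by (rule integrable_lborel_scaleR[OF integrable_gaussian c0])
    then show ?thesis by (simp only: gg complex_of_real_integrable_eq)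
  qed
  have Fb: "(cmod (?F \<xi>))\<^sup>2 \<le> (\<integral>x. cmod (f x) \<partial>lborel)\<^sup>2" for \<xi>
    by (intro power_mono cmod_fourier_integral_le f1) auto
  have Fgint: "integrable lborel (\<lambda>\<xi>. (cmod (?F \<xi>))\<^sup>2 * g n \<xi>)" for n
  proof (rule Bochner_Integration.integrable_bound)
    show "integrable lborel (\<lambda>\<xi>. (\<integral>x. cmod (f x) \<partial>lborel)\<^sup>2 * g n \<xi>)" using gint by simp
    show "AE \<xi> in lborel. norm ((cmod (?F \<xi>))\<^sup>2 * g n \<xi>) \<le> norm ((\<integral>x. cmod (f x) \<partial>lborel)\<^sup>2 * g n \<xi>)"
      using Fb by (auto simp: abs_mult g_def intro!: mult_right_mono)
  qed measurable
  have id: "complex_of_real (\<integral>\<xi>. (cmod (?F \<xi>))\<^sup>2 * g n \<xi> \<partial>lborel)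
      = of_real k * (\<integral>v. ?A (c n *\<^sub>R v) * gaussian v \<partial>lborel)" for n
    using integral_fourier_times_gaussian[OF f1 c0[of n]] unfolding gg k_def
    by (simp only: of_real_mult[symmetric] integral_complex_of_real)
  \<comment> \<open>Dominated convergence; by Cauchy-Schwarz the autocorrelation never exceeds its
    value \<open>L\<close> at the origin.\<close>
  have "(\<lambda>n. \<integral>v. ?A (c n *\<^sub>R v) * gaussian v \<partial>lborel) \<longlonglongrightarrow> (\<integral>v. of_real L * gaussian v \<partial>(lborel :: 'a measure))"
  proof (rule integral_dominated_convergence[where w="\<lambda>v. L * cmod (gaussian v)"])
    show "integrable lborel (\<lambda>v::'a. L * cmod (gaussian v))"
      using integrable_gaussian by (intro integrable_mult_right integrable_norm)
    show "AE v in lborel. (\<lambda>n. ?A (c n *\<^sub>R v) * gaussian v) \<longlonglongrightarrow> of_real L * gaussian v"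
    proof (intro AE_I2 tendsto_mult tendsto_const)
      fix v :: 'a
      have "(\<lambda>n. c n *\<^sub>R v) \<longlonglongrightarrow> 0 *\<^sub>R v" by (intro tendsto_intros c_lim)
      then have "(\<lambda>n. cinner (abs_L2 (\<lambda>x. f (c n *\<^sub>R v + x))) (abs_L2 f)) \<longlonglongrightarrow> cinner (abs_L2 f) (abs_L2 f)"
        by (intro bounded_bilinear.tendsto[OF bounded_bilinear_cinner] L2_translation_tendsto f tendsto_const) simp
      then show "(\<lambda>n. ?A (c n *\<^sub>R v)) \<longlonglongrightarrow> of_real L"
        by (simp add: autocorrelation_eq_cinner[OF f] cinner_self L_def)
    qed
    show "AE v in lborel. norm (?A (c n *\<^sub>R v) * gaussian v) \<le> L * cmod (gaussian v)" for n
    proof (intro AE_I2)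
      fix v :: 'a
      have "cmod (?A (c n *\<^sub>R v)) \<le> norm (abs_L2 (\<lambda>x. f (c n *\<^sub>R v + x))) * norm (abs_L2 f)"
        unfolding autocorrelation_eq_cinner[OF f] by (rule norm_cinner_le)
      also have "\<dots> = L" by (simp add: L_def norm_abs_L2_translate[OF f] power2_eq_square)
      finally show "norm (?A (c n *\<^sub>R v) * gaussian v) \<le> L * cmod (gaussian v)"
        by (simp add: norm_mult mult_right_mono)
    qed
  qed measurable
  then have "(\<lambda>n. of_real k * (\<integral>v. ?A (c n *\<^sub>R v) * gaussian v \<partial>lborel))
      \<longlonglongrightarrow> of_real k * (of_real L * (\<integral>v. gaussian v \<partial>(lborel :: 'a measure)))"
    by (intro tendsto_intros) simp
  then have "(\<lambda>n. complex_of_real (\<integral>\<xi>. (cmod (?F \<xi>))\<^sup>2 * g n \<xi> \<partial>lborel)) \<longlonglongrightarrow> of_real (k * (L * k))"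
    unfolding id integral_gaussian by (simp add: k_def)
  then have lim1: "(\<lambda>n. \<integral>\<xi>. (cmod (?F \<xi>))\<^sup>2 * g n \<xi> \<partial>lborel) \<longlonglongrightarrow> k * (L * k)"
    by (rule iffD1[OF tendsto_of_real_iff])
  have "k * k = (2 * pi) ^ DIM('a)"
    unfolding k_def power_mult_distrib[symmetric] real_sqrt_mult_self by simp
  then have kk: "k * (L * k) = (2 * pi) ^ DIM('a) * L" by (simp add: mult_ac)
  have gmono: "g m \<xi> \<le> g n \<xi>" if "m \<le> n" for m n \<xi>
  proof -
    have "c n \<le> c m" using that by (simp add: c_def frac_le)
    then have "c n * norm \<xi> \<le> c m * norm \<xi>" by (intro mult_right_mono) auto
    then have "(norm (c n *\<^sub>R \<xi>))\<^sup>2 \<le> (norm (c m *\<^sub>R \<xi>))\<^sup>2"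
      using c0[of n] c0[of m] by (intro power_mono) auto
    then show ?thesis by (simp add: g_def)
  qed
  \<comment> \<open>Monotone convergence in place of domination, because integrability of the
    squared transform is part of the conclusion.\<close>
  have "(\<lambda>n. \<integral>\<^sup>+\<xi>. ennreal ((cmod (?F \<xi>))\<^sup>2 * g n \<xi>) \<partial>lborel) \<longlonglongrightarrow> (\<integral>\<^sup>+\<xi>. ennreal ((cmod (?F \<xi>))\<^sup>2) \<partial>lborel)"
  proof (rule nn_integral_LIMSEQ)
    show "incseq (\<lambda>n \<xi>. ennreal ((cmod (?F \<xi>))\<^sup>2 * g n \<xi>))"
      by (auto simp: incseq_def le_fun_def intro!: ennreal_leI mult_left_mono gmono)
    fix \<xi> :: 'a
    have "(\<lambda>n. ennreal ((cmod (?F \<xi>))\<^sup>2 * exp (- (norm (c n *\<^sub>R \<xi>))\<^sup>2 / 2)))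
        \<longlonglongrightarrow> ennreal ((cmod (?F \<xi>))\<^sup>2 * exp (- (norm ((0::real) *\<^sub>R \<xi>))\<^sup>2 / 2))"
      by (intro tendsto_intros c_lim) auto
    then show "(\<lambda>n. ennreal ((cmod (?F \<xi>))\<^sup>2 * g n \<xi>)) \<longlonglongrightarrow> ennreal ((cmod (?F \<xi>))\<^sup>2)"
      by (simp add: g_def)
  qed measurable
  moreover have "(\<integral>\<^sup>+\<xi>. ennreal ((cmod (?F \<xi>))\<^sup>2 * g n \<xi>) \<partial>lborel)
      = ennreal (\<integral>\<xi>. (cmod (?F \<xi>))\<^sup>2 * g n \<xi> \<partial>lborel)" for n
    by (rule nn_integral_eq_integral[OF Fgint]) (simp add: g_def)
  ultimately have "(\<lambda>n. ennreal (\<integral>\<xi>. (cmod (?F \<xi>))\<^sup>2 * g n \<xi> \<partial>lborel))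
      \<longlonglongrightarrow> (\<integral>\<^sup>+\<xi>. ennreal ((cmod (?F \<xi>))\<^sup>2) \<partial>lborel)" by simp
  from LIMSEQ_unique[OF this tendsto_ennrealI[OF lim1]]
  have nn: "(\<integral>\<^sup>+\<xi>. ennreal ((cmod (?F \<xi>))\<^sup>2) \<partial>lborel) = ennreal ((2 * pi) ^ DIM('a) * L)"
    by (simp only: kk)
  show sq: "sq_integrable ?F"
    by (rule sq_integrableI_nn_integral) (simp_all add: nn)
  from nn nn_integral_abs_L2[OF sq]
  have "ennreal ((norm (abs_L2 ?F))\<^sup>2) = ennreal ((2 * pi) ^ DIM('a) * L)" by simp
  then show "(norm (abs_L2 (fourier_integral f)))\<^sup>2 = (2 * pi) ^ DIM('a) * (norm (abs_L2 f))\<^sup>2"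
    by (simp add: L_def)
qed


section \<open>The Fourier transform on \<open>L\<^sup>2\<close>\<close>

definition truncation :: "real \<Rightarrow> ('a::euclidean_space \<Rightarrow> complex) \<Rightarrow> 'a \<Rightarrow> complex" where
  "truncation R f x = indicat_real (cball 0 R) x *\<^sub>R f x"

lemma borel_measurable_truncation [measurable]:
  "f \<in> borel_measurable borel \<Longrightarrow> truncation R f \<in> borel_measurable borel"
  unfolding truncation_def[abs_def] by (intro borel_measurable_scaleR borel_measurable_indicator) auto

lemma sq_integrable_truncation:
  assumes "sq_integrable f"
  shows "sq_integrable (truncation R f)"
proof -
  have [measurable]: "f \<in> borel_measurable borel" using assms by (simp add: sq_integrable_def)
  show ?thesis
    by (rule sq_integrable_bound[OF assms assms, where c=1 and d=0])
      (auto simp: truncation_def indicator_def)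
qed

lemma integrable_truncation:
  fixes f :: "'a::euclidean_space \<Rightarrow> complex"
  assumes "sq_integrable f"
  shows "integrable lborel (truncation R f)"
proof (rule Bochner_Integration.integrable_bound)
  have [measurable]: "f \<in> borel_measurable borel" using assms by (simp add: sq_integrable_def)
  show "truncation R f \<in> borel_measurable lborel" by measurable
  show "integrable lborel (\<lambda>x. indicat_real (cball 0 R) x + (cmod (f x))\<^sup>2)"
    using assms emeasure_bounded_finite[of "cball (0::'a) R"]
    by (intro Bochner_Integration.integrable_add integrable_real_indicator) (auto simp: sq_integrable_def less_top)
  show "AE x in lborel. norm (truncation R f x) \<le> norm (indicat_real (cball 0 R) x + (cmod (f x))\<^sup>2)"
  proof (intro AE_I2)
    fix x
    have "2 * cmod (f x) \<le> 1 + (cmod (f x))\<^sup>2"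
      using sum_squares_bound[of "cmod (f x)" 1] by simp
    moreover have "0 \<le> cmod (f x)" by simp
    ultimately have "cmod (f x) \<le> 1 + (cmod (f x))\<^sup>2" by linarith
    then show "norm (truncation R f x) \<le> norm (indicat_real (cball 0 R) x + (cmod (f x))\<^sup>2)"
      by (auto simp: truncation_def indicator_def)
  qed
qed

lemma truncation_tendsto:
  fixes f :: "'a::euclidean_space \<Rightarrow> complex"
  assumes f: "sq_integrable f"
  shows "((\<lambda>R. abs_L2 (truncation R f)) \<longlongrightarrow> abs_L2 f) at_top"
proof -
  have [measurable]: "f \<in> borel_measurable borel" using assms by (simp add: sq_integrable_def)
  have "((\<lambda>R. \<integral>x. (cmod (truncation R f x - f x))\<^sup>2 \<partial>lborel) \<longlongrightarrow> (\<integral>x. 0 \<partial>(lborel :: 'a measure))) at_top"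
  proof (rule integral_dominated_convergence_at_top[where w="\<lambda>x. (cmod (f x))\<^sup>2"])
    show "AE x in lborel. ((\<lambda>R. (cmod (truncation R f x - f x))\<^sup>2) \<longlongrightarrow> 0) at_top"
    proof (intro AE_I2 tendsto_eventually)
      fix x
      show "\<forall>\<^sub>F R in at_top. (cmod (truncation R f x - f x))\<^sup>2 = 0"
        using eventually_ge_at_top[of "norm x"] by eventually_elim (simp add: truncation_def)
    qed
    show "\<forall>\<^sub>F R in at_top. AE x in lborel. norm ((cmod (truncation R f x - f x))\<^sup>2) \<le> (cmod (f x))\<^sup>2"
      by (intro always_eventually allI AE_I2) (auto simp: truncation_def indicator_def)
  qed (use f in \<open>auto simp: sq_integrable_def\<close>)
  moreover have "(\<integral>x. (cmod (truncation R f x - f x))\<^sup>2 \<partial>lborel) = (norm (abs_L2 (truncation R f) - abs_L2 f))\<^sup>2" for R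
    using f by (simp add: abs_L2_diff norm_abs_L2 sq_integrable_truncation sq_integrable_diff)
  ultimately have "((\<lambda>R. (norm (abs_L2 (truncation R f) - abs_L2 f))\<^sup>2) \<longlongrightarrow> 0) at_top" by simp
  then have "((\<lambda>R. sqrt ((norm (abs_L2 (truncation R f) - abs_L2 f))\<^sup>2)) \<longlongrightarrow> sqrt 0) at_top"
    by (rule tendsto_real_sqrt)
  then have "((\<lambda>R. norm (abs_L2 (truncation R f) - abs_L2 f)) \<longlongrightarrow> 0) at_top" by simp
  then show ?thesis by (simp only: tendsto_norm_zero_iff LIM_zero_iff)
qed

section \<open>Truncated transforms and their limit in \<open>L^2\<close>\<close>

definition fourier_truncated :: "real \<Rightarrow> ('a::euclidean_space \<Rightarrow> complex) \<Rightarrow> 'a L2" where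
  "fourier_truncated R f = abs_L2 (fourier_integral (truncation R f))"

lemma sq_integrable_fourier_truncation:
  "sq_integrable f \<Longrightarrow> sq_integrable (fourier_integral (truncation R f))"
  by (intro plancherel_integrable sq_integrable_truncation integrable_truncation)

lemma norm_fourier_truncated:
  fixes f :: "'a::euclidean_space \<Rightarrow> complex"
  assumes "sq_integrable f"
  shows "(norm (fourier_truncated R f))\<^sup>2 = (2 * pi) ^ DIM('a) * (norm (abs_L2 (truncation R f)))\<^sup>2"
  unfolding fourier_truncated_def
  by (intro plancherel_integrable sq_integrable_truncation integrable_truncation assms)

lemma norm_fourier_truncated_diff:
  fixes f :: "'a::euclidean_space \<Rightarrow> complex"
  assumes f: "sq_integrable f"
  shows "(norm (fourier_truncated R f - fourier_truncated S f))\<^sup>2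
    = (2 * pi) ^ DIM('a) * (norm (abs_L2 (truncation R f) - abs_L2 (truncation S f)))\<^sup>2"
proof -
  let ?d = "\<lambda>x. truncation R f x - truncation S f x"
  note s = sq_integrable_truncation[OF f] and i = integrable_truncation[OF f]
  have "fourier_truncated R f - fourier_truncated S f = abs_L2 (fourier_integral ?d)"
    unfolding fourier_truncated_def abs_L2_diff[OF sq_integrable_fourier_truncation[OF f] sq_integrable_fourier_truncation[OF f]]
    by (simp add: fourier_integral_diff[OF i i, symmetric])
  moreover have "(norm (abs_L2 (fourier_integral ?d)))\<^sup>2 = (2 * pi) ^ DIM('a) * (norm (abs_L2 ?d))\<^sup>2"
    by (intro plancherel_integrable sq_integrable_diff Bochner_Integration.integrable_diff s i)
  ultimately show ?thesis by (simp add: abs_L2_diff[OF s s])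
qed

lemma fourier_ball_abs_L2:
  assumes "sq_integrable f"
  shows "fourier_ball R (abs_L2 f) = fourier_integral (truncation R f)"
  using assms by (auto simp: fourier_ball.abs_eq L2_rel_self fourier_integral_def truncation_def
      set_lebesgue_integral_def fun_eq_iff intro!: Bochner_Integration.integral_cong)

text \<open>Plancherel puts the truncated transforms in \<open>L^2\<close>, so the extended integral
  in the definition is a genuine squared distance.\<close>

lemma is_fourier_transform_iff_tendsto:
  assumes f: "sq_integrable f"
  shows "is_fourier_transform (abs_L2 f) H \<longleftrightarrow> ((\<lambda>R. fourier_truncated R f) \<longlongrightarrow> H) at_top"
proof -
  obtain h where h: "sq_integrable h" and H: "H = abs_L2 h" by (rule L2_cases)
  have "is_fourier_transform (abs_L2 f) H \<longleftrightarrow>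
      ((\<lambda>R. ennreal ((norm (fourier_truncated R f - H))\<^sup>2)) \<longlongrightarrow> ennreal 0) at_top"
    using f h unfolding H fourier_truncated_def
    by (simp add: is_fourier_transform.abs_eq L2_rel_self fourier_ball_abs_L2
        nn_integral_abs_L2_diff sq_integrable_fourier_truncation)
  also have "\<dots> \<longleftrightarrow> ((\<lambda>R. (norm (fourier_truncated R f - H))\<^sup>2) \<longlongrightarrow> 0) at_top"
    by (rule tendsto_ennreal_iff) auto
  also have "\<dots> \<longleftrightarrow> ((\<lambda>R. norm (fourier_truncated R f - H)) \<longlongrightarrow> 0) at_top"
  proof
    assume "((\<lambda>R. (norm (fourier_truncated R f - H))\<^sup>2) \<longlongrightarrow> 0) at_top"
    then have "((\<lambda>R. sqrt ((norm (fourier_truncated R f - H))\<^sup>2)) \<longlongrightarrow> sqrt 0) at_top"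
      by (rule tendsto_real_sqrt)
    then show "((\<lambda>R. norm (fourier_truncated R f - H)) \<longlongrightarrow> 0) at_top" by simp
  next
    assume "((\<lambda>R. norm (fourier_truncated R f - H)) \<longlongrightarrow> 0) at_top"
    then have "((\<lambda>R. (norm (fourier_truncated R f - H))\<^sup>2) \<longlongrightarrow> 0\<^sup>2) at_top"
      by (rule tendsto_power)
    then show "((\<lambda>R. (norm (fourier_truncated R f - H))\<^sup>2) \<longlongrightarrow> 0) at_top" by simp
  qed
  also have "\<dots> \<longleftrightarrow> ((\<lambda>R. fourier_truncated R f) \<longlongrightarrow> H) at_top"
    by (simp only: tendsto_norm_zero_iff LIM_zero_iff)
  finally show ?thesis .
qed

text \<open>The transform multiplies distances between truncations by a constant, so along integer
  radii it inherits the Cauchy property from the truncations.\<close>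

lemma is_fourier_transform_exists: "\<exists>H. is_fourier_transform F H"
proof -
  obtain f where f: "sq_integrable f" and F: "F = abs_L2 f" by (rule L2_cases)
  define c where "c = sqrt ((2 * pi) ^ DIM('a))"
  let ?T = "\<lambda>R. fourier_truncated R f" and ?t = "\<lambda>R. abs_L2 (truncation R f)"
  have c: "c > 0" by (simp add: c_def)
  have dist: "norm (?T R - ?T S) = c * norm (?t R - ?t S)" for R S
    using norm_fourier_truncated_diff[OF f, of R S]
    by (metis c_def norm_ge_zero real_sqrt_mult real_sqrt_unique)
  have tn: "(\<lambda>n. ?t (real n)) \<longlonglongrightarrow> abs_L2 f"
    by (rule filterlim_compose[OF truncation_tendsto[OF f] filterlim_real_sequentially])
  have "Cauchy (\<lambda>n. ?T (real n))"
  proof (rule metric_CauchyI)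
    fix e :: real assume "e > 0"
    then obtain M where M: "\<And>m n. m \<ge> M \<Longrightarrow> n \<ge> M \<Longrightarrow> dist (?t (real m)) (?t (real n)) < e / c"
      using metric_CauchyD[OF LIMSEQ_imp_Cauchy[OF tn], of "e / c"] c by (auto intro: divide_pos_pos)
    show "\<exists>M. \<forall>m\<ge>M. \<forall>n\<ge>M. dist (?T (real m)) (?T (real n)) < e"
    proof (intro exI allI impI)
      fix m n assume "m \<ge> M" "n \<ge> M"
      from M[OF this] show "dist (?T (real m)) (?T (real n)) < e"
        using c by (simp add: dist_norm dist pos_less_divide_eq mult.commute)
    qed
  qed
  then obtain H where H: "(\<lambda>n. ?T (real n)) \<longlonglongrightarrow> H"
    using Cauchy_convergent by (auto simp: convergent_def)
  \<comment> \<open>Letting the second radius tend to infinity gives an exact error formula at every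
    real radius, which upgrades the limit along integers to one along all radii.\<close>
  have "norm (?T R - H) = c * norm (?t R - abs_L2 f)" for R
  proof (rule LIMSEQ_unique)
    show "(\<lambda>n. norm (?T R - ?T (real n))) \<longlonglongrightarrow> norm (?T R - H)"
      by (intro tendsto_intros H)
    show "(\<lambda>n. norm (?T R - ?T (real n))) \<longlonglongrightarrow> c * norm (?t R - abs_L2 f)"
      unfolding dist by (intro tendsto_intros tn)
  qed
  moreover have "((\<lambda>R. c * norm (?t R - abs_L2 f)) \<longlongrightarrow> c * norm (abs_L2 f - abs_L2 f)) at_top"
    by (intro tendsto_intros truncation_tendsto f)
  ultimately have "((\<lambda>R. norm (?T R - H)) \<longlongrightarrow> 0) at_top" by simp
  then have "(?T \<longlongrightarrow> H) at_top" by (simp only: tendsto_norm_zero_iff LIM_zero_iff)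
  then show ?thesis unfolding F using is_fourier_transform_iff_tendsto[OF f] by blast
qed

text \<open>A choice among candidates that \<open>is_fourier_transform_iff\<close> shows to be
  unique.\<close>

definition fourier_L2 :: "'a::euclidean_space L2 \<Rightarrow> 'a L2" where
  "fourier_L2 F = (SOME H. is_fourier_transform F H)"

lemma fourier_truncated_tendsto:
  assumes "sq_integrable f"
  shows "((\<lambda>R. fourier_truncated R f) \<longlongrightarrow> fourier_L2 (abs_L2 f)) at_top"
  using someI_ex[OF is_fourier_transform_exists, of "abs_L2 f"]
  by (simp add: fourier_L2_def is_fourier_transform_iff_tendsto[OF assms])

lemma is_fourier_transform_iff: "is_fourier_transform F H \<longleftrightarrow> H = fourier_L2 F"
proof -
  obtain f where f: "sq_integrable f" and F: "F = abs_L2 f" by (rule L2_cases)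
  show ?thesis
    unfolding F is_fourier_transform_iff_tendsto[OF f]
  proof
    assume "((\<lambda>R. fourier_truncated R f) \<longlongrightarrow> H) at_top"
    from tendsto_unique[OF trivial_limit_at_top_linorder this fourier_truncated_tendsto[OF f]]
    show "H = fourier_L2 (abs_L2 f)" .
  qed (simp add: fourier_truncated_tendsto[OF f])
qed

lemma norm_fourier_L2:
  "(norm (fourier_L2 F))\<^sup>2 = (2 * pi) ^ DIM('a) * (norm F)\<^sup>2" for F :: "'a::euclidean_space L2"
proof -
  obtain f where f: "sq_integrable f" and F: "F = abs_L2 f" by (rule L2_cases)
  have "((\<lambda>R. (norm (fourier_truncated R f))\<^sup>2) \<longlongrightarrow> (norm (fourier_L2 F))\<^sup>2) at_top"
    unfolding F by (intro tendsto_intros fourier_truncated_tendsto f)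
  moreover have "((\<lambda>R. (norm (fourier_truncated R f))\<^sup>2) \<longlongrightarrow> (2 * pi) ^ DIM('a) * (norm F)\<^sup>2) at_top"
    unfolding F norm_fourier_truncated[OF f] by (intro tendsto_intros truncation_tendsto f)
  ultimately show ?thesis by (rule tendsto_unique[OF trivial_limit_at_top_linorder])
qed

text \<open>Stated for differences because polarisation in \<open>cinner_scaled_isometry\<close>
  works with differences, scalar multiples and norms.\<close>

lemma fourier_L2_diff: "fourier_L2 (F - G) = fourier_L2 F - fourier_L2 G"
proof -
  obtain f where f: "sq_integrable f" and F: "F = abs_L2 f" by (rule L2_cases)
  obtain g where g: "sq_integrable g" and G: "G = abs_L2 g" by (rule L2_cases)
  note fg = sq_integrable_diff[OF f g]
  have "fourier_truncated R (\<lambda>x. f x - g x) = fourier_truncated R f - fourier_truncated R g" for R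
  proof -
    have "truncation R (\<lambda>x. f x - g x) = (\<lambda>x. truncation R f x - truncation R g x)"
      by (simp add: truncation_def fun_eq_iff scaleR_diff_right)
    then show ?thesis
      unfolding fourier_truncated_def
        abs_L2_diff[OF sq_integrable_fourier_truncation[OF f] sq_integrable_fourier_truncation[OF g]]
      by (simp add: fourier_integral_diff[OF integrable_truncation[OF f] integrable_truncation[OF g], symmetric])
  qed
  then have "((\<lambda>R. fourier_truncated R f - fourier_truncated R g) \<longlongrightarrow> fourier_L2 (F - G)) at_top"
    using fourier_truncated_tendsto[OF fg] by (simp add: F G abs_L2_diff[OF f g])
  moreover have "((\<lambda>R. fourier_truncated R f - fourier_truncated R g) \<longlongrightarrow> fourier_L2 F - fourier_L2 G) at_top"
    unfolding F G by (intro tendsto_intros fourier_truncated_tendsto f g)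
  ultimately show ?thesis by (rule tendsto_unique[OF trivial_limit_at_top_linorder])
qed

lemma fourier_L2_scaleC: "fourier_L2 (scaleC c F) = scaleC c (fourier_L2 F)"
proof -
  obtain f where f: "sq_integrable f" and F: "F = abs_L2 f" by (rule L2_cases)
  have "fourier_truncated R (\<lambda>x. c * f x) = scaleC c (fourier_truncated R f)" for R
  proof -
    have "truncation R (\<lambda>x. c * f x) = (\<lambda>x. c * truncation R f x)"
      by (simp add: truncation_def fun_eq_iff)
    then have "fourier_integral (truncation R (\<lambda>x. c * f x)) = (\<lambda>x. c * fourier_integral (truncation R f) x)"
      by (intro ext) (simp only: fourier_integral_cmult)
    then show ?thesis
      unfolding fourier_truncated_def abs_L2_scaleC[OF sq_integrable_fourier_truncation[OF f]] by simp
  qed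
  then have "((\<lambda>R. scaleC c (fourier_truncated R f)) \<longlongrightarrow> fourier_L2 (scaleC c F)) at_top"
    using fourier_truncated_tendsto[OF sq_integrable_cmult[OF f, of c]] by (simp add: F abs_L2_scaleC[OF f])
  moreover have "((\<lambda>R. scaleC c (fourier_truncated R f)) \<longlongrightarrow> scaleC c (fourier_L2 F)) at_top"
    unfolding F by (intro bounded_bilinear.tendsto[OF bounded_bilinear_scaleC] tendsto_const fourier_truncated_tendsto f)
  ultimately show ?thesis by (rule tendsto_unique[OF trivial_limit_at_top_linorder])
qed

lemma scaleC_neg_one: "scaleC (- 1) F = - F"
  by (simp add: uminus_L2_def)

section \<open>Polarisation, conjugation and bijectivity of the transform\<close>

lemma cinner_diff_left: "cinner (f - g) h = cinner f h - cinner g h"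
  by (rule bounded_bilinear.diff_left[OF bounded_bilinear_cinner])

lemma cinner_diff_right: "cinner h (f - g) = cinner h f - cinner h g"
  by (rule bounded_bilinear.diff_right[OF bounded_bilinear_cinner])

lemma cinner_eq_norms:
  "cinner f g = Complex (((norm f)\<^sup>2 + (norm g)\<^sup>2 - (norm (f - g))\<^sup>2) / 2)
     (((norm f)\<^sup>2 + (norm (scaleC \<i> g))\<^sup>2 - (norm (f - scaleC \<i> g))\<^sup>2) / 2)"
proof -
  have inner: "inner x y = ((norm x)\<^sup>2 + (norm y)\<^sup>2 - (norm (x - y))\<^sup>2) / 2" for x y :: "'a L2"
    by (simp add: power2_norm_eq_inner inner_diff_left inner_diff_right inner_commute)
  have "Re (cinner f g) = inner f g" "Im (cinner f g) = inner f (scaleC \<i> g)"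
    by (simp_all add: inner_L2_def cinner_scaleC_right)
  then show ?thesis by (simp add: complex_eq_iff inner)
qed

text \<open>Polarisation expresses the product through norms of differences and of multiples by
  \<open>\<i>\<close>, all of which \<open>T\<close> respects up to the factor \<open>k\<close>. It
  is applied to the Fourier transform with \<open>k = (2 * pi) ^ d\<close> and to the Schroedinger
  group with \<open>k = 1\<close>.\<close>

lemma cinner_scaled_isometry:
  assumes diff: "\<And>f g. T (f - g) = T f - T g" and scale: "\<And>c f. T (scaleC c f) = scaleC c (T f)"
    and norm: "\<And>f. (norm (T f))\<^sup>2 = k * (norm f)\<^sup>2"
  shows "cinner (T f) (T g) = of_real k * cinner f g"
  unfolding cinner_eq_norms[of "T f"] cinner_eq_norms[of f]
  by (simp add: diff[symmetric] scale[symmetric] norm complex_eq_iff algebra_simps)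

lemma cinner_fourier_L2:
  "cinner (fourier_L2 F) (fourier_L2 G) = of_real ((2 * pi) ^ DIM('a)) * cinner F G"
  for F G :: "'a::euclidean_space L2"
  by (rule cinner_scaled_isometry) (rule fourier_L2_diff fourier_L2_scaleC norm_fourier_L2)+

text \<open>Conjugating the second argument turns the sesquilinear product into the bilinear pairing
  \<open>\<integral> f g\<close>, the form in which Fubini exchanges the transform between two
  factors.\<close>

lift_definition cnj_L2 :: "'a::euclidean_space L2 \<Rightarrow> 'a L2" is "\<lambda>f x. cnj (f x)"
  by (auto simp: L2_rel_def sq_integrable_def)

lemma sq_integrable_cnj: "sq_integrable f \<Longrightarrow> sq_integrable (\<lambda>x. cnj (f x))"
  by (auto simp: sq_integrable_def)

lemma cnj_L2_abs_L2: "sq_integrable f \<Longrightarrow> cnj_L2 (abs_L2 f) = abs_L2 (\<lambda>x. cnj (f x))"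
  by (simp add: cnj_L2.abs_eq L2_rel_self)

lemma cnj_L2_cnj_L2: "cnj_L2 (cnj_L2 F) = F"
  by transfer (simp add: L2_rel_def)

lemma cnj_L2_diff: "cnj_L2 (F - G) = cnj_L2 F - cnj_L2 G"
proof -
  obtain f where f: "sq_integrable f" and F: "F = abs_L2 f" by (rule L2_cases)
  obtain g where g: "sq_integrable g" and G: "G = abs_L2 g" by (rule L2_cases)
  show ?thesis
    using f g by (simp add: F G abs_L2_diff cnj_L2_abs_L2 sq_integrable_cnj sq_integrable_diff)
qed

lemma norm_cnj_L2: "norm (cnj_L2 F) = norm F"
proof -
  obtain f where f: "sq_integrable f" and F: "F = abs_L2 f" by (rule L2_cases)
  have "(norm (cnj_L2 F))\<^sup>2 = (norm F)\<^sup>2"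
    using f by (simp add: F cnj_L2_abs_L2 norm_abs_L2 sq_integrable_cnj)
  then show ?thesis by simp
qed

lemma tendsto_cnj_L2:
  assumes "(X \<longlongrightarrow> F) \<F>"
  shows "((\<lambda>i. cnj_L2 (X i)) \<longlongrightarrow> cnj_L2 F) \<F>"
  using assms unfolding tendsto_dist_iff[of X] tendsto_dist_iff[of "\<lambda>i. cnj_L2 (X i)"]
  by (simp add: dist_norm cnj_L2_diff[symmetric] norm_cnj_L2)

text \<open>The Fubini exchange holds for truncations, which are integrable, and survives the limit
  because the product is jointly continuous.\<close>

lemma cinner_fourier_L2_swap:
  "cinner (fourier_L2 F) (cnj_L2 G) = cinner F (cnj_L2 (fourier_L2 G))"
proof -
  obtain f where f: "sq_integrable f" and F: "F = abs_L2 f" by (rule L2_cases)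
  obtain g where g: "sq_integrable g" and G: "G = abs_L2 g" by (rule L2_cases)
  have eq: "cinner (fourier_truncated R f) (cnj_L2 (abs_L2 (truncation R g)))
      = cinner (abs_L2 (truncation R f)) (cnj_L2 (fourier_truncated R g))" for R
    using f g fourier_integral_swap[OF integrable_truncation[OF f] integrable_truncation[OF g], of R R]
    by (simp add: fourier_truncated_def cnj_L2_abs_L2 abs_L2_cinner sq_integrable_cnj
        sq_integrable_fourier_truncation sq_integrable_truncation)
  have "((\<lambda>R. cinner (fourier_truncated R f) (cnj_L2 (abs_L2 (truncation R g))))
      \<longlongrightarrow> cinner (fourier_L2 F) (cnj_L2 G)) at_top"
    unfolding F G
    by (intro bounded_bilinear.tendsto[OF bounded_bilinear_cinner] tendsto_cnj_L2
        fourier_truncated_tendsto truncation_tendsto f g)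
  moreover have "((\<lambda>R. cinner (fourier_truncated R f) (cnj_L2 (abs_L2 (truncation R g))))
      \<longlongrightarrow> cinner F (cnj_L2 (fourier_L2 G))) at_top"
    unfolding F G eq
    by (intro bounded_bilinear.tendsto[OF bounded_bilinear_cinner] tendsto_cnj_L2
        fourier_truncated_tendsto truncation_tendsto f g)
  ultimately show ?thesis by (rule tendsto_unique[OF trivial_limit_at_top_linorder])
qed

lemma fourier_L2_inj: "fourier_L2 F = fourier_L2 G \<Longrightarrow> F = G" for F G :: "'a::euclidean_space L2"
  using norm_fourier_L2[of "F - G"] by (simp add: fourier_L2_diff)

text \<open>
  By the swapping rule the candidate preimage differs from \<open>H\<close> by an element orthogonal to the
  range, and the same rule shows that such an element vanishes.
\<close>

lemma fourier_L2_surj: "\<exists>G. fourier_L2 G = H" for H :: "'a::euclidean_space L2"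
proof -
  define k where "k = complex_of_real ((2 * pi) ^ DIM('a))"
  have k: "k \<noteq> 0" by (simp add: k_def)
  define G where "G = scaleC (inverse k) (cnj_L2 (fourier_L2 (cnj_L2 H)))"
  have kG: "cnj_L2 (fourier_L2 (cnj_L2 H)) = scaleC k G"
    using k by (simp add: G_def scaleC_scaleC scaleC_one)
  define W where "W = H - fourier_L2 G"
  have orth: "cinner (fourier_L2 F) W = 0" for F
  proof -
    have "cinner (fourier_L2 F) H = cinner F (scaleC k G)"
      using cinner_fourier_L2_swap[of F "cnj_L2 H"] by (simp add: cnj_L2_cnj_L2 kG)
    also have "\<dots> = k * cinner F G" by (simp add: cinner_scaleC_right k_def)
    also have "\<dots> = cinner (fourier_L2 F) (fourier_L2 G)" by (simp only: cinner_fourier_L2 k_def)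
    finally show ?thesis by (simp add: W_def cinner_diff_right)
  qed
  define V where "V = cnj_L2 (fourier_L2 (cnj_L2 W))"
  have "cinner V V = 0"
    using cinner_fourier_L2_swap[of V "cnj_L2 W"] orth[of V] by (simp add: cnj_L2_cnj_L2 V_def)
  then have "norm (fourier_L2 (cnj_L2 W)) = 0"
    by (simp add: cinner_self V_def norm_cnj_L2)
  then have "norm W = 0"
    using norm_fourier_L2[of "cnj_L2 W"] by (simp add: norm_cnj_L2)
  then have "fourier_L2 G = H" by (simp add: W_def)
  then show ?thesis ..
qed


section \<open>The Schroedinger group\<close>

lemma schroedinger_symbol_abs_L2:
  "sq_integrable f \<Longrightarrow> schroedinger_symbol t (abs_L2 f)
    = abs_L2 (\<lambda>\<xi>. exp (- \<i> * of_real (t * (norm \<xi>)\<^sup>2)) * f \<xi>)"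
  by (simp only: schroedinger_symbol.abs_eq L2_rel_self)

lemma sq_integrable_schroedinger_symbol:
  fixes f :: "'a::euclidean_space \<Rightarrow> complex"
  assumes "sq_integrable f"
  shows "sq_integrable (\<lambda>\<xi>. exp (- \<i> * of_real (t * (norm \<xi>)\<^sup>2)) * f \<xi>)"
proof (rule sq_integrable_mult_bounded[OF assms])
  show "cmod (exp (- \<i> * of_real (t * (norm \<xi>)\<^sup>2))) \<le> 1" for \<xi> :: 'a
    by (simp only: cmod_exp_minus_ii_of_real)
qed measurable

lemma schroedinger_symbol_diff:
  "schroedinger_symbol t (F - G) = schroedinger_symbol t F - schroedinger_symbol t G"
proof -
  obtain f where f: "sq_integrable f" and F: "F = abs_L2 f" by (rule L2_cases)
  obtain g where g: "sq_integrable g" and G: "G = abs_L2 g" by (rule L2_cases)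
  show ?thesis
    unfolding F G abs_L2_diff[OF f g] schroedinger_symbol_abs_L2[OF f] schroedinger_symbol_abs_L2[OF g]
      schroedinger_symbol_abs_L2[OF sq_integrable_diff[OF f g]]
      abs_L2_diff[OF sq_integrable_schroedinger_symbol[OF f] sq_integrable_schroedinger_symbol[OF g]]
    by (simp only: right_diff_distrib)
qed

lemma schroedinger_symbol_scaleC:
  "schroedinger_symbol t (scaleC c F) = scaleC c (schroedinger_symbol t F)"
proof -
  obtain f where f: "sq_integrable f" and F: "F = abs_L2 f" by (rule L2_cases)
  show ?thesis
    unfolding F abs_L2_scaleC[OF f] schroedinger_symbol_abs_L2[OF f]
      schroedinger_symbol_abs_L2[OF sq_integrable_cmult[OF f]]
      abs_L2_scaleC[OF sq_integrable_schroedinger_symbol[OF f]]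
    by (simp only: mult_ac)
qed

lemma schroedinger_symbol_add:
  "schroedinger_symbol s (schroedinger_symbol t F) = schroedinger_symbol (s + t) F"
proof -
  obtain f where f: "sq_integrable f" and F: "F = abs_L2 f" by (rule L2_cases)
  show ?thesis
    unfolding F schroedinger_symbol_abs_L2[OF f]
      schroedinger_symbol_abs_L2[OF sq_integrable_schroedinger_symbol[OF f]]
    by (simp only: mult.assoc[symmetric] exp_add[symmetric] distrib_right of_real_add distrib_left)
qed

lemma schroedinger_symbol_zero: "schroedinger_symbol 0 F = F"
  by (rule L2_cases[of F]) (simp add: schroedinger_symbol_abs_L2)

lemma norm_schroedinger_symbol: "norm (schroedinger_symbol t F) = norm F"
proof -
  obtain f where f: "sq_integrable f" and F: "F = abs_L2 f" by (rule L2_cases)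
  have "(norm (schroedinger_symbol t F))\<^sup>2 = (norm F)\<^sup>2"
    unfolding F schroedinger_symbol_abs_L2[OF f] norm_abs_L2[OF f]
      norm_abs_L2[OF sq_integrable_schroedinger_symbol[OF f]]
      norm_mult cmod_exp_minus_ii_of_real by simp
  then show ?thesis by simp
qed

text \<open>Bijectivity of the transform gives the definite description in
  \<open>schroedinger_group\<close> exactly one witness. The group law and unitarity then follow by
  pulling the multiplier back along the injective transform.\<close>

lemma fourier_L2_schroedinger_group:
  "fourier_L2 (schroedinger_group t F) = schroedinger_symbol t (fourier_L2 F)"
proof -
  have "\<exists>!G. fourier_L2 G = schroedinger_symbol t (fourier_L2 F)"
    using fourier_L2_surj fourier_L2_inj by metis
  from theI'[OF this] show ?thesis
    by (simp add: schroedinger_group_def is_fourier_transform_iff eq_commute)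
qed

lemma schroedinger_group_diff:
  "schroedinger_group t (F - G) = schroedinger_group t F - schroedinger_group t G"
  by (rule fourier_L2_inj)
    (simp add: fourier_L2_schroedinger_group fourier_L2_diff schroedinger_symbol_diff)

lemma schroedinger_group_scaleC:
  "schroedinger_group t (scaleC c F) = scaleC c (schroedinger_group t F)"
  by (rule fourier_L2_inj)
    (simp add: fourier_L2_schroedinger_group fourier_L2_scaleC schroedinger_symbol_scaleC)

lemma schroedinger_group_add:
  "schroedinger_group s (schroedinger_group t F) = schroedinger_group (s + t) F"
  by (rule fourier_L2_inj) (simp add: fourier_L2_schroedinger_group schroedinger_symbol_add)

lemma schroedinger_group_zero: "schroedinger_group 0 F = F"
  by (rule fourier_L2_inj) (simp add: fourier_L2_schroedinger_group schroedinger_symbol_zero)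

lemma norm_schroedinger_group: "norm (schroedinger_group t F) = norm F"
proof -
  have "(norm (fourier_L2 (schroedinger_group t F)))\<^sup>2 = (norm (fourier_L2 F))\<^sup>2"
    by (simp add: fourier_L2_schroedinger_group norm_schroedinger_symbol)
  then show ?thesis by (simp add: norm_fourier_L2)
qed

lemma cinner_schroedinger_group: "cinner (schroedinger_group t F) (schroedinger_group t G) = cinner F G"
  using cinner_scaled_isometry[of "schroedinger_group t" 1 F G]
  by (simp add: schroedinger_group_diff schroedinger_group_scaleC norm_schroedinger_group)

lemma bounded_linear_schroedinger_group: "bounded_linear (schroedinger_group t)"
proof (rule bounded_linear_intro[where K=1])
  fix F G :: "'a L2"
  have "schroedinger_group t (F - scaleC (- 1) G) = schroedinger_group t F - scaleC (- 1) (schroedinger_group t G)"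
    by (simp only: schroedinger_group_diff schroedinger_group_scaleC)
  then show "schroedinger_group t (F + G) = schroedinger_group t F + schroedinger_group t G"
    by (simp add: scaleC_neg_one)
qed (simp_all add: scaleR_eq_scaleC schroedinger_group_scaleC norm_schroedinger_group)


section \<open>The pathwise equation for the correlation\<close>

text \<open>The coupling uses only complex-linear operations and the scalar product of its
  arguments, and a unitary map respects all of these. This is where dispersion drops out of the
  dynamics of the scalar product.\<close>

lemma schroedinger_group_coupling:
  "schroedinger_group t (coupling K \<theta> x y) = coupling K \<theta> (schroedinger_group t x) (schroedinger_group t y)"
  unfolding coupling_def
  by (simp add: scaleR_eq_scaleC schroedinger_group_scaleC schroedinger_group_diff cinner_schroedinger_group)

text \<open>Passage to the interaction picture: applying \<open>U(- t)\<close> to Duhamel's formula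
  removes \<open>t\<close> from the integrand, so \<open>U(- t) \<phi>(t)\<close> is an ordinary
  primitive and can be differentiated.\<close>

lemma mild_solution_has_integral:
  assumes "mild_solution u G \<phi>" and t: "0 \<le> t"
  shows "((\<lambda>s. schroedinger_group (- s) (G s)) has_integral (schroedinger_group (- t) (\<phi> t) - u)) {0..t}"
proof -
  have "((\<lambda>s. schroedinger_group (t - s) (G s)) has_integral (\<phi> t - schroedinger_group t u)) {0..t}"
    using assms by (auto simp: mild_solution_def)
  from has_integral_linear[OF this bounded_linear_schroedinger_group[of "- t"]]
  show ?thesis
    by (simp add: o_def schroedinger_group_add schroedinger_group_diff schroedinger_group_zero)
qed

section \<open>Calculus in the interaction picture: conserved norms and a Riccati equation\<close>

lemma continuous_on_cinner [continuous_intros]: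
  assumes "continuous_on S f" "continuous_on S g"
  shows "continuous_on S (\<lambda>x. cinner (f x) (g x))"
  by (rule bounded_bilinear.continuous_on[OF bounded_bilinear_cinner assms])

lemma continuous_on_scaleC [continuous_intros]:
  assumes "continuous_on S f" "continuous_on S g"
  shows "continuous_on S (\<lambda>x. scaleC (f x) (g x))"
  by (rule bounded_bilinear.continuous_on[OF bounded_bilinear_scaleC assms])

text \<open>The two parts form a bootstrap. A primitive is continuous for any integrable
  \<open>f\<close>; when \<open>f\<close> is built from the primitive itself, this yields the
  continuity of \<open>f\<close> demanded by the second part.\<close>

lemma
  fixes \<eta> f :: "real \<Rightarrow> 'b::banach"
  assumes int: "\<And>t. t \<ge> 0 \<Longrightarrow> (f has_integral (\<eta> t - u)) {0..t}"
  shows has_integral_primitive_continuous_on: "continuous_on {0..T} \<eta>"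
    and has_integral_primitive_derivative: "continuous_on {0..T} f \<Longrightarrow> t \<in> {0..T} \<Longrightarrow>
      (\<eta> has_vector_derivative f t) (at t within {0..T})"
proof -
  have eq: "\<eta> t = integral {0..t} f + u" if "t \<in> {0..T}" for t
    using int[of t] that by (auto simp: integral_unique)
  have "f integrable_on {0..T}"
    using int[of T] by (cases "T \<ge> 0") (auto simp: integrable_on_def)
  then have "continuous_on {0..T} (\<lambda>t. integral {0..t} f + u)"
    by (intro continuous_intros indefinite_integral_continuous_1)
  then show "continuous_on {0..T} \<eta>"
    by (rule continuous_on_eq) (simp add: eq)
  assume f: "continuous_on {0..T} f" and t: "t \<in> {0..T}"
  have "((\<lambda>t. integral {0..t} f + u) has_vector_derivative (f t + 0)) (at t within {0..T})"
    by (intro has_vector_derivative_add has_vector_derivative_const integral_has_vector_derivative f t)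
  then show "(\<eta> has_vector_derivative f t) (at t within {0..T})"
    using eq t by (intro has_vector_derivative_transform[of t "{0..T}" \<eta> "\<lambda>t. integral {0..t} f + u"]) auto
qed

text \<open>Integrating factor: with a primitive \<open>P\<close> of \<open>p\<close>, the function
  \<open>q exp(- P)\<close> has zero derivative.\<close>

lemma linear_ode_zero:
  fixes q p :: "real \<Rightarrow> real"
  assumes q: "\<And>t. t \<in> {0..T} \<Longrightarrow> (q has_vector_derivative (p t * q t)) (at t within {0..T})"
    and p: "continuous_on {0..T} p" and q0: "q 0 = 0" and t: "t \<in> {0..T}"
  shows "q t = 0"
proof -
  define P where "P t = integral {0..t} p" for t
  have P: "(P has_vector_derivative p t) (at t within {0..T})" if "t \<in> {0..T}" for t
    unfolding P_def[abs_def] by (rule integral_has_vector_derivative[OF p that])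
  have "((\<lambda>t. q t * exp (- P t)) has_derivative (\<lambda>_. 0)) (at t within {0..T})" if "t \<in> {0..T}" for t
  proof -
    have "((\<lambda>t. q t * exp (- P t)) has_real_derivative 0) (at t within {0..T})"
      using q[OF that] P[OF that] unfolding has_real_derivative_iff_has_vector_derivative[symmetric]
      by (auto intro!: derivative_eq_intros)
    then show ?thesis by (simp add: has_field_derivative_def lambda_zero[symmetric])
  qed
  then obtain c where "\<And>t. t \<in> {0..T} \<Longrightarrow> q t * exp (- P t) = c"
    using has_derivative_zero_constant[of "{0..T}" "\<lambda>t. q t * exp (- P t)"] by auto
  from this[of t] this[of 0] t q0 have "q t * exp (- P t) = 0" by auto
  then show ?thesis by simp
qed

text \<open>The defect \<open>1 - |\<eta>1|^2\<close> solves a homogeneous linear equation with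
  continuous coefficient and starts at 0. As the equations are symmetric, exchanging the components
  and replacing \<open>\<theta>\<close> by \<open>- \<theta>\<close> covers the second norm.\<close>

lemma coupled_norm_conserved:
  fixes \<eta>1 \<eta>2 :: "real \<Rightarrow> 'a::euclidean_space L2"
  assumes d: "\<And>t. t \<in> {0..T} \<Longrightarrow>
      (\<eta>1 has_vector_derivative coupling K (\<theta> t) (\<eta>1 t) (\<eta>2 t)) (at t within {0..T})"
    and c2: "continuous_on {0..T} \<eta>2" and c\<theta>: "continuous_on {0..T} \<theta>"
    and init: "norm (\<eta>1 0) = 1" and t: "t \<in> {0..T}"
  shows "norm (\<eta>1 t) = 1"
proof -
  define p where "p t = Re (exp (\<i> * of_real (\<theta> t)) * cinner (\<eta>1 t) (\<eta>2 t))" for t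
  have c1: "continuous_on {0..T} \<eta>1"
    by (rule continuous_on_vector_derivative[OF d])
  have inner_coupling: "2 * inner (\<eta>1 t) (coupling K (\<theta> t) (\<eta>1 t) (\<eta>2 t)) = K * p t * (1 - (norm (\<eta>1 t))\<^sup>2)" for t
  proof -
    have "cinner (\<eta>2 t) (\<eta>1 t) = cnj (cinner (\<eta>1 t) (\<eta>2 t))" by (rule cinner_commute)
    moreover have "exp (- \<i> * of_real (\<theta> t)) = cnj (exp (\<i> * of_real (\<theta> t)))" by (simp add: exp_cnj)
    ultimately have "cinner (coupling K (\<theta> t) (\<eta>1 t) (\<eta>2 t)) (\<eta>1 t)
        = of_real (K / 2) * (cnj (exp (\<i> * of_real (\<theta> t)) * cinner (\<eta>1 t) (\<eta>2 t))
          - exp (\<i> * of_real (\<theta> t)) * cinner (\<eta>1 t) (\<eta>2 t) * of_real ((norm (\<eta>1 t))\<^sup>2))"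
      unfolding coupling_def scaleR_eq_scaleC cinner_scaleC_left cinner_diff_left cinner_self by simp
    moreover have "Re (of_real k * (cnj w - w * of_real n)) = k * (Re w - Re w * n)" for k n :: real and w
      by simp
    ultimately have "Re (cinner (coupling K (\<theta> t) (\<eta>1 t) (\<eta>2 t)) (\<eta>1 t)) = K / 2 * (p t - p t * (norm (\<eta>1 t))\<^sup>2)"
      by (simp only: p_def)
    then show ?thesis
      by (subst inner_commute) (simp add: inner_L2_def algebra_simps)
  qed
  define q where "q t = 1 - (norm (\<eta>1 t))\<^sup>2" for t
  have "(q has_vector_derivative (- K * p t) * q t) (at t within {0..T})" if "t \<in> {0..T}" for t
  proof -
    have "((\<lambda>t. inner (\<eta>1 t) (\<eta>1 t)) has_vector_derivative
        (inner (\<eta>1 t) (coupling K (\<theta> t) (\<eta>1 t) (\<eta>2 t)) + inner (coupling K (\<theta> t) (\<eta>1 t) (\<eta>2 t)) (\<eta>1 t)))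
        (at t within {0..T})"
      by (rule bounded_bilinear.has_vector_derivative[OF bounded_bilinear_inner d[OF that] d[OF that]])
    also have "inner (\<eta>1 t) (coupling K (\<theta> t) (\<eta>1 t) (\<eta>2 t)) + inner (coupling K (\<theta> t) (\<eta>1 t) (\<eta>2 t)) (\<eta>1 t)
        = 2 * inner (\<eta>1 t) (coupling K (\<theta> t) (\<eta>1 t) (\<eta>2 t))"
      by (simp add: inner_commute)
    also have "\<dots> = K * p t * q t" by (simp add: inner_coupling q_def)
    finally have "((\<lambda>t. 1 - inner (\<eta>1 t) (\<eta>1 t)) has_vector_derivative (0 - K * p t * q t)) (at t within {0..T})"
      by (intro has_vector_derivative_diff has_vector_derivative_const)
    then show ?thesis by (simp add: q_def[abs_def] power2_norm_eq_inner)
  qed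
  moreover have "continuous_on {0..T} (\<lambda>t. - K * p t)"
    unfolding p_def by (intro continuous_intros c1 c2 c\<theta>)
  moreover have "q 0 = 0" using init by (simp add: q_def)
  ultimately have "q t = 0" using t by (rule linear_ode_zero)
  then have "(norm (\<eta>1 t))\<^sup>2 = 1\<^sup>2" by (simp add: q_def)
  then show ?thesis by (rule power2_eq_imp_eq) auto
qed

text \<open>Both terms of the product rule contribute the same half, because the norms are 1 and
  conjugation exchanges the phases. The sum involves the vectors only through their scalar product,
  so the equation closes.\<close>

lemma coupled_cinner_derivative:
  fixes \<eta>1 \<eta>2 :: "real \<Rightarrow> 'a::euclidean_space L2"
  assumes d1: "(\<eta>1 has_vector_derivative coupling K \<theta> (\<eta>1 t) (\<eta>2 t)) (at t within S)"
    and d2: "(\<eta>2 has_vector_derivative coupling K (- \<theta>) (\<eta>2 t) (\<eta>1 t)) (at t within S)"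
    and n: "norm (\<eta>1 t) = 1" "norm (\<eta>2 t) = 1"
  shows "((\<lambda>t. cinner (\<eta>1 t) (\<eta>2 t)) has_vector_derivative
    of_real K * (exp (- \<i> * of_real \<theta>) - exp (\<i> * of_real \<theta>) * (cinner (\<eta>1 t) (\<eta>2 t))\<^sup>2)) (at t within S)"
proof -
  let ?a = "cinner (\<eta>1 t) (\<eta>2 t)"
  have "((\<lambda>t. cinner (\<eta>1 t) (\<eta>2 t)) has_vector_derivative
      (cinner (\<eta>1 t) (coupling K (- \<theta>) (\<eta>2 t) (\<eta>1 t)) + cinner (coupling K \<theta> (\<eta>1 t) (\<eta>2 t)) (\<eta>2 t))) (at t within S)"
    by (rule bounded_bilinear.has_vector_derivative[OF bounded_bilinear_cinner d1 d2])
  also have "cinner (\<eta>1 t) (coupling K (- \<theta>) (\<eta>2 t) (\<eta>1 t)) = of_real (K / 2) *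
      (exp (- \<i> * of_real \<theta>) - exp (\<i> * of_real \<theta>) * ?a\<^sup>2)"
    using n cinner_commute[of "\<eta>2 t" "\<eta>1 t"]
    by (simp add: coupling_def scaleR_eq_scaleC cinner_scaleC_right cinner_diff_right cinner_self exp_cnj power2_eq_square)
  also have "cinner (coupling K \<theta> (\<eta>1 t) (\<eta>2 t)) (\<eta>2 t) = of_real (K / 2) *
      (exp (- \<i> * of_real \<theta>) - exp (\<i> * of_real \<theta>) * ?a\<^sup>2)"
    using n
    by (simp add: coupling_def scaleR_eq_scaleC cinner_scaleC_left cinner_diff_left cinner_self power2_eq_square)
  also have "of_real (K / 2) * X + of_real (K / 2) * X = of_real K * X" for X :: complex
    by (simp add: distrib_right[symmetric])
  finally show ?thesis .
qed

section \<open>Increments of the correlation over one time step\<close>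

lemma cmod_exp_ii_diff_le: "cmod (exp (\<i> * of_real a) - exp (\<i> * of_real b)) \<le> \<bar>a - b\<bar>"
proof -
  have "exp (\<i> * of_real a) - exp (\<i> * of_real b) = exp (\<i> * of_real b) * (exp (\<i> * of_real (a - b)) - 1)"
    by (simp add: algebra_simps exp_add[symmetric])
  then have "cmod (exp (\<i> * of_real a) - exp (\<i> * of_real b)) = cmod (iexp (a - b) - 1)"
    by (simp add: norm_mult)
  also have "\<dots> \<le> \<bar>a - b\<bar>"
    using iexp_approx1[of "a - b" 0] by simp
  finally show ?thesis .
qed

text \<open>Here \<open>a\<close> is the correlation of the gauged wave functions and \<open>z\<close> that of the original ones.\<close>

lemma correlation_increment:
  fixes a :: "real \<Rightarrow> complex" and \<theta> :: "real \<Rightarrow> real"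
  assumes K: "K \<ge> 0" and t: "0 \<le> t" and h: "0 \<le> h"
    and da: "\<And>s. s \<in> {0..t + h} \<Longrightarrow> (a has_vector_derivative
      of_real K * (exp (- \<i> * of_real (\<theta> s)) - exp (\<i> * of_real (\<theta> s)) * (a s)\<^sup>2)) (at s within {0..t + h})"
    and c\<theta>: "continuous_on {0..t + h} \<theta>"
    and a1: "\<And>s. s \<in> {0..t + h} \<Longrightarrow> cmod (a s) \<le> 1"
    and z: "\<And>s. s \<in> {0..t + h} \<Longrightarrow> z s = exp (\<i> * of_real (\<theta> s)) * a s"
  shows "cmod (z (t + h) - exp (\<i> * of_real (\<theta> (t + h) - \<theta> t)) * z t) \<le> 2 * K * h"
    and "cmod (z (t + h) - exp (\<i> * of_real (\<theta> (t + h) - \<theta> t)) * z t - of_real (h * K) * (1 - (z t)\<^sup>2))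
      \<le> integral {t..t + h} (\<lambda>s. 2 * K * (\<bar>\<theta> (t + h) - \<theta> s\<bar> + \<bar>\<theta> s - \<theta> t\<bar> + 2 * K * h))"
proof -
  define T where "T = t + h"
  have T: "t \<le> T" "t \<in> {0..T}" "T \<in> {0..T}" using t h by (auto simp: T_def)
  note da = da[folded T_def] and c\<theta> = c\<theta>[folded T_def] and a1 = a1[folded T_def] and z = z[folded T_def]
  have z1: "cmod (z s) \<le> 1" if "s \<in> {0..T}" for s using a1[OF that] by (simp add: z[OF that] norm_mult)
  have ca: "continuous_on {0..T} a"
    by (rule continuous_on_vector_derivative[OF da])
  have cz: "continuous_on {0..T} z"
  proof -
    have "continuous_on {0..T} (\<lambda>s. exp (\<i> * of_real (\<theta> s)) * a s)"
      by (intro continuous_intros ca c\<theta>)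
    then show ?thesis by (rule continuous_on_eq) (simp add: z)
  qed
  \<comment> \<open>Variation of constants for \<open>z\<close>: \<open>g r s\<close> is the drift
    at time \<open>s\<close> carried to the phase of time \<open>r\<close>, and its integral over
    \<open>{t..r}\<close> is \<open>z r\<close> minus the rotated \<open>z t\<close>.\<close>
  define g where "g r s = of_real K * (exp (\<i> * of_real (\<theta> r - \<theta> s)) * (1 - (z s)\<^sup>2))" for r s
  have z2: "cmod (1 - (z s)\<^sup>2) \<le> 2" if "s \<in> {0..T}" for s
  proof -
    have "cmod (1 - (z s)\<^sup>2) \<le> cmod 1 + cmod ((z s)\<^sup>2)" by (rule norm_triangle_ineq4)
    also have "\<dots> \<le> 1 + 1" using z1[OF that] by (simp add: norm_power power_le_one)
    finally show ?thesis by simp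
  qed
  have gb: "cmod (g r s) \<le> 2 * K" if "s \<in> {0..T}" for r s
    using K z2[OF that] by (simp add: g_def norm_mult mult.commute[of K] mult_right_mono)
  have gint: "((\<lambda>s. g r s) has_integral (z r - exp (\<i> * of_real (\<theta> r - \<theta> t)) * z t)) {t..r}"
    if r: "t \<le> r" "r \<in> {0..T}" for r
  proof -
    have "((\<lambda>s. of_real K * (exp (- \<i> * of_real (\<theta> s)) - exp (\<i> * of_real (\<theta> s)) * (a s)\<^sup>2))
        has_integral (a r - a t)) {t..r}"
    proof (rule fundamental_theorem_of_calculus[OF r(1)])
      fix s assume "s \<in> {t..r}"
      then show "(a has_vector_derivative of_real K * (exp (- \<i> * of_real (\<theta> s))
          - exp (\<i> * of_real (\<theta> s)) * (a s)\<^sup>2)) (at s within {t..r})"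
        using r t by (intro has_vector_derivative_within_subset[OF da]) auto
    qed
    from has_integral_mult_right[OF this, of "exp (\<i> * of_real (\<theta> r))"]
    have G1: "((\<lambda>s. exp (\<i> * of_real (\<theta> r)) * (of_real K * (exp (- \<i> * of_real (\<theta> s)) - exp (\<i> * of_real (\<theta> s)) * (a s)\<^sup>2)))
        has_integral (exp (\<i> * of_real (\<theta> r)) * (a r - a t))) {t..r}" .
    have G2: "exp (\<i> * of_real (\<theta> r)) * (of_real K * (exp (- \<i> * of_real (\<theta> s)) - exp (\<i> * of_real (\<theta> s)) * (a s)\<^sup>2)) = g r s"
      if "s \<in> {t..r}" for s
    proof -
      have s: "s \<in> {0..T}" using that r t by auto
      have e: "exp (\<i> * of_real (\<theta> r - \<theta> s)) = exp (\<i> * of_real (\<theta> r)) * exp (- \<i> * of_real (\<theta> s))"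
        by (simp add: exp_add[symmetric] algebra_simps)
      have "exp (- \<i> * of_real (\<theta> s)) * exp (\<i> * of_real (\<theta> s)) = 1"
        by (simp add: exp_add[symmetric])
      then have "exp (- \<i> * of_real (\<theta> s)) * (exp (\<i> * of_real (\<theta> s)) * a s)\<^sup>2 = exp (\<i> * of_real (\<theta> s)) * (a s)\<^sup>2"
        by (simp only: power2_eq_square mult.assoc[symmetric]) simp
      then show ?thesis
        unfolding g_def e z[OF s] by (simp only: right_diff_distrib mult_1_right mult_1_left mult_ac)
    qed
    have G3: "exp (\<i> * of_real (\<theta> r)) * (a r - a t) = z r - exp (\<i> * of_real (\<theta> r - \<theta> t)) * z t"
    proof -
      have e: "exp (\<i> * of_real (\<theta> r - \<theta> t)) * exp (\<i> * of_real (\<theta> t)) = exp (\<i> * of_real (\<theta> r))"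
        by (simp add: exp_add[symmetric] algebra_simps)
      show ?thesis
        unfolding z[OF r(2)] z[OF T(2)] mult.assoc[symmetric] e by (simp only: right_diff_distrib)
    qed
    show ?thesis using has_integral_eq[OF G2 G1] unfolding G3 .
  qed
  have first: "cmod (z r - exp (\<i> * of_real (\<theta> r - \<theta> t)) * z t) \<le> 2 * K * (r - t)" if r: "t \<le> r" "r \<in> {0..T}" for r
  proof -
    have "cmod (z r - exp (\<i> * of_real (\<theta> r - \<theta> t)) * z t) \<le> 2 * K * measure lborel (cbox t r)"
      by (rule has_integral_bound[where f="g r"]) (use K gint[OF r] gb r t in auto)
    then show ?thesis using r by simp
  qed
  from first[OF T(1,3)]
  show "cmod (z (t + h) - exp (\<i> * of_real (\<theta> (t + h) - \<theta> t)) * z t) \<le> 2 * K * h"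
    by (simp add: T_def)
  have e0: "cmod (exp (\<i> * of_real x) - exp (\<i> * of_real 0)) \<le> \<bar>x\<bar>" for x
    using cmod_exp_ii_diff_le[of x 0] by (simp only: diff_zero)
  have zdiff: "cmod (z s - z t) \<le> \<bar>\<theta> s - \<theta> t\<bar> + 2 * K * h" if s: "s \<in> {t..T}" for s
  proof -
    have "z s - z t = (z s - exp (\<i> * of_real (\<theta> s - \<theta> t)) * z t) + (exp (\<i> * of_real (\<theta> s - \<theta> t)) - exp (\<i> * of_real 0)) * z t"
      by (simp add: algebra_simps)
    also have "cmod \<dots> \<le> 2 * K * (s - t) + \<bar>\<theta> s - \<theta> t\<bar> * 1"
    proof (intro order_trans[OF norm_triangle_ineq] add_mono)
      show "cmod (z s - exp (\<i> * of_real (\<theta> s - \<theta> t)) * z t) \<le> 2 * K * (s - t)"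
        using s t by (intro first) auto
      show "cmod ((exp (\<i> * of_real (\<theta> s - \<theta> t)) - exp (\<i> * of_real 0)) * z t) \<le> \<bar>\<theta> s - \<theta> t\<bar> * 1"
        unfolding norm_mult by (intro mult_mono e0 z1 T) auto
    qed
    also have "2 * K * (s - t) \<le> 2 * K * h" using s K by (intro mult_left_mono) (auto simp: T_def)
    finally show ?thesis by simp
  qed
  have "((\<lambda>s. g T s - of_real K * (1 - (z t)\<^sup>2)) has_integral
      (z T - exp (\<i> * of_real (\<theta> T - \<theta> t)) * z t - (T - t) *\<^sub>R (of_real K * (1 - (z t)\<^sup>2)))) {t..T}"
    using has_integral_const_real[of "complex_of_real K * (1 - (z t)\<^sup>2)" t T] T
    by (intro has_integral_diff gint) (auto)
  moreover have eq: "(T - t) *\<^sub>R (of_real K * (1 - (z t)\<^sup>2)) = of_real (h * K) * (1 - (z t)\<^sup>2)"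
    by (simp add: T_def scaleR_conv_of_real)
  ultimately have gi: "((\<lambda>s. g T s - of_real K * (1 - (z t)\<^sup>2)) has_integral
      (z T - exp (\<i> * of_real (\<theta> T - \<theta> t)) * z t - of_real (h * K) * (1 - (z t)\<^sup>2))) {t..T}" by simp
  have "cmod (integral {t..T} (\<lambda>s. g T s - of_real K * (1 - (z t)\<^sup>2)))
      \<le> integral {t..T} (\<lambda>s. 2 * K * (\<bar>\<theta> T - \<theta> s\<bar> + \<bar>\<theta> s - \<theta> t\<bar> + 2 * K * h))"
  proof (rule integral_norm_bound_integral)
    show "(\<lambda>s. g T s - of_real K * (1 - (z t)\<^sup>2)) integrable_on {t..T}" using gi by blast
    have "continuous_on {t..T} \<theta>" by (rule continuous_on_subset[OF c\<theta>]) (use t in auto)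
    then show "(\<lambda>s. 2 * K * (\<bar>\<theta> T - \<theta> s\<bar> + \<bar>\<theta> s - \<theta> t\<bar> + 2 * K * h)) integrable_on {t..T}"
      by (intro integrable_continuous_real continuous_intros)
    fix s assume s: "s \<in> {t..T}"
    then have s0: "s \<in> {0..T}" using t by auto
    \<comment> \<open>The deviation from the drift frozen at \<open>t\<close> splits into a phase
      error and the change of \<open>z\<close> since \<open>t\<close>; the accompanying factors
      \<open>1 - (z s)^2\<close> and \<open>z s + z t\<close> have modulus at most 2. The constant 1
      appears as an exponential of 0 so that the Lipschitz bound for phases applies.\<close>
    have "g T s - of_real K * (1 - (z t)\<^sup>2) = of_real K *
        ((exp (\<i> * of_real (\<theta> T - \<theta> s)) - exp (\<i> * of_real 0)) * (1 - (z s)\<^sup>2) - (z s - z t) * (z s + z t))"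
      by (simp add: g_def algebra_simps power2_eq_square)
    also have "cmod \<dots> \<le> K * (\<bar>\<theta> T - \<theta> s\<bar> * 2 + (\<bar>\<theta> s - \<theta> t\<bar> + 2 * K * h) * 2)"
    proof -
      have b1: "cmod ((exp (\<i> * of_real (\<theta> T - \<theta> s)) - exp (\<i> * of_real 0)) * (1 - (z s)\<^sup>2)) \<le> \<bar>\<theta> T - \<theta> s\<bar> * 2"
        unfolding norm_mult
        by (intro mult_mono z2 s0 e0) auto
      have b2: "cmod ((z s - z t) * (z s + z t)) \<le> (\<bar>\<theta> s - \<theta> t\<bar> + 2 * K * h) * 2"
        unfolding norm_mult
        by (intro mult_mono zdiff s)
          (use K h norm_triangle_ineq[of "z s" "z t"] z1[OF s0] z1[OF T(2)] in auto)
      show ?thesis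
        unfolding norm_mult[of "of_real K"] norm_of_real abs_of_nonneg[OF K]
        by (intro mult_left_mono order_trans[OF norm_triangle_ineq4] add_mono b1 b2 K)
    qed
    also have "\<dots> = 2 * K * (\<bar>\<theta> T - \<theta> s\<bar> + \<bar>\<theta> s - \<theta> t\<bar> + 2 * K * h)" by (simp add: algebra_simps)
    finally show "cmod (g T s - of_real K * (1 - (z t)\<^sup>2))
      \<le> 2 * K * (\<bar>\<theta> T - \<theta> s\<bar> + \<bar>\<theta> s - \<theta> t\<bar> + 2 * K * h)" .
  qed
  then show "cmod (z (t + h) - exp (\<i> * of_real (\<theta> (t + h) - \<theta> t)) * z t - of_real (h * K) * (1 - (z t)\<^sup>2))
      \<le> integral {t..t + h} (\<lambda>s. 2 * K * (\<bar>\<theta> (t + h) - \<theta> s\<bar> + \<bar>\<theta> s - \<theta> t\<bar> + 2 * K * h))"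
    using integral_unique[OF gi] by (simp add: T_def)
qed

text \<open>Two gauges are removed together, the random phases and the free group. The scalar
  product of the resulting vectors \<open>\<eta>1\<close>, \<open>\<eta>2\<close> is
  \<open>z\<close> up to the phase \<open>\<theta>\<close> and satisfies the equation required by
  \<open>correlation_increment\<close>.\<close>

lemma lohe_path_estimates:
  fixes \<psi>1 \<psi>2 :: "real \<Rightarrow> 'a::euclidean_space L2" and \<beta>1 \<beta>2 :: "real \<Rightarrow> real" and \<epsilon> :: real
  defines "\<phi>1 \<equiv> \<lambda>t. scaleC (exp (- \<i> * of_real (\<epsilon> * \<beta>1 t))) (\<psi>1 t)"
    and "\<phi>2 \<equiv> \<lambda>t. scaleC (exp (- \<i> * of_real (\<epsilon> * \<beta>2 t))) (\<psi>2 t)"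
    and "\<theta> \<equiv> \<lambda>t. \<epsilon> * (\<beta>1 t - \<beta>2 t)" and "z \<equiv> \<lambda>t. cinner (\<psi>1 t) (\<psi>2 t)"
  assumes K: "K \<ge> 0"
    and c: "continuous_on {0..} \<beta>1" "continuous_on {0..} \<beta>2"
    and u: "norm u1 = 1" "norm u2 = 1"
    and m1: "mild_solution u1 (\<lambda>s. coupling K (\<epsilon> * (\<beta>1 s - \<beta>2 s)) (\<phi>1 s) (\<phi>2 s)) \<phi>1"
    and m2: "mild_solution u2 (\<lambda>s. coupling K (\<epsilon> * (\<beta>2 s - \<beta>1 s)) (\<phi>2 s) (\<phi>1 s)) \<phi>2"
    and t: "0 \<le> t" and h: "0 \<le> h"
  shows "norm (\<psi>1 t) = 1" and "norm (\<psi>2 t) = 1"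
    and "cmod (z (t + h) - exp (\<i> * of_real (\<theta> (t + h) - \<theta> t)) * z t) \<le> 2 * K * h"
    and "cmod (z (t + h) - exp (\<i> * of_real (\<theta> (t + h) - \<theta> t)) * z t - of_real (h * K) * (1 - (z t)\<^sup>2))
      \<le> integral {t..t + h} (\<lambda>s. 2 * K * (\<bar>\<theta> (t + h) - \<theta> s\<bar> + \<bar>\<theta> s - \<theta> t\<bar> + 2 * K * h))"
proof -
  define \<eta>1 where "\<eta>1 t = schroedinger_group (- t) (\<phi>1 t)" for t
  define \<eta>2 where "\<eta>2 t = schroedinger_group (- t) (\<phi>2 t)" for t
  define f1 where "f1 s = coupling K (\<theta> s) (\<eta>1 s) (\<eta>2 s)" for s
  define f2 where "f2 s = coupling K (- \<theta> s) (\<eta>2 s) (\<eta>1 s)" for s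
  define a where "a t = cinner (\<eta>1 t) (\<eta>2 t)" for t
  have \<theta>': "\<epsilon> * (\<beta>2 s - \<beta>1 s) = - \<theta> s" for s by (simp add: \<theta>_def algebra_simps)
  have i1: "(f1 has_integral (\<eta>1 t - u1)) {0..t}" if "t \<ge> 0" for t
    using mild_solution_has_integral[OF m1 that]
    by (simp add: f1_def[abs_def] \<eta>1_def \<eta>2_def schroedinger_group_coupling \<theta>_def)
  have i2: "(f2 has_integral (\<eta>2 t - u2)) {0..t}" if "t \<ge> 0" for t
    using mild_solution_has_integral[OF m2 that] unfolding \<theta>'
    by (simp add: f2_def[abs_def] \<eta>1_def \<eta>2_def schroedinger_group_coupling)
  let ?T = "t + h"
  have c\<theta>: "continuous_on {0..?T} \<theta>"
    unfolding \<theta>_def by (intro continuous_intros continuous_on_subset[OF c(1)] continuous_on_subset[OF c(2)]) auto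
  have c1: "continuous_on {0..?T} \<eta>1" by (rule has_integral_primitive_continuous_on) (rule i1)
  have c2: "continuous_on {0..?T} \<eta>2" by (rule has_integral_primitive_continuous_on) (rule i2)
  have cm: "continuous_on {0..?T} (\<lambda>s. - \<theta> s)" by (intro continuous_intros c\<theta>)
  have cf1: "continuous_on {0..?T} f1"
    unfolding f1_def[abs_def] coupling_def by (intro continuous_intros c1 c2 c\<theta>)
  have cf2: "continuous_on {0..?T} f2"
    unfolding f2_def[abs_def] coupling_def by (intro continuous_intros c1 c2 c\<theta>)
  have d1: "(\<eta>1 has_vector_derivative coupling K (\<theta> s) (\<eta>1 s) (\<eta>2 s)) (at s within {0..?T})" if "s \<in> {0..?T}" for s
    using has_integral_primitive_derivative[OF i1 cf1 that] by (simp add: f1_def)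
  have d2: "(\<eta>2 has_vector_derivative coupling K (- \<theta> s) (\<eta>2 s) (\<eta>1 s)) (at s within {0..?T})" if "s \<in> {0..?T}" for s
    using has_integral_primitive_derivative[OF i2 cf2 that] by (simp add: f2_def)
  \<comment> \<open>At time 0 the integral runs over a single point, which identifies the initial
    values.\<close>
  have "\<eta>1 0 - u1 = 0" "\<eta>2 0 - u2 = 0"
    using has_integral_unique[OF i1[of 0], of 0] has_integral_unique[OF i2[of 0], of 0] by auto
  then have n0: "norm (\<eta>1 0) = 1" "norm (\<eta>2 0) = 1" using u by auto
  have n1: "norm (\<eta>1 s) = 1" if "s \<in> {0..?T}" for s
    by (rule coupled_norm_conserved[of ?T \<eta>1 K \<theta> \<eta>2 s, OF _ c2 c\<theta> n0(1) that]) (rule d1)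
  have n2: "norm (\<eta>2 s) = 1" if "s \<in> {0..?T}" for s
    by (rule coupled_norm_conserved[of ?T \<eta>2 K "\<lambda>s. - \<theta> s" \<eta>1 s, OF _ c1 cm n0(2) that]) (rule d2)
  have tT: "t \<in> {0..?T}" using t h by auto
  show "norm (\<psi>1 t) = 1" "norm (\<psi>2 t) = 1"
    using n1[OF tT] n2[OF tT] by (simp_all add: \<eta>1_def \<eta>2_def norm_schroedinger_group \<phi>1_def \<phi>2_def norm_scaleC)
  have za: "z s = exp (\<i> * of_real (\<theta> s)) * a s" for s
  proof -
    have "a s = exp (- \<i> * of_real (\<epsilon> * \<beta>1 s)) * (cnj (exp (- \<i> * of_real (\<epsilon> * \<beta>2 s))) * z s)"
      by (simp only: a_def \<eta>1_def \<eta>2_def cinner_schroedinger_group \<phi>1_def \<phi>2_def cinner_scaleC_left cinner_scaleC_right z_def mult_ac)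
    also have "\<dots> = exp (- (\<i> * of_real (\<theta> s))) * z s"
      unfolding exp_cnj mult.assoc[symmetric] exp_add[symmetric] by (simp add: \<theta>_def algebra_simps)
    finally show ?thesis by (simp add: mult.assoc[symmetric] exp_add[symmetric])
  qed
  have a1: "cmod (a s) \<le> 1" if "s \<in> {0..?T}" for s
    using norm_cinner_le[of "\<eta>1 s" "\<eta>2 s"] n1[OF that] n2[OF that] by (simp add: a_def)
  have da: "(a has_vector_derivative of_real K * (exp (- \<i> * of_real (\<theta> s)) - exp (\<i> * of_real (\<theta> s)) * (a s)\<^sup>2))
      (at s within {0..?T})" if "s \<in> {0..?T}" for s
    using coupled_cinner_derivative[OF d1[OF that] d2[OF that] n1[OF that] n2[OF that]] unfolding a_def[abs_def] .
  show "cmod (z (t + h) - exp (\<i> * of_real (\<theta> (t + h) - \<theta> t)) * z t) \<le> 2 * K * h"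
    by (rule correlation_increment(1)[OF K t h da c\<theta> a1 za])
  show "cmod (z (t + h) - exp (\<i> * of_real (\<theta> (t + h) - \<theta> t)) * z t - of_real (h * K) * (1 - (z t)\<^sup>2))
      \<le> integral {t..t + h} (\<lambda>s. 2 * K * (\<bar>\<theta> (t + h) - \<theta> s\<bar> + \<bar>\<theta> s - \<theta> t\<bar> + 2 * K * h))"
    by (rule correlation_increment(2)[OF K t h da c\<theta> a1 za])
qed


section \<open>Time integrals of random functions\<close>

lemma riemann_sums_tendsto:
  fixes w :: "real \<Rightarrow> real"
  assumes w: "continuous_on {a..b} w" and ab: "a \<le> b"
  shows "(\<lambda>n. \<Sum>i<n. (b - a) / real n * w (a + real i * ((b - a) / real n))) \<longlonglongrightarrow> integral {a..b} w"
proof (rule LIMSEQ_I)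
  fix e :: real assume "e > 0"
  define e' where "e' = e / (b - a + 1)"
  have e': "e' > 0" "e' * (b - a) < e"
    using \<open>e > 0\<close> ab by (auto simp: e'_def field_simps)
  have "uniformly_continuous_on {a..b} w"
    by (rule compact_uniformly_continuous[OF w]) simp
  then obtain d where d: "d > 0" and wd: "\<And>x y. x \<in> {a..b} \<Longrightarrow> y \<in> {a..b} \<Longrightarrow> \<bar>y - x\<bar> < d \<Longrightarrow> \<bar>w y - w x\<bar> < e'"
    unfolding uniformly_continuous_on_def dist_real_def using e'(1) by meson
  obtain N :: nat where N: "N > (b - a) / d" using reals_Archimedean2 by blast
  show "\<exists>no. \<forall>n\<ge>no. norm ((\<Sum>i<n. (b - a) / real n * w (a + real i * ((b - a) / real n))) - integral {a..b} w) < e"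
  proof (intro exI allI impI)
    fix n assume n: "n \<ge> Suc N"
    define l where "l = (b - a) / real n"
    define x where "x i = a + real i * l" for i
    have l: "l \<ge> 0" "real n * l = b - a" using n ab by (auto simp: l_def)
    have "(b - a) / d < real n" using N n by linarith
    then have "l < d" using d n by (simp add: l_def field_simps)
    have xn: "x n = b" using l by (simp add: x_def)
    have x0: "x 0 = a" by (simp add: x_def)
    have xmono: "x i \<le> x j" if "i \<le> j" for i j using that l by (auto simp: x_def intro!: mult_right_mono)
    have xs: "x (Suc i) = x i + l" for i by (simp add: x_def algebra_simps)
    have x_in: "x i \<in> {a..b}" if "i \<le> n" for i using xmono[of 0 i] xmono[of i n] that x0 xn by auto
    have int: "w integrable_on {a..b}" using w by (rule integrable_continuous_real)
    have split: "integral {a..x k} w = (\<Sum>i<k. integral {x i..x (Suc i)} w)" if "k \<le> n" for k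
      using that
    proof (induction k)
      case (Suc k)
      have "integral {a..x k} w + integral {x k..x (Suc k)} w = integral {a..x (Suc k)} w"
      proof (rule Henstock_Kurzweil_Integration.integral_combine)
        show "a \<le> x k" "x k \<le> x (Suc k)" using xmono[of 0 k] xmono[of k "Suc k"] x0 by auto
        show "w integrable_on {a..x (Suc k)}"
          by (rule integrable_subinterval_real[OF int]) (use x_in[OF Suc(2)] in auto)
      qed
      then show ?case using Suc by simp
    qed (simp add: x0)
    have piece: "\<bar>l * w (x i) - integral {x i..x (Suc i)} w\<bar> \<le> e' * l" if i: "i < n" for i
    proof -
      have sub: "{x i..x (Suc i)} \<subseteq> {a..b}" using x_in[of i] x_in[of "Suc i"] i by auto
      have ci: "continuous_on {x i..x (Suc i)} w" by (rule continuous_on_subset[OF w sub])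
      have E1: "integral {x i..x (Suc i)} (\<lambda>s. w (x i) - w s)
          = integral {x i..x (Suc i)} (\<lambda>s. w (x i)) - integral {x i..x (Suc i)} w"
        by (intro Henstock_Kurzweil_Integration.integral_diff integrable_continuous_real ci continuous_intros)
      have E2: "integral {x i..x (Suc i)} (\<lambda>s. w (x i)) = l * w (x i)" using l by (simp add: xs)
      have xd: "x (Suc i) - x i = l" by (simp add: xs)
      have E3: "norm (integral {x i..x (Suc i)} (\<lambda>s. w (x i) - w s)) \<le> e' * (x (Suc i) - x i)"
      proof (rule integral_bound)
        fix s assume s: "s \<in> {x i..x (Suc i)}"
        then have "\<bar>x i - s\<bar> < d" using \<open>l < d\<close> by (auto simp: xs)
        then show "norm (w (x i) - w s) \<le> e'"
          using wd[of s "x i"] s sub x_in[of i] i by (auto intro: less_imp_le)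
      qed (use l in \<open>auto simp: xs[symmetric] intro!: continuous_intros ci xmono\<close>)
      show ?thesis using E3 unfolding E1 E2 xd real_norm_def .
    qed
    have "norm ((\<Sum>i<n. l * w (x i)) - integral {a..b} w) = \<bar>\<Sum>i<n. l * w (x i) - integral {x i..x (Suc i)} w\<bar>"
      using split[of n] by (simp add: xn sum_subtractf)
    also have "\<dots> \<le> (\<Sum>i<n. e' * l)"
      by (intro order_trans[OF sum_abs] sum_mono piece) auto
    also have "\<dots> = e' * (b - a)" using l by (simp add: mult.left_commute)
    also have "\<dots> < e" by (rule e')
    finally show "norm ((\<Sum>i<n. (b - a) / real n * w (a + real i * ((b - a) / real n))) - integral {a..b} w) < e"
      by (simp add: l_def x_def)
  qed
qed

text \<open>Fatou's lemma along Riemann sums replaces Fubini, so no joint measurability is needed.\<close>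

lemma nn_integral_time_integral_le:
  fixes w :: "real \<Rightarrow> 'w \<Rightarrow> real"
  assumes ab: "a \<le> b" and c: "0 \<le> c"
    and meas: "\<And>s. s \<in> {a..b} \<Longrightarrow> w s \<in> borel_measurable M"
    and nonneg: "\<And>s \<omega>. 0 \<le> w s \<omega>"
    and bound: "\<And>s. s \<in> {a..b} \<Longrightarrow> (\<integral>\<^sup>+\<omega>. ennreal (w s \<omega>) \<partial>M) \<le> ennreal c"
    and cont: "AE \<omega> in M. continuous_on {a..b} (\<lambda>s. w s \<omega>)"
  shows "(\<integral>\<^sup>+\<omega>. ennreal (integral {a..b} (\<lambda>s. w s \<omega>)) \<partial>M) \<le> ennreal (c * (b - a))"
proof -
  define l where "l n = (b - a) / real n" for n
  define x where "x n i = a + real i * l n" for n i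
  define S where "S n \<omega> = (\<Sum>i<n. l n * w (x n i) \<omega>)" for n \<omega>
  have l0: "0 \<le> l n" for n using ab by (simp add: l_def)
  have x: "x n i \<in> {a..b}" if "i < n" for n i
  proof -
    have "real i * l n \<le> real n * l n" using that l0 by (intro mult_right_mono) auto
    also have "\<dots> = b - a" using that by (simp add: l_def)
    finally show ?thesis using l0[of n] by (simp add: x_def)
  qed
  have meas_S: "(\<lambda>\<omega>. ennreal (S n \<omega>)) \<in> borel_measurable M" for n
    unfolding S_def by (intro measurable_compose[OF _ measurable_ennreal] borel_measurable_sum borel_measurable_times meas x) auto
  have S_le: "(\<integral>\<^sup>+\<omega>. ennreal (S n \<omega>) \<partial>M) \<le> ennreal (c * (b - a))" for n
  proof -
    have "(\<integral>\<^sup>+\<omega>. ennreal (S n \<omega>) \<partial>M) = (\<integral>\<^sup>+\<omega>. (\<Sum>i<n. ennreal (l n) * ennreal (w (x n i) \<omega>)) \<partial>M)"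
      unfolding S_def
      by (intro nn_integral_cong, subst sum_ennreal[symmetric]) (auto simp: l0 nonneg ennreal_mult)
    also have "\<dots> = (\<Sum>i<n. ennreal (l n) * (\<integral>\<^sup>+\<omega>. ennreal (w (x n i) \<omega>) \<partial>M))"
      using meas x by (subst nn_integral_sum) (auto intro!: sum.cong nn_integral_cmult)
    also have "\<dots> \<le> (\<Sum>i<n. ennreal (l n) * ennreal c)"
      by (intro sum_mono mult_left_mono bound x) auto
    also have "\<dots> = ennreal (real n * (l n * c))"
      using l0[of n] c by (simp add: ennreal_mult[symmetric] ennreal_of_nat_eq_real_of_nat)
    \<comment> \<open>For \<open>n = 0\<close> the mesh is 0 by the convention for division and the
      sum is empty.\<close>
    also have "\<dots> \<le> ennreal (c * (b - a))"
      using ab c by (intro ennreal_leI) (cases "n = 0", auto simp: l_def)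
    finally show ?thesis .
  qed
  have "(\<integral>\<^sup>+\<omega>. ennreal (integral {a..b} (\<lambda>s. w s \<omega>)) \<partial>M) \<le> (\<integral>\<^sup>+\<omega>. liminf (\<lambda>n. ennreal (S n \<omega>)) \<partial>M)"
  proof (rule nn_integral_mono_AE, use cont in eventually_elim)
    fix \<omega> assume "continuous_on {a..b} (\<lambda>s. w s \<omega>)"
    from riemann_sums_tendsto[OF this ab]
    have "(\<lambda>n. ennreal (S n \<omega>)) \<longlonglongrightarrow> ennreal (integral {a..b} (\<lambda>s. w s \<omega>))"
      by (intro tendsto_ennrealI) (simp add: S_def x_def l_def)
    then show "ennreal (integral {a..b} (\<lambda>s. w s \<omega>)) \<le> liminf (\<lambda>n. ennreal (S n \<omega>))"
      by (simp add: lim_imp_Liminf)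
  qed
  also have "\<dots> \<le> liminf (\<lambda>n. \<integral>\<^sup>+\<omega>. ennreal (S n \<omega>) \<partial>M)"
    by (rule nn_integral_liminf[OF meas_S])
  also have "\<dots> \<le> liminf (\<lambda>n::nat. ennreal (c * (b - a)))"
    by (rule Liminf_mono) (simp add: S_le)
  also have "\<dots> = ennreal (c * (b - a))" by (simp add: Liminf_const)
  finally show ?thesis .
qed


section \<open>Increments of Brownian motion\<close>

context stochastic_basis
begin

lemma filtration_measurable_mono:
  assumes "0 \<le> s" "s \<le> t" "Y \<in> borel_measurable (F s)"
  shows "Y \<in> borel_measurable (F t)"
proof (rule measurable_from_subalg[OF _ assms(3)])
  show "subalgebra (F t) (F s)"
    using filtration_subalgebra[of s] filtration_subalgebra[of t] filtration_mono[OF assms(1,2)] assms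
    by (auto simp: subalgebra_def)
qed

lemma filtration_measurable:
  assumes "0 \<le> s" "Y \<in> borel_measurable (F s)"
  shows "Y \<in> borel_measurable M"
  using measurable_from_subalg[OF filtration_subalgebra assms(2)] assms(1) .

context
  fixes \<beta> :: "real \<Rightarrow> 'w \<Rightarrow> real"
  assumes bm: "brownian_motion M F \<beta>"
begin

lemma brownian_adapted: "0 \<le> s \<Longrightarrow> \<beta> s \<in> borel_measurable (F s)"
  using bm by (simp add: brownian_motion_def)

lemma brownian_measurable: "0 \<le> s \<Longrightarrow> \<beta> s \<in> borel_measurable M"
  using brownian_adapted filtration_measurable by blast

lemma brownian_increment_adapted:
  "0 \<le> r \<Longrightarrow> r \<le> s \<Longrightarrow> (\<lambda>\<omega>. \<beta> s \<omega> - \<beta> r \<omega>) \<in> borel_measurable (F s)"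
  by (intro borel_measurable_diff brownian_adapted filtration_measurable_mono[of r s]) auto

lemma brownian_increment_measurable:
  "0 \<le> r \<Longrightarrow> 0 \<le> s \<Longrightarrow> (\<lambda>\<omega>. \<beta> s \<omega> - \<beta> r \<omega>) \<in> borel_measurable M"
  by (intro borel_measurable_diff brownian_measurable)

text \<open>The definition of Brownian motion speaks of \<open>s < t\<close> only; including the
  trivial case \<open>s = t\<close> spares later estimates the distinction. The other case reads off
  moments of a centred normal law.\<close>

lemma
  assumes "0 \<le> s" "s \<le> t"
  shows integrable_brownian_increment: "integrable M (\<lambda>\<omega>. \<beta> t \<omega> - \<beta> s \<omega>)"
    and integrable_brownian_increment2: "integrable M (\<lambda>\<omega>. (\<beta> t \<omega> - \<beta> s \<omega>)\<^sup>2)"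
    and integrable_brownian_increment4: "integrable M (\<lambda>\<omega>. (\<beta> t \<omega> - \<beta> s \<omega>) ^ 4)"
    and expectation_brownian_increment: "expectation (\<lambda>\<omega>. \<beta> t \<omega> - \<beta> s \<omega>) = 0"
    and expectation_brownian_increment2: "expectation (\<lambda>\<omega>. (\<beta> t \<omega> - \<beta> s \<omega>)\<^sup>2) = t - s"
    and expectation_brownian_increment4: "expectation (\<lambda>\<omega>. (\<beta> t \<omega> - \<beta> s \<omega>) ^ 4) = 3 * (t - s)\<^sup>2"
proof -
  have "integrable M (\<lambda>\<omega>. \<beta> t \<omega> - \<beta> s \<omega>) \<and> integrable M (\<lambda>\<omega>. (\<beta> t \<omega> - \<beta> s \<omega>)\<^sup>2) \<and> integrable M (\<lambda>\<omega>. (\<beta> t \<omega> - \<beta> s \<omega>) ^ 4)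
    \<and> expectation (\<lambda>\<omega>. \<beta> t \<omega> - \<beta> s \<omega>) = 0 \<and> expectation (\<lambda>\<omega>. (\<beta> t \<omega> - \<beta> s \<omega>)\<^sup>2) = t - s
    \<and> expectation (\<lambda>\<omega>. (\<beta> t \<omega> - \<beta> s \<omega>) ^ 4) = 3 * (t - s)\<^sup>2"
  proof (cases "s = t")
    case False
    then have st: "s < t" using assms by simp
    define \<sigma> where "\<sigma> = sqrt (t - s)"
    have \<sigma>: "\<sigma> > 0" "\<sigma>\<^sup>2 = t - s" using st by (auto simp: \<sigma>_def)
    have D: "distributed M lborel (\<lambda>\<omega>. \<beta> t \<omega> - \<beta> s \<omega>) (normal_density 0 \<sigma>)"
      using bm assms st by (auto simp: brownian_motion_def \<sigma>_def)
    have moment: "integrable M (\<lambda>\<omega>. (\<beta> t \<omega> - \<beta> s \<omega>) ^ k) \<and> expectation (\<lambda>\<omega>. (\<beta> t \<omega> - \<beta> s \<omega>) ^ k) = m"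
      if "has_bochner_integral lborel (\<lambda>x. normal_density 0 \<sigma> x * x ^ k) m" for k m
      using distributed_integrable[OF D, of "\<lambda>x. x ^ k"] distributed_integral[OF D, of "\<lambda>x. x ^ k"] that
      by (auto simp: has_bochner_integral_iff)
    have m1: "has_bochner_integral lborel (\<lambda>x. normal_density 0 \<sigma> x * x ^ 1) 0"
      using normal_moment_odd[OF \<sigma>(1), of 0 0] by simp
    have m2: "has_bochner_integral lborel (\<lambda>x. normal_density 0 \<sigma> x * x ^ 2) (t - s)"
      using normal_moment_even[OF \<sigma>(1), of 0 1] \<sigma> by (simp add: power2_eq_square)
    have "fact (2 * 2) / ((2 / \<sigma>\<^sup>2) ^ 2 * fact 2) = 3 * (t - s)\<^sup>2"
      using \<sigma>(1) unfolding \<sigma>(2)[symmetric] by (simp add: fact_numeral field_simps power2_eq_square)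
    then have m4: "has_bochner_integral lborel (\<lambda>x. normal_density 0 \<sigma> x * x ^ 4) (3 * (t - s)\<^sup>2)"
      using normal_moment_even[OF \<sigma>(1), of 0 2] by simp
    show ?thesis
      using moment[OF m1] moment[OF m2] moment[OF m4] by simp
  qed simp
  then show "integrable M (\<lambda>\<omega>. \<beta> t \<omega> - \<beta> s \<omega>)" "integrable M (\<lambda>\<omega>. (\<beta> t \<omega> - \<beta> s \<omega>)\<^sup>2)"
    "integrable M (\<lambda>\<omega>. (\<beta> t \<omega> - \<beta> s \<omega>) ^ 4)" "expectation (\<lambda>\<omega>. \<beta> t \<omega> - \<beta> s \<omega>) = 0"
    "expectation (\<lambda>\<omega>. (\<beta> t \<omega> - \<beta> s \<omega>)\<^sup>2) = t - s" "expectation (\<lambda>\<omega>. (\<beta> t \<omega> - \<beta> s \<omega>) ^ 4) = 3 * (t - s)\<^sup>2"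
    by auto
qed

text \<open>Independence of the increment from \<open>F s\<close> restricts to the sigma-algebra of
  \<open>Y\<close> and passes to functions of the increment. Taking \<open>g\<close> to be a power
  replaces conditional moments given \<open>F s\<close>.\<close>

lemma expectation_mult_increment:
  fixes Y :: "'w \<Rightarrow> real" and g :: "real \<Rightarrow> real"
  assumes st: "0 \<le> s" "s \<le> t" and Y: "Y \<in> borel_measurable (F s)" "integrable M Y"
    and g: "g \<in> borel_measurable borel" "integrable M (\<lambda>\<omega>. g (\<beta> t \<omega> - \<beta> s \<omega>))"
  shows "expectation (\<lambda>\<omega>. Y \<omega> * g (\<beta> t \<omega> - \<beta> s \<omega>))
      = expectation Y * expectation (\<lambda>\<omega>. g (\<beta> t \<omega> - \<beta> s \<omega>))"
proof (cases "s = t")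
  case False
  let ?D = "\<lambda>\<omega>. \<beta> t \<omega> - \<beta> s \<omega>"
  have D: "?D \<in> borel_measurable M" using st by (intro brownian_increment_measurable) auto
  have sp: "space (F s) = space M" using filtration_subalgebra[OF st(1)] by (simp add: subalgebra_def)
  have bi: "indep_set (sets (F s)) {?D -` A \<inter> space M |A. A \<in> sets borel}"
    using bm st False by (auto simp: brownian_motion_def)
  have sub: "{Y -` A \<inter> space M |A. A \<in> sets borel} \<subseteq> sets (F s)"
    using measurable_sets[OF Y(1)] by (auto simp: sp)
  have ind: "indep_set {Y -` A \<inter> space M |A. A \<in> sets borel} {?D -` A \<inter> space M |A. A \<in> sets borel}"
  proof (rule indep_setI)
    show "{Y -` A \<inter> space M |A. A \<in> sets borel} \<subseteq> events"
      using sub filtration_subalgebra[OF st(1)] by (auto simp: subalgebra_def)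
    show "{?D -` A \<inter> space M |A. A \<in> sets borel} \<subseteq> events"
      using measurable_sets[OF D] by auto
  qed (use indep_setD[OF bi] sub in blast)
  \<comment> \<open>Independence is known for the families of preimages; closure under intersection
    extends it to the generated sigma-algebras, in terms of which \<open>indep_var\<close> is
    expressed.\<close>
  have stable: "Int_stable {X -` A \<inter> space M |A. A \<in> sets borel}" for X :: "'w \<Rightarrow> real"
  proof (safe intro!: Int_stableI)
    fix A B :: "real set" assume "A \<in> sets borel" "B \<in> sets borel"
    then show "\<exists>C. (X -` A \<inter> space M) \<inter> (X -` B \<inter> space M) = X -` C \<inter> space M \<and> C \<in> sets borel"
      by (intro exI[of _ "A \<inter> B"]) auto
  qed
  have "indep_var borel Y borel ?D"
    unfolding indep_var_eq
    using filtration_measurable[OF st(1) Y(1)] D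
    by (auto intro!: indep_set_sigma_sets ind stable)
  then have iv: "indep_var borel Y borel (\<lambda>\<omega>. g (?D \<omega>))"
    using indep_var_compose[of borel Y borel ?D "\<lambda>x. x" borel g borel] g(1) by (simp add: o_def)
  show ?thesis by (rule indep_var_lebesgue_integral[OF iv Y(2) g(2)])
qed (use Y in \<open>simp add: prob_space\<close>)

lemma expectation_mult_increment_zero:
  assumes st: "0 \<le> s" "s \<le> t" and Y: "Y \<in> borel_measurable (F s)" "integrable M Y"
  shows "expectation (\<lambda>\<omega>. Y \<omega> * (\<beta> t \<omega> - \<beta> s \<omega>)) = 0"
  using expectation_mult_increment[OF st Y, of "\<lambda>x. x"] integrable_brownian_increment[OF st]
  by (simp add: expectation_brownian_increment[OF st])

lemma expectation_increment_products:
  assumes "0 \<le> a" "a \<le> b" "b \<le> c" "c \<le> d"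
  shows "expectation (\<lambda>\<omega>. (\<beta> b \<omega> - \<beta> a \<omega>) * (\<beta> d \<omega> - \<beta> c \<omega>)) = 0"
  using assms
  by (intro expectation_mult_increment_zero filtration_measurable_mono[of b c] brownian_increment_adapted
      integrable_brownian_increment) auto

text \<open>With \<open>r = sqrt (t - s)\<close> the inequality
  \<open>2 |x| \<le> r + x^2 / r\<close> is sharp at the typical size of the increment, so the
  second moment alone gives the bound \<open>r\<close>.\<close>

lemma nn_integral_brownian_increment:
  assumes "0 \<le> s" "s \<le> t"
  shows "(\<integral>\<^sup>+\<omega>. ennreal \<bar>\<beta> t \<omega> - \<beta> s \<omega>\<bar> \<partial>M) \<le> ennreal (sqrt (t - s))"
proof (cases "s = t")
  case False
  define r where "r = sqrt (t - s)"
  have r: "r > 0" "r\<^sup>2 = t - s" using False assms by (auto simp: r_def)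
  have "(\<integral>\<^sup>+\<omega>. ennreal \<bar>\<beta> t \<omega> - \<beta> s \<omega>\<bar> \<partial>M) \<le> (\<integral>\<^sup>+\<omega>. ennreal ((r + (\<beta> t \<omega> - \<beta> s \<omega>)\<^sup>2 / r) / 2) \<partial>M)"
  proof (intro nn_integral_mono ennreal_leI)
    fix \<omega>
    let ?x = "\<bar>\<beta> t \<omega> - \<beta> s \<omega>\<bar>"
    have "0 \<le> (r - ?x)\<^sup>2 / r" using r by simp
    also have "\<dots> = r - 2 * ?x + ?x\<^sup>2 / r"
      using r by (simp add: power2_eq_square field_simps)
    finally show "?x \<le> (r + (\<beta> t \<omega> - \<beta> s \<omega>)\<^sup>2 / r) / 2" by simp
  qed
  also have "\<dots> = ennreal (expectation (\<lambda>\<omega>. (r + (\<beta> t \<omega> - \<beta> s \<omega>)\<^sup>2 / r) / 2))"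
    using r integrable_brownian_increment2[OF assms] by (intro nn_integral_eq_integral) auto
  also have "expectation (\<lambda>\<omega>. (r + (\<beta> t \<omega> - \<beta> s \<omega>)\<^sup>2 / r) / 2) = (r + (t - s) / r) / 2"
    using integrable_brownian_increment2[OF assms] expectation_brownian_increment2[OF assms]
    by (simp add: prob_space)
  also have "\<dots> = r" using r(1) unfolding r(2)[symmetric] by (simp add: power2_eq_square)
  finally show ?thesis by (simp add: r_def)
qed simp

text \<open>Interpolation between even moments: \<open>2 |x|^3 \<le> r x^2 + x^4 / r\<close> with
  \<open>r = sqrt (t - s)\<close>, and the right side has expectation
  \<open>r^3 + 3 r^3\<close>.\<close>

lemma nn_integral_brownian_increment_cubed:
  assumes "0 \<le> s" "s \<le> t"
  shows "(\<integral>\<^sup>+\<omega>. ennreal (\<bar>\<beta> t \<omega> - \<beta> s \<omega>\<bar> ^ 3) \<partial>M) \<le> ennreal (2 * sqrt (t - s) ^ 3)"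
proof (cases "s = t")
  case False
  define r where "r = sqrt (t - s)"
  have r: "r > 0" "r\<^sup>2 = t - s" using False assms by (auto simp: r_def)
  let ?g = "\<lambda>\<omega>. (r * (\<beta> t \<omega> - \<beta> s \<omega>)\<^sup>2 + (\<beta> t \<omega> - \<beta> s \<omega>) ^ 4 / r) / 2"
  have "(\<integral>\<^sup>+\<omega>. ennreal (\<bar>\<beta> t \<omega> - \<beta> s \<omega>\<bar> ^ 3) \<partial>M) \<le> (\<integral>\<^sup>+\<omega>. ennreal (?g \<omega>) \<partial>M)"
  proof (intro nn_integral_mono ennreal_leI)
    fix \<omega>
    let ?x = "\<bar>\<beta> t \<omega> - \<beta> s \<omega>\<bar>"
    have "0 \<le> ?x\<^sup>2 * (r - ?x)\<^sup>2 / r" using r by simp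
    also have "\<dots> = r * ?x\<^sup>2 - 2 * ?x ^ 3 + ?x ^ 4 / r"
      using r by (simp add: power2_eq_square power3_eq_cube power4_eq_xxxx field_simps)
    finally show "?x ^ 3 \<le> ?g \<omega>" by simp
  qed
  also have "\<dots> = ennreal (expectation ?g)"
    using r integrable_brownian_increment2[OF assms] integrable_brownian_increment4[OF assms]
    by (intro nn_integral_eq_integral) auto
  also have "expectation ?g = (r * (t - s) + 3 * (t - s)\<^sup>2 / r) / 2"
    using r integrable_brownian_increment2[OF assms] integrable_brownian_increment4[OF assms]
    by (simp add: expectation_brownian_increment2[OF assms] expectation_brownian_increment4[OF assms])
  also have "\<dots> = 2 * r ^ 3"
    using r(1) unfolding r(2)[symmetric] by (simp add: power2_eq_square power3_eq_cube field_simps)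
  finally show ?thesis by (simp add: r_def)
qed simp

end

end


section \<open>Two independent Brownian motions\<close>

locale brownian_pair = stochastic_basis M F
  for M :: "'w measure" and F :: "real \<Rightarrow> 'w measure" +
  fixes \<beta>1 \<beta>2 :: "real \<Rightarrow> 'w \<Rightarrow> real"
  assumes bm1: "brownian_motion M F \<beta>1" and bm2: "brownian_motion M F \<beta>2"
    and indep: "independent_processes M \<beta>1 \<beta>2"
begin

text \<open>A product of two increments is a measurable functional of one whole path, so
  independence of the processes factors these mixed fourth moments. They control the variance in
  \<open>expectation_cross_increment\<close>.\<close>

lemma
  assumes t: "0 \<le> a" "0 \<le> b" "0 \<le> c" "0 \<le> d"
    and 1: "integrable M (\<lambda>\<omega>. (\<beta>1 b \<omega> - \<beta>1 a \<omega>) * (\<beta>1 d \<omega> - \<beta>1 c \<omega>))"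
    and 2: "integrable M (\<lambda>\<omega>. (\<beta>2 b \<omega> - \<beta>2 a \<omega>) * (\<beta>2 d \<omega> - \<beta>2 c \<omega>))"
  shows integrable_pair_products: "integrable M (\<lambda>\<omega>. ((\<beta>1 b \<omega> - \<beta>1 a \<omega>) * (\<beta>1 d \<omega> - \<beta>1 c \<omega>))
      * ((\<beta>2 b \<omega> - \<beta>2 a \<omega>) * (\<beta>2 d \<omega> - \<beta>2 c \<omega>)))"
    and expectation_pair_products: "expectation (\<lambda>\<omega>. ((\<beta>1 b \<omega> - \<beta>1 a \<omega>) * (\<beta>1 d \<omega> - \<beta>1 c \<omega>))
      * ((\<beta>2 b \<omega> - \<beta>2 a \<omega>) * (\<beta>2 d \<omega> - \<beta>2 c \<omega>)))
      = expectation (\<lambda>\<omega>. (\<beta>1 b \<omega> - \<beta>1 a \<omega>) * (\<beta>1 d \<omega> - \<beta>1 c \<omega>))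
      * expectation (\<lambda>\<omega>. (\<beta>2 b \<omega> - \<beta>2 a \<omega>) * (\<beta>2 d \<omega> - \<beta>2 c \<omega>))"
proof -
  let ?P = "PiM {0..} (\<lambda>_. borel :: real measure)"
  define G where "G p = (p b - p a) * (p d - p c)" for p :: "real \<Rightarrow> real"
  have G: "G \<in> borel_measurable ?P"
    unfolding G_def using t
    by (intro borel_measurable_times borel_measurable_diff measurable_component_singleton) auto
  have "indep_var borel (G \<circ> (\<lambda>\<omega>. \<lambda>t\<in>{0..}. \<beta>1 t \<omega>)) borel (G \<circ> (\<lambda>\<omega>. \<lambda>t\<in>{0..}. \<beta>2 t \<omega>))"
    using indep unfolding independent_processes_def by (rule indep_var_compose[OF _ G G])
  then have iv: "indep_var borel (\<lambda>\<omega>. (\<beta>1 b \<omega> - \<beta>1 a \<omega>) * (\<beta>1 d \<omega> - \<beta>1 c \<omega>))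
      borel (\<lambda>\<omega>. (\<beta>2 b \<omega> - \<beta>2 a \<omega>) * (\<beta>2 d \<omega> - \<beta>2 c \<omega>))"
    using t by (simp add: o_def G_def)
  show "integrable M (\<lambda>\<omega>. ((\<beta>1 b \<omega> - \<beta>1 a \<omega>) * (\<beta>1 d \<omega> - \<beta>1 c \<omega>))
      * ((\<beta>2 b \<omega> - \<beta>2 a \<omega>) * (\<beta>2 d \<omega> - \<beta>2 c \<omega>)))"
    by (rule indep_var_integrable[OF iv 1 2])
  show "expectation (\<lambda>\<omega>. ((\<beta>1 b \<omega> - \<beta>1 a \<omega>) * (\<beta>1 d \<omega> - \<beta>1 c \<omega>))
      * ((\<beta>2 b \<omega> - \<beta>2 a \<omega>) * (\<beta>2 d \<omega> - \<beta>2 c \<omega>)))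
      = expectation (\<lambda>\<omega>. (\<beta>1 b \<omega> - \<beta>1 a \<omega>) * (\<beta>1 d \<omega> - \<beta>1 c \<omega>))
      * expectation (\<lambda>\<omega>. (\<beta>2 b \<omega> - \<beta>2 a \<omega>) * (\<beta>2 d \<omega> - \<beta>2 c \<omega>))"
    by (rule indep_var_lebesgue_integral[OF iv 1 2])
qed

lemma integrable_increment_products:
  assumes bm: "brownian_motion M F \<beta>" "brownian_motion M F \<beta>'"
    and t: "0 \<le> a" "a \<le> b" "0 \<le> c" "c \<le> d"
  shows "integrable M (\<lambda>\<omega>. (\<beta> b \<omega> - \<beta> a \<omega>) * (\<beta>' d \<omega> - \<beta>' c \<omega>))"
proof (rule Bochner_Integration.integrable_bound)
  show "integrable M (\<lambda>\<omega>. (\<beta> b \<omega> - \<beta> a \<omega>)\<^sup>2 + (\<beta>' d \<omega> - \<beta>' c \<omega>)\<^sup>2)"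
    using t by (intro Bochner_Integration.integrable_add integrable_brownian_increment2 bm)
  show "(\<lambda>\<omega>. (\<beta> b \<omega> - \<beta> a \<omega>) * (\<beta>' d \<omega> - \<beta>' c \<omega>)) \<in> borel_measurable M"
    using t by (intro borel_measurable_times brownian_increment_measurable bm) auto
  have "\<bar>x * y\<bar> \<le> x\<^sup>2 + y\<^sup>2" for x y :: real
  proof -
    have "2 * (\<bar>x\<bar> * \<bar>y\<bar>) \<le> x\<^sup>2 + y\<^sup>2" using sum_squares_bound[of "\<bar>x\<bar>" "\<bar>y\<bar>"] by simp
    moreover have "0 \<le> \<bar>x\<bar> * \<bar>y\<bar>" by simp
    ultimately show ?thesis unfolding abs_mult by linarith
  qed
  then show "AE \<omega> in M. norm ((\<beta> b \<omega> - \<beta> a \<omega>) * (\<beta>' d \<omega> - \<beta>' c \<omega>))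
      \<le> norm ((\<beta> b \<omega> - \<beta> a \<omega>)\<^sup>2 + (\<beta>' d \<omega> - \<beta>' c \<omega>)\<^sup>2)" by simp
qed

lemma integrable_bounded_mult:
  fixes X Y :: "'w \<Rightarrow> real"
  assumes "Y \<in> borel_measurable M" "\<And>\<omega>. \<bar>Y \<omega>\<bar> \<le> C" "integrable M X"
  shows "integrable M (\<lambda>\<omega>. Y \<omega> * X \<omega>)"
proof (rule Bochner_Integration.integrable_bound)
  show "integrable M (\<lambda>\<omega>. C * X \<omega>)" using assms(3) by simp
  show "(\<lambda>\<omega>. Y \<omega> * X \<omega>) \<in> borel_measurable M" using assms by auto
  show "AE \<omega> in M. norm (Y \<omega> * X \<omega>) \<le> norm (C * X \<omega>)"
  proof (rule AE_I2)
    fix \<omega>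
    have "\<bar>Y \<omega>\<bar> \<le> \<bar>C\<bar>" using assms(2)[of \<omega>] by linarith
    then show "norm (Y \<omega> * X \<omega>) \<le> norm (C * X \<omega>)" by (simp add: abs_mult mult_right_mono)
  qed
qed

text \<open>
  The two motions are not assumed to be jointly independent of the filtration. Their quadratic
  covariation vanishes: in a subdivision of \<open>[s, t]\<close> the off-diagonal terms have expectation zero,
  and the diagonal terms are orthogonal in \<open>L\<^sup>2\<close>, so their sum has variance \<open>(t - s)\<^sup>2 / n\<close>.
\<close>

lemma expectation_cross_increment:
  assumes st: "0 \<le> s" "s \<le> t" and Y: "Y \<in> borel_measurable (F s)" and C: "\<And>\<omega>. \<bar>Y \<omega>\<bar> \<le> C"
  shows "expectation (\<lambda>\<omega>. Y \<omega> * ((\<beta>1 t \<omega> - \<beta>1 s \<omega>) * (\<beta>2 t \<omega> - \<beta>2 s \<omega>))) = 0"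
proof -
  have YM: "Y \<in> borel_measurable M" by (rule filtration_measurable[OF st(1) Y])
  let ?I = "\<lambda>\<beta> a b \<omega>. \<beta> b \<omega> - \<beta> a \<omega> :: real"
  define D where "D a b = expectation (\<lambda>\<omega>. Y \<omega> * (?I \<beta>1 a b \<omega> * ?I \<beta>2 a b \<omega>))" for a b
  have int: "integrable M (\<lambda>\<omega>. Y \<omega> * (?I \<beta> a b \<omega> * ?I \<beta>' c d \<omega>))"
    if "brownian_motion M F \<beta>" "brownian_motion M F \<beta>'" "0 \<le> a" "a \<le> b" "0 \<le> c" "c \<le> d" for \<beta> \<beta>' a b c d
    by (intro integrable_bounded_mult[OF YM C] integrable_increment_products that)
  have cross: "expectation (\<lambda>\<omega>. Y \<omega> * (?I \<beta> a b \<omega> * ?I \<beta>' b c \<omega>)) = 0"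
    if bm: "brownian_motion M F \<beta>" "brownian_motion M F \<beta>'" and "s \<le> a" "a \<le> b" "b \<le> c" for \<beta> \<beta>' a b c
  proof -
    have "expectation (\<lambda>\<omega>. (Y \<omega> * ?I \<beta> a b \<omega>) * ?I \<beta>' b c \<omega>) = 0"
      using that st
      by (intro expectation_mult_increment_zero[OF bm(2)] borel_measurable_times
          integrable_bounded_mult[OF YM C] integrable_brownian_increment[OF bm(1)]
          brownian_increment_adapted[OF bm(1)] filtration_measurable_mono[OF _ _ Y]) auto
    then show ?thesis by (simp add: mult.assoc)
  qed
  \<comment> \<open>Additivity over adjacent intervals reduces the claim to arbitrarily fine
    subdivisions: in a mixed term the later increment is centred and independent of all other
    factors.\<close>
  have D_add: "D a c = D a b + D b c" if abc: "s \<le> a" "a \<le> b" "b \<le> c" for a b c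
  proof -
    have pos: "0 \<le> a" "0 \<le> b" using st abc by auto
    have "D a c = expectation (\<lambda>\<omega>. (Y \<omega> * (?I \<beta>1 a b \<omega> * ?I \<beta>2 a b \<omega>) + Y \<omega> * (?I \<beta>1 b c \<omega> * ?I \<beta>2 b c \<omega>))
        + (Y \<omega> * (?I \<beta>1 a b \<omega> * ?I \<beta>2 b c \<omega>) + Y \<omega> * (?I \<beta>2 a b \<omega> * ?I \<beta>1 b c \<omega>)))"
      unfolding D_def by (intro Bochner_Integration.integral_cong refl) (simp add: algebra_simps)
    also have "\<dots> = (D a b + D b c)
        + (expectation (\<lambda>\<omega>. Y \<omega> * (?I \<beta>1 a b \<omega> * ?I \<beta>2 b c \<omega>)) + expectation (\<lambda>\<omega>. Y \<omega> * (?I \<beta>2 a b \<omega> * ?I \<beta>1 b c \<omega>)))"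
      unfolding D_def
      using int[OF bm1 bm2, of a b a b] int[OF bm1 bm2, of b c b c] int[OF bm1 bm2, of a b b c] int[OF bm2 bm1, of a b b c] pos abc
      by (simp add: Bochner_Integration.integral_add Bochner_Integration.integrable_add)
    also have "\<dots> = D a b + D b c"
      using cross[OF bm1 bm2 abc] cross[OF bm2 bm1 abc] by simp
    finally show ?thesis .
  qed
  \<comment> \<open>Young's inequality with weight \<open>\<mu>\<close> bounds \<open>|Y S|\<close>
    by \<open>(\<mu> C^2 + S^2 / \<mu>) / 2\<close>. A subdivision into
    \<open>n > 1 / \<mu>^2\<close> pieces keeps the second moment of \<open>S\<close> at most
    \<open>\<mu>^2 (t - s)^2\<close>, so the total is proportional to \<open>\<mu>\<close>.\<close>
  have small: "\<bar>D s t\<bar> \<le> \<mu> * (C\<^sup>2 + (t - s)\<^sup>2) / 2" if \<mu>: "\<mu> > 0" for \<mu>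
  proof -
    obtain n :: nat where n: "n > 1 / \<mu>\<^sup>2" using reals_Archimedean2 by blast
    have n0: "n > 0" using n \<mu> by (cases n) (auto simp: not_less[symmetric])
    define l where "l = (t - s) / real n"
    define x where "x i = s + real i * l" for i
    have l: "l \<ge> 0" "real n * l = t - s" using n0 st by (auto simp: l_def)
    have xn: "x n = t" and x0: "x 0 = s" using l by (auto simp: x_def)
    have xmono: "x i \<le> x j" if "i \<le> j" for i j using that l by (auto simp: x_def intro!: mult_right_mono)
    have xs: "x (Suc i) - x i = l" for i by (simp add: x_def algebra_simps)
    have x_ge: "s \<le> x i" "0 \<le> x i" for i using xmono[of 0 i] x0 st by auto
    define d1 where "d1 i = ?I \<beta>1 (x i) (x (Suc i))" for i
    define d2 where "d2 i = ?I \<beta>2 (x i) (x (Suc i))" for i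
    define X where "X i \<omega> = d1 i \<omega> * d2 i \<omega>" for i \<omega>
    define S where "S \<omega> = (\<Sum>i<n. X i \<omega>)" for \<omega>
    have Xint: "integrable M (X i)" for i
      unfolding X_def d1_def d2_def by (intro integrable_increment_products bm1 bm2 x_ge xmono) auto
    have p1: "integrable M (\<lambda>\<omega>. d1 i \<omega> * d1 j \<omega>)" and p2: "integrable M (\<lambda>\<omega>. d2 i \<omega> * d2 j \<omega>)" for i j
      unfolding d1_def d2_def by (intro integrable_increment_products bm1 bm2 x_ge xmono; simp)+
    have XX: "X i \<omega> * X j \<omega> = (d1 i \<omega> * d1 j \<omega>) * (d2 i \<omega> * d2 j \<omega>)" for i j \<omega>
      by (simp add: X_def)
    have XXint: "integrable M (\<lambda>\<omega>. X i \<omega> * X j \<omega>)" for i j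
      unfolding XX using p1[of i j] p2[of i j] unfolding d1_def d2_def by (intro integrable_pair_products x_ge)
    have XXE: "expectation (\<lambda>\<omega>. X i \<omega> * X j \<omega>)
        = expectation (\<lambda>\<omega>. d1 i \<omega> * d1 j \<omega>) * expectation (\<lambda>\<omega>. d2 i \<omega> * d2 j \<omega>)" for i j
      unfolding XX using p1[of i j] p2[of i j] unfolding d1_def d2_def by (intro expectation_pair_products x_ge)
    have diag: "expectation (\<lambda>\<omega>. d1 i \<omega> * d1 i \<omega>) = l" "expectation (\<lambda>\<omega>. d2 i \<omega> * d2 i \<omega>) = l" for i
      unfolding d1_def d2_def
      using expectation_brownian_increment2[OF bm1 x_ge(2)[of i] xmono[of i "Suc i"]]
        expectation_brownian_increment2[OF bm2 x_ge(2)[of i] xmono[of i "Suc i"]]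
      by (simp_all add: power2_eq_square xs)
    have off: "expectation (\<lambda>\<omega>. d1 i \<omega> * d1 j \<omega>) = 0" if "i < j" for i j
      unfolding d1_def by (rule expectation_increment_products[OF bm1]) (use x_ge xmono that in auto)
    have XXd: "expectation (\<lambda>\<omega>. X i \<omega> * X j \<omega>) = (if i = j then l\<^sup>2 else 0)" for i j
    proof (cases i j rule: linorder_cases)
      case greater
      then show ?thesis using off[of j i] by (simp add: XXE mult.commute)
    qed (simp_all add: XXE off diag power2_eq_square)
    have SS: "(S \<omega>)\<^sup>2 = (\<Sum>i<n. \<Sum>j<n. X i \<omega> * X j \<omega>)" for \<omega>
      by (simp add: S_def power2_eq_square sum_product)
    have S2int: "integrable M (\<lambda>\<omega>. (S \<omega>)\<^sup>2)"
      unfolding SS by (intro Bochner_Integration.integrable_sum XXint)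
    have "expectation (\<lambda>\<omega>. (S \<omega>)\<^sup>2) = (\<Sum>i<n. \<Sum>j<n. expectation (\<lambda>\<omega>. X i \<omega> * X j \<omega>))"
      unfolding SS by (simp add: Bochner_Integration.integral_sum XXint Bochner_Integration.integrable_sum)
    also have "\<dots> = real n * l\<^sup>2" by (simp add: XXd)
    finally have S2: "expectation (\<lambda>\<omega>. (S \<omega>)\<^sup>2) = real n * l\<^sup>2" .
    have "real n * l\<^sup>2 = (t - s)\<^sup>2 / real n"
      using n0 by (simp add: l_def power2_eq_square)
    also have "\<dots> \<le> (t - s)\<^sup>2 * \<mu>\<^sup>2"
    proof -
      have "1 / real n \<le> \<mu>\<^sup>2" using n n0 \<mu> by (simp add: field_simps)
      then have "(t - s)\<^sup>2 * (1 / real n) \<le> (t - s)\<^sup>2 * \<mu>\<^sup>2" by (intro mult_left_mono) auto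
      then show ?thesis by simp
    qed
    finally have nl: "real n * l\<^sup>2 \<le> (t - s)\<^sup>2 * \<mu>\<^sup>2" .
    have "D s (x k) = (\<Sum>i<k. expectation (\<lambda>\<omega>. Y \<omega> * X i \<omega>))" for k
    proof (induction k)
      case 0
      show ?case by (simp add: D_def x0)
    next
      case (Suc k)
      have "D s (x (Suc k)) = D s (x k) + D (x k) (x (Suc k))"
        by (intro D_add x_ge xmono) auto
      also have "D (x k) (x (Suc k)) = expectation (\<lambda>\<omega>. Y \<omega> * X k \<omega>)"
        by (simp add: D_def X_def d1_def d2_def)
      finally show ?case using Suc by simp
    qed
    from this[of n] have "D s t = (\<Sum>i<n. expectation (\<lambda>\<omega>. Y \<omega> * X i \<omega>))" by (simp add: xn)
    also have "\<dots> = expectation (\<lambda>\<omega>. Y \<omega> * S \<omega>)"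
      unfolding S_def sum_distrib_left
      by (intro Bochner_Integration.integral_sum[symmetric] integrable_bounded_mult[OF YM C] Xint)
    finally have "\<bar>D s t\<bar> = \<bar>expectation (\<lambda>\<omega>. Y \<omega> * S \<omega>)\<bar>" by simp
    also have "\<dots> \<le> expectation (\<lambda>\<omega>. \<bar>Y \<omega> * S \<omega>\<bar>)" by (rule integral_abs_bound)
    also have "\<dots> \<le> expectation (\<lambda>\<omega>. (\<mu> * C\<^sup>2 + (S \<omega>)\<^sup>2 / \<mu>) / 2)"
    proof (rule integral_mono)
      show "integrable M (\<lambda>\<omega>. \<bar>Y \<omega> * S \<omega>\<bar>)"
        unfolding S_def by (intro integrable_abs integrable_bounded_mult[OF YM C] Bochner_Integration.integrable_sum Xint)
      show "integrable M (\<lambda>\<omega>. (\<mu> * C\<^sup>2 + (S \<omega>)\<^sup>2 / \<mu>) / 2)" using S2int by simp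
      fix \<omega>
      let ?y = "\<bar>Y \<omega>\<bar>" and ?s = "\<bar>S \<omega>\<bar>"
      have "0 \<le> (\<mu> * ?y - ?s)\<^sup>2 / \<mu>" using \<mu> by simp
      also have "\<dots> = \<mu> * ?y\<^sup>2 - 2 * (?y * ?s) + ?s\<^sup>2 / \<mu>"
        using \<mu> by (simp add: power2_eq_square field_simps)
      finally have "2 * (?y * ?s) \<le> \<mu> * ?y\<^sup>2 + ?s\<^sup>2 / \<mu>" by simp
      moreover have "\<mu> * ?y\<^sup>2 \<le> \<mu> * C\<^sup>2" using \<mu> C[of \<omega>] by (intro mult_left_mono power_mono) auto
      ultimately show "\<bar>Y \<omega> * S \<omega>\<bar> \<le> (\<mu> * C\<^sup>2 + (S \<omega>)\<^sup>2 / \<mu>) / 2" by (simp add: abs_mult)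
    qed
    also have "\<dots> = (\<mu> * C\<^sup>2 + (real n * l\<^sup>2) / \<mu>) / 2" using S2int by (simp add: S2 prob_space)
    also have "\<dots> \<le> (\<mu> * C\<^sup>2 + ((t - s)\<^sup>2 * \<mu>\<^sup>2) / \<mu>) / 2"
      using nl \<mu> by (intro divide_right_mono add_left_mono) auto
    also have "\<dots> = \<mu> * (C\<^sup>2 + (t - s)\<^sup>2) / 2" using \<mu> by (simp add: power2_eq_square field_simps)
    finally show ?thesis .
  qed
  have "\<bar>D s t\<bar> \<le> 0"
  proof (rule field_le_epsilon)
    fix e :: real assume e: "e > 0"
    define q where "q = C\<^sup>2 + (t - s)\<^sup>2 + 1"
    have q: "q > 0" "C\<^sup>2 + (t - s)\<^sup>2 \<le> q" by (auto simp: q_def add_nonneg_pos)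
    have "\<bar>D s t\<bar> \<le> (e / q) * (C\<^sup>2 + (t - s)\<^sup>2) / 2" using e q by (intro small) auto
    also have "\<dots> \<le> (e / q) * q / 2" using e q by (intro divide_right_mono mult_left_mono) auto
    also have "\<dots> \<le> 0 + e" using e q by simp
    finally show "\<bar>D s t\<bar> \<le> 0 + e" .
  qed
  then show ?thesis by (simp add: D_def)
qed

section \<open>The difference of the two motions, with quadratic variation
  \<open>2 t\<close>\<close>

definition B :: "real \<Rightarrow> 'w \<Rightarrow> real" where
  "B t \<omega> = \<beta>1 t \<omega> - \<beta>2 t \<omega>"

lemma B_increment: "B t \<omega> - B s \<omega> = (\<beta>1 t \<omega> - \<beta>1 s \<omega>) - (\<beta>2 t \<omega> - \<beta>2 s \<omega>)"
  by (simp add: B_def)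

lemma B_measurable: "0 \<le> t \<Longrightarrow> B t \<in> borel_measurable M"
  unfolding B_def by (intro borel_measurable_diff brownian_measurable bm1 bm2)

lemma integrable_B_increment:
  assumes "0 \<le> s" "s \<le> t"
  shows "integrable M (\<lambda>\<omega>. B t \<omega> - B s \<omega>)" and "integrable M (\<lambda>\<omega>. (B t \<omega> - B s \<omega>)\<^sup>2)"
proof -
  show "integrable M (\<lambda>\<omega>. B t \<omega> - B s \<omega>)"
    unfolding B_increment
    by (intro Bochner_Integration.integrable_diff integrable_brownian_increment[OF bm1]
        integrable_brownian_increment[OF bm2] assms)
  have eq: "(B t \<omega> - B s \<omega>)\<^sup>2 = ((\<beta>1 t \<omega> - \<beta>1 s \<omega>)\<^sup>2 + (\<beta>2 t \<omega> - \<beta>2 s \<omega>)\<^sup>2)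
      - 2 * ((\<beta>1 t \<omega> - \<beta>1 s \<omega>) * (\<beta>2 t \<omega> - \<beta>2 s \<omega>))" for \<omega>
    unfolding B_increment by (simp only: power2_diff mult.assoc)
  show "integrable M (\<lambda>\<omega>. (B t \<omega> - B s \<omega>)\<^sup>2)"
    unfolding eq
    by (intro Bochner_Integration.integrable_diff Bochner_Integration.integrable_add integrable_mult_right
        integrable_brownian_increment2[OF bm1] integrable_brownian_increment2[OF bm2]
        integrable_increment_products bm1 bm2 assms)
qed

text \<open>The mixed term of the square drops out by \<open>expectation_cross_increment\<close>, so
  the variances of the two motions add up to \<open>2 (t - s)\<close>. These two identities do the
  work of Ito's formula in the one-step estimate.\<close>

lemma
  assumes st: "0 \<le> s" "s \<le> t" and Y: "Y \<in> borel_measurable (F s)" and C: "\<And>\<omega>. \<bar>Y \<omega>\<bar> \<le> C"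
  shows expectation_mult_B_increment: "expectation (\<lambda>\<omega>. Y \<omega> * (B t \<omega> - B s \<omega>)) = 0"
    and expectation_mult_B_increment2: "expectation (\<lambda>\<omega>. Y \<omega> * (B t \<omega> - B s \<omega>)\<^sup>2) = 2 * (t - s) * expectation Y"
proof -
  have YM: "Y \<in> borel_measurable M" by (rule filtration_measurable[OF st(1) Y])
  have Yint: "integrable M Y" by (rule integrable_const_bound[where B=C]) (use YM C in auto)
  note i1 = integrable_brownian_increment[OF bm1 st] and i2 = integrable_brownian_increment[OF bm2 st]
  note j1 = integrable_brownian_increment2[OF bm1 st] and j2 = integrable_brownian_increment2[OF bm2 st]
  note bounded = integrable_bounded_mult[OF YM C]
  have "expectation (\<lambda>\<omega>. Y \<omega> * (B t \<omega> - B s \<omega>))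
      = expectation (\<lambda>\<omega>. Y \<omega> * (\<beta>1 t \<omega> - \<beta>1 s \<omega>) - Y \<omega> * (\<beta>2 t \<omega> - \<beta>2 s \<omega>))"
    unfolding B_increment by (simp only: right_diff_distrib)
  also have "\<dots> = expectation (\<lambda>\<omega>. Y \<omega> * (\<beta>1 t \<omega> - \<beta>1 s \<omega>)) - expectation (\<lambda>\<omega>. Y \<omega> * (\<beta>2 t \<omega> - \<beta>2 s \<omega>))"
    by (intro Bochner_Integration.integral_diff bounded i1 i2)
  also have "\<dots> = 0"
    by (simp add: expectation_mult_increment_zero[OF bm1 st Y Yint] expectation_mult_increment_zero[OF bm2 st Y Yint])
  finally show "expectation (\<lambda>\<omega>. Y \<omega> * (B t \<omega> - B s \<omega>)) = 0" .
  have sq: "expectation (\<lambda>\<omega>. Y \<omega> * (\<beta> t \<omega> - \<beta> s \<omega>)\<^sup>2) = expectation Y * (t - s)"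
    if bm: "brownian_motion M F \<beta>" for \<beta>
    using expectation_mult_increment[OF bm st Y Yint, of "\<lambda>x. x\<^sup>2"] integrable_brownian_increment2[OF bm st]
    by (simp add: expectation_brownian_increment2[OF bm st])
  have "expectation (\<lambda>\<omega>. Y \<omega> * (B t \<omega> - B s \<omega>)\<^sup>2)
      = expectation (\<lambda>\<omega>. (Y \<omega> * (\<beta>1 t \<omega> - \<beta>1 s \<omega>)\<^sup>2 + Y \<omega> * (\<beta>2 t \<omega> - \<beta>2 s \<omega>)\<^sup>2)
        - 2 * (Y \<omega> * ((\<beta>1 t \<omega> - \<beta>1 s \<omega>) * (\<beta>2 t \<omega> - \<beta>2 s \<omega>))))"
    unfolding B_increment power2_diff
    by (intro Bochner_Integration.integral_cong refl) (simp add: algebra_simps)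
  also have "\<dots> = (expectation (\<lambda>\<omega>. Y \<omega> * (\<beta>1 t \<omega> - \<beta>1 s \<omega>)\<^sup>2) + expectation (\<lambda>\<omega>. Y \<omega> * (\<beta>2 t \<omega> - \<beta>2 s \<omega>)\<^sup>2))
      - 2 * expectation (\<lambda>\<omega>. Y \<omega> * ((\<beta>1 t \<omega> - \<beta>1 s \<omega>) * (\<beta>2 t \<omega> - \<beta>2 s \<omega>)))"
    using bounded[OF j1] bounded[OF j2] bounded[OF integrable_increment_products[OF bm1 bm2 st st]]
    by simp
  also have "\<dots> = 2 * (t - s) * expectation Y"
    by (simp add: sq[OF bm1] sq[OF bm2] expectation_cross_increment[OF st Y C])
  finally show "expectation (\<lambda>\<omega>. Y \<omega> * (B t \<omega> - B s \<omega>)\<^sup>2) = 2 * (t - s) * expectation Y" .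
qed

lemma nn_integral_B_increment:
  assumes st: "0 \<le> s" "s \<le> t"
  shows "(\<integral>\<^sup>+\<omega>. ennreal \<bar>B t \<omega> - B s \<omega>\<bar> \<partial>M) \<le> ennreal (2 * sqrt (t - s))"
proof -
  have [measurable]: "\<beta>1 s \<in> borel_measurable M" "\<beta>1 t \<in> borel_measurable M"
      "\<beta>2 s \<in> borel_measurable M" "\<beta>2 t \<in> borel_measurable M"
    using st by (auto intro: brownian_measurable bm1 bm2)
  have "(\<integral>\<^sup>+\<omega>. ennreal \<bar>B t \<omega> - B s \<omega>\<bar> \<partial>M)
      \<le> (\<integral>\<^sup>+\<omega>. ennreal \<bar>\<beta>1 t \<omega> - \<beta>1 s \<omega>\<bar> + ennreal \<bar>\<beta>2 t \<omega> - \<beta>2 s \<omega>\<bar> \<partial>M)"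
    unfolding B_increment by (intro nn_integral_mono) (simp add: ennreal_plus[symmetric] del: ennreal_plus)
  also have "\<dots> = (\<integral>\<^sup>+\<omega>. ennreal \<bar>\<beta>1 t \<omega> - \<beta>1 s \<omega>\<bar> \<partial>M) + (\<integral>\<^sup>+\<omega>. ennreal \<bar>\<beta>2 t \<omega> - \<beta>2 s \<omega>\<bar> \<partial>M)"
    by (rule nn_integral_add) measurable
  also have "\<dots> \<le> ennreal (sqrt (t - s)) + ennreal (sqrt (t - s))"
    by (intro add_mono nn_integral_brownian_increment bm1 bm2 st)
  also have "\<dots> = ennreal (2 * sqrt (t - s))"
    using st by (simp add: ennreal_plus[symmetric] del: ennreal_plus)
  finally show ?thesis .
qed

lemma nn_integral_B_increment_cubed:
  assumes st: "0 \<le> s" "s \<le> t"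
  shows "(\<integral>\<^sup>+\<omega>. ennreal (\<bar>B t \<omega> - B s \<omega>\<bar> ^ 3) \<partial>M) \<le> ennreal (16 * sqrt (t - s) ^ 3)"
proof -
  have [measurable]: "\<beta>1 s \<in> borel_measurable M" "\<beta>1 t \<in> borel_measurable M"
      "\<beta>2 s \<in> borel_measurable M" "\<beta>2 t \<in> borel_measurable M"
    using st by (auto intro: brownian_measurable bm1 bm2)
  \<comment> \<open>The constant 4 comes from the identity
    \<open>(a + b)^3 = 4 (a^3 + b^3) - 3 (a + b) (a - b)^2\<close>; with a bound 2 for each motion
    the total is \<open>4 (2 + 2) = 16\<close>.\<close>
  have cube: "\<bar>x - y\<bar> ^ 3 \<le> 4 * (\<bar>x\<bar> ^ 3 + \<bar>y\<bar> ^ 3)" for x y :: real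
  proof -
    have "\<bar>x - y\<bar> ^ 3 \<le> (\<bar>x\<bar> + \<bar>y\<bar>) ^ 3" by (intro power_mono) auto
    also have "\<dots> = 4 * (\<bar>x\<bar> ^ 3 + \<bar>y\<bar> ^ 3) - 3 * ((\<bar>x\<bar> + \<bar>y\<bar>) * (\<bar>x\<bar> - \<bar>y\<bar>)\<^sup>2)"
      by (simp add: power2_eq_square power3_eq_cube algebra_simps)
    also have "\<dots> \<le> 4 * (\<bar>x\<bar> ^ 3 + \<bar>y\<bar> ^ 3)" by simp
    finally show ?thesis .
  qed
  have "(\<integral>\<^sup>+\<omega>. ennreal (\<bar>B t \<omega> - B s \<omega>\<bar> ^ 3) \<partial>M)
      \<le> (\<integral>\<^sup>+\<omega>. ennreal 4 * (ennreal (\<bar>\<beta>1 t \<omega> - \<beta>1 s \<omega>\<bar> ^ 3) + ennreal (\<bar>\<beta>2 t \<omega> - \<beta>2 s \<omega>\<bar> ^ 3)) \<partial>M)"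
  proof (rule nn_integral_mono)
    fix \<omega>
    let ?x = "\<bar>\<beta>1 t \<omega> - \<beta>1 s \<omega>\<bar> ^ 3" and ?y = "\<bar>\<beta>2 t \<omega> - \<beta>2 s \<omega>\<bar> ^ 3"
    have "ennreal (\<bar>B t \<omega> - B s \<omega>\<bar> ^ 3) \<le> ennreal (4 * (?x + ?y))"
      unfolding B_increment by (intro ennreal_leI cube)
    also have "\<dots> = ennreal 4 * ennreal (?x + ?y)" by (rule ennreal_mult) auto
    also have "ennreal (?x + ?y) = ennreal ?x + ennreal ?y" by (rule ennreal_plus) auto
    finally show "ennreal (\<bar>B t \<omega> - B s \<omega>\<bar> ^ 3) \<le> ennreal 4 * (ennreal ?x + ennreal ?y)" .
  qed
  also have "\<dots> = ennreal 4 * ((\<integral>\<^sup>+\<omega>. ennreal (\<bar>\<beta>1 t \<omega> - \<beta>1 s \<omega>\<bar> ^ 3) \<partial>M) + (\<integral>\<^sup>+\<omega>. ennreal (\<bar>\<beta>2 t \<omega> - \<beta>2 s \<omega>\<bar> ^ 3) \<partial>M))"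
    by (subst nn_integral_cmult, measurable, subst nn_integral_add) measurable
  also have "\<dots> \<le> ennreal 4 * (ennreal (2 * sqrt (t - s) ^ 3) + ennreal (2 * sqrt (t - s) ^ 3))"
    by (intro mult_left_mono add_mono nn_integral_brownian_increment_cubed bm1 bm2 st) auto
  also have "ennreal (2 * sqrt (t - s) ^ 3) + ennreal (2 * sqrt (t - s) ^ 3) = ennreal (4 * sqrt (t - s) ^ 3)"
    using st by (simp add: ennreal_plus[symmetric] del: ennreal_plus)
  also have "ennreal 4 * ennreal (4 * sqrt (t - s) ^ 3) = ennreal (4 * (4 * sqrt (t - s) ^ 3))"
    using st by (intro ennreal_mult[symmetric]) auto
  also have "4 * (4 * sqrt (t - s) ^ 3) = 16 * sqrt (t - s) ^ 3" by simp
  finally show ?thesis .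
qed

end


section \<open>The exponential test function\<close>

text \<open>The point \<open>x + \<i> y\<close> is rotated by the angle \<open>\<Delta>\<close>. Its
  coordinates satisfy \<open>q' = - p\<close> and \<open>p' = q\<close>, so every derivative of
  \<open>exp(- \<gamma> q)\<close> is a polynomial in \<open>p\<close> and \<open>q\<close> times
  the exponential. Since the point stays in the unit disc, the third-order remainder is bounded
  uniformly.\<close>

lemma exp_rotation_taylor:
  fixes x y \<Delta> \<gamma> :: real
  assumes \<gamma>: "0 \<le> \<gamma>" and xy: "x\<^sup>2 + y\<^sup>2 \<le> 1"
  shows "exp (- \<gamma> * (x * cos \<Delta> - y * sin \<Delta>))
    \<le> exp (- \<gamma> * x) * (1 + \<gamma> * y * \<Delta> + (\<gamma> * x + \<gamma>\<^sup>2 * y\<^sup>2) / 2 * \<Delta>\<^sup>2)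
      + (\<gamma> + 3 * \<gamma>\<^sup>2 + \<gamma> ^ 3) * exp \<gamma> / 6 * \<bar>\<Delta>\<bar> ^ 3"
proof -
  define q where "q t = x * cos t - y * sin t" for t
  define p where "p t = x * sin t + y * cos t" for t
  define E where "E t = exp (- \<gamma> * q t)" for t
  \<comment> \<open>The derivatives of \<open>E\<close>; only orders up to 3 matter, and the last
    branch is the one of order 3.\<close>
  define diff where "diff m t = (if m = 0 then E t else if m = 1 then \<gamma> * p t * E t
      else if m = 2 then (\<gamma> * q t + \<gamma>\<^sup>2 * (p t)\<^sup>2) * E t
      else (- \<gamma> * p t + 3 * \<gamma>\<^sup>2 * (p t * q t) + \<gamma> ^ 3 * p t ^ 3) * E t)" for m :: nat and t
  have "(q t)\<^sup>2 + (p t)\<^sup>2 = (x\<^sup>2 + y\<^sup>2) * ((sin t)\<^sup>2 + (cos t)\<^sup>2)" for t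
    unfolding q_def p_def by algebra
  then have qp: "(q t)\<^sup>2 + (p t)\<^sup>2 \<le> 1" for t using xy by simp
  have q1: "\<bar>q t\<bar> \<le> 1" for t
  proof -
    have "(q t)\<^sup>2 \<le> 1" using qp[of t] zero_le_power2[of "p t"] by linarith
    then show ?thesis by (simp add: abs_square_le_1)
  qed
  have p1: "\<bar>p t\<bar> \<le> 1" for t
  proof -
    have "(p t)\<^sup>2 \<le> 1" using qp[of t] zero_le_power2[of "q t"] by linarith
    then show ?thesis by (simp add: abs_square_le_1)
  qed
  have dq: "(q has_real_derivative - p t) (at t)" for t
    unfolding q_def[abs_def] p_def by (auto intro!: derivative_eq_intros)
  have dp: "(p has_real_derivative q t) (at t)" for t
    unfolding p_def[abs_def] q_def by (auto intro!: derivative_eq_intros)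
  have dE: "(E has_real_derivative \<gamma> * p t * E t) (at t)" for t
    unfolding E_def[abs_def] by (auto intro!: derivative_eq_intros dq)
  have d: "(diff m has_real_derivative diff (Suc m) t) (at t)" if "m < 3" for m t
  proof -
    have "m = 0 \<or> m = 1 \<or> m = 2" using that by arith
    then consider "m = 0" | "m = 1" | "m = 2" by blast
    then show ?thesis
    proof cases
      case 1
      then show ?thesis using dE by (simp add: diff_def[abs_def])
    next
      case 2
      have "((\<lambda>t. \<gamma> * p t * E t) has_real_derivative (\<gamma> * q t + \<gamma>\<^sup>2 * (p t)\<^sup>2) * E t) (at t)"
        by (rule derivative_eq_intros dE dp | simp add: power2_eq_square algebra_simps)+
      then show ?thesis using 2 by (simp add: diff_def[abs_def])
    next
      case 3
      have "((\<lambda>t. (\<gamma> * q t + \<gamma>\<^sup>2 * (p t)\<^sup>2) * E t) has_real_derivative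
          (\<gamma> * (- p t) + \<gamma>\<^sup>2 * (2 * p t * q t)) * E t + (\<gamma> * p t * E t) * (\<gamma> * q t + \<gamma>\<^sup>2 * (p t)\<^sup>2)) (at t)"
        by (auto intro!: derivative_eq_intros dE dp dq)
      also have "(\<gamma> * (- p t) + \<gamma>\<^sup>2 * (2 * p t * q t)) * E t + (\<gamma> * p t * E t) * (\<gamma> * q t + \<gamma>\<^sup>2 * (p t)\<^sup>2)
          = (- \<gamma> * p t + 3 * \<gamma>\<^sup>2 * (p t * q t) + \<gamma> ^ 3 * p t ^ 3) * E t"
        by algebra
      finally have "((\<lambda>t. (\<gamma> * q t + \<gamma>\<^sup>2 * (p t)\<^sup>2) * E t) has_real_derivative
          (- \<gamma> * p t + 3 * \<gamma>\<^sup>2 * (p t * q t) + \<gamma> ^ 3 * p t ^ 3) * E t) (at t)" .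
      then show ?thesis using 3 by (simp add: diff_def[abs_def])
    qed
  qed
  obtain t where t: "diff 0 \<Delta> = (\<Sum>m<3. diff m 0 / fact m * \<Delta> ^ m) + diff 3 t / fact 3 * \<Delta> ^ 3"
    using Maclaurin_bi_le[of diff "diff 0" 3 \<Delta>] d by blast
  have "\<bar>diff 3 t\<bar> \<le> (\<gamma> + 3 * \<gamma>\<^sup>2 + \<gamma> ^ 3) * exp \<gamma>"
  proof -
    have "\<bar>p t * q t\<bar> \<le> 1" using mult_mono[OF p1[of t] q1[of t]] by (simp add: abs_mult)
    moreover have "\<bar>p t ^ 3\<bar> \<le> 1" using p1[of t] by (simp add: power_abs power_le_one)
    ultimately have "\<bar>- \<gamma> * p t + 3 * \<gamma>\<^sup>2 * (p t * q t) + \<gamma> ^ 3 * p t ^ 3\<bar>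
        \<le> \<gamma> * 1 + 3 * \<gamma>\<^sup>2 * 1 + \<gamma> ^ 3 * 1"
      using \<gamma> p1[of t]
      by (intro order_trans[OF abs_triangle_ineq] add_mono; simp add: abs_mult mult_left_le)
    moreover have "E t \<le> exp \<gamma>"
      using q1[of t] \<gamma> mult_left_mono[of "- q t" 1 \<gamma>] by (simp add: E_def)
    moreover have "0 \<le> E t" by (simp add: E_def)
    ultimately have "\<bar>- \<gamma> * p t + 3 * \<gamma>\<^sup>2 * (p t * q t) + \<gamma> ^ 3 * p t ^ 3\<bar> * E t
        \<le> (\<gamma> * 1 + 3 * \<gamma>\<^sup>2 * 1 + \<gamma> ^ 3 * 1) * exp \<gamma>"
      using \<gamma> by (intro mult_mono) auto
    then show ?thesis using \<open>0 \<le> E t\<close> by (simp add: diff_def abs_mult)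
  qed
  then have "diff 3 t / fact 3 * \<Delta> ^ 3 \<le> (\<gamma> + 3 * \<gamma>\<^sup>2 + \<gamma> ^ 3) * exp \<gamma> / 6 * \<bar>\<Delta>\<bar> ^ 3"
  proof -
    assume a: "\<bar>diff 3 t\<bar> \<le> (\<gamma> + 3 * \<gamma>\<^sup>2 + \<gamma> ^ 3) * exp \<gamma>"
    have "diff 3 t / fact 3 * \<Delta> ^ 3 \<le> \<bar>diff 3 t / fact 3 * \<Delta> ^ 3\<bar>" by (rule abs_ge_self)
    also have "\<dots> = \<bar>diff 3 t\<bar> / 6 * \<bar>\<Delta>\<bar> ^ 3" by (simp add: abs_mult power_abs fact_numeral)
    also have "\<dots> \<le> (\<gamma> + 3 * \<gamma>\<^sup>2 + \<gamma> ^ 3) * exp \<gamma> / 6 * \<bar>\<Delta>\<bar> ^ 3"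
      using a by (intro mult_right_mono divide_right_mono) auto
    finally show ?thesis .
  qed
  moreover have "(\<Sum>m<3. diff m 0 / fact m * \<Delta> ^ m)
      = exp (- \<gamma> * x) * (1 + \<gamma> * y * \<Delta> + (\<gamma> * x + \<gamma>\<^sup>2 * y\<^sup>2) / 2 * \<Delta>\<^sup>2)"
    by (simp add: numeral_3_eq_3 diff_def E_def p_def q_def fact_numeral algebra_simps power2_eq_square)
  ultimately show ?thesis using t by (simp add: diff_def E_def q_def)
qed

lemma exp_le_quadratic: "exp v \<le> 1 + v + exp \<bar>v\<bar> / 2 * v\<^sup>2" for v :: real
proof -
  obtain t where t: "\<bar>t\<bar> \<le> \<bar>v\<bar>" "exp v = (\<Sum>m<2. v ^ m / fact m) + exp t / fact 2 * v ^ 2"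
    using Maclaurin_exp_le[of v 2] by blast
  have "exp t / 2 * v\<^sup>2 \<le> exp \<bar>v\<bar> / 2 * v\<^sup>2"
    using t(1) by (intro mult_right_mono divide_right_mono) auto
  then show ?thesis using t(2) by (simp add: numeral_2_eq_2)
qed

lemma abs_exp_diff_le:
  fixes a b c :: real
  assumes "a \<le> c" "b \<le> c"
  shows "\<bar>exp a - exp b\<bar> \<le> exp c * \<bar>a - b\<bar>"
proof -
  have le: "exp a - exp b \<le> exp c * (a - b)" if "b \<le> a" "a \<le> c" for a b
  proof -
    have "1 - exp (b - a) \<le> a - b" using exp_ge_add_one_self[of "b - a"] by linarith
    then have "exp a * (1 - exp (b - a)) \<le> exp a * (a - b)" by (intro mult_left_mono) auto
    also have "\<dots> \<le> exp c * (a - b)" using that by (intro mult_right_mono) auto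
    also have "exp a * (1 - exp (b - a)) = exp a - exp b" by (simp add: right_diff_distrib exp_add[symmetric])
    finally show ?thesis .
  qed
  show ?thesis
  proof (cases "b \<le> a")
    case True
    with le[of b a] assms show ?thesis by simp
  next
    case False
    with le[of a b] assms show ?thesis by simp
  qed
qed

lemma exp_test_step:
  fixes w z' :: complex and \<gamma> K h \<Delta> R :: real
  assumes \<gamma>: "0 \<le> \<gamma>" and K: "0 \<le> K" and h: "0 \<le> h"
    and w: "cmod w \<le> 1" and z': "cmod z' \<le> 1"
    and 1: "cmod (z' - exp (\<i> * of_real \<Delta>) * w) \<le> 2 * K * h"
    and 2: "cmod (z' - exp (\<i> * of_real \<Delta>) * w - of_real (h * K) * (1 - w\<^sup>2)) \<le> R"
  shows "exp (- \<gamma> * Re z') + \<gamma> * h * K * (exp (- \<gamma> * Re w) * (1 - (Re w)\<^sup>2 + (Im w)\<^sup>2))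
    \<le> exp (- \<gamma> * Re w) * (1 + \<gamma> * Im w * \<Delta> + (\<gamma> * Re w + \<gamma>\<^sup>2 * (Im w)\<^sup>2) / 2 * \<Delta>\<^sup>2)
      + (\<gamma> + 3 * \<gamma>\<^sup>2 + \<gamma> ^ 3) * exp \<gamma> / 6 * \<bar>\<Delta>\<bar> ^ 3 + 2 * \<gamma>\<^sup>2 * K * exp \<gamma> * (h * \<bar>\<Delta>\<bar>)
      + 2 * \<gamma>\<^sup>2 * K\<^sup>2 * exp (3 * \<gamma>) * h\<^sup>2 + \<gamma> * exp \<gamma> * R"
proof -
  define x where "x = Re w"
  define y where "y = Im w"
  define q where "q = Re (exp (\<i> * of_real \<Delta>) * w)"
  define m where "m = Re (z' - exp (\<i> * of_real \<Delta>) * w)"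
  have q: "q = x * cos \<Delta> - y * sin \<Delta>"
    by (simp add: q_def x_def y_def Re_exp Im_exp mult.commute)
  have x1: "\<bar>x\<bar> \<le> 1" using abs_Re_le_cmod[of w] w by (simp add: x_def)
  have xy: "x\<^sup>2 + y\<^sup>2 \<le> 1"
    using w by (simp add: x_def y_def cmod_power2[symmetric] power_le_one)
  have q1: "\<bar>q\<bar> \<le> 1"
    using abs_Re_le_cmod[of "exp (\<i> * of_real \<Delta>) * w"] w by (simp add: q_def norm_mult)
  have m1: "\<bar>m\<bar> \<le> 2 * K * h" unfolding m_def using abs_Re_le_cmod 1 by (rule order_trans)
  have zqm: "Re z' = q + m" by (simp add: q_def m_def)
  \<comment> \<open>A bound on \<open>m\<close> free of \<open>h\<close>, from \<open>Re z'\<close>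
    and \<open>q\<close> both lying in \<open>[-1, 1]\<close>. It enters only the exponential in the
    quadratic remainder, where together with \<open>exp(- \<gamma> q)\<close> it produces
    \<open>exp(3 \<gamma>)\<close>.\<close>
  have "\<bar>Re z'\<bar> \<le> 1" using abs_Re_le_cmod[of z'] z' by simp
  then have m2: "\<bar>m\<bar> \<le> 2" using zqm q1 by linarith
  have Eq: "exp (- \<gamma> * q) \<le> exp \<gamma>" using q1 \<gamma> mult_left_mono[of "- q" 1 \<gamma>] by simp
  have Ex: "exp (- \<gamma> * x) \<le> exp \<gamma>" using x1 \<gamma> mult_left_mono[of "- x" 1 \<gamma>] by simp
  have "exp (- \<gamma> * m) \<le> 1 + (- \<gamma> * m) + exp \<bar>- \<gamma> * m\<bar> / 2 * (- \<gamma> * m)\<^sup>2" by (rule exp_le_quadratic)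
  also have "exp \<bar>- \<gamma> * m\<bar> / 2 * (- \<gamma> * m)\<^sup>2 \<le> exp (2 * \<gamma>) / 2 * (\<gamma> * (2 * K * h))\<^sup>2"
  proof (intro mult_mono divide_right_mono)
    show "exp \<bar>- \<gamma> * m\<bar> \<le> exp (2 * \<gamma>)" using m2 \<gamma> mult_left_mono[of "\<bar>m\<bar>" 2 \<gamma>] by (simp add: abs_mult mult.commute)
    have "(\<gamma> * \<bar>m\<bar>)\<^sup>2 \<le> (\<gamma> * (2 * K * h))\<^sup>2"
      using m1 \<gamma> by (intro power_mono mult_left_mono mult_nonneg_nonneg) auto
    then show "(- \<gamma> * m)\<^sup>2 \<le> (\<gamma> * (2 * K * h))\<^sup>2" by (simp add: power_mult_distrib)
  qed auto
  finally have em: "exp (- \<gamma> * m) \<le> 1 - \<gamma> * m + 2 * \<gamma>\<^sup>2 * K\<^sup>2 * exp (2 * \<gamma>) * h\<^sup>2"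
    by (simp add: power_mult_distrib mult_ac)
  have "exp (- \<gamma> * Re z') = exp (- \<gamma> * q) * exp (- \<gamma> * m)"
    by (simp add: zqm exp_add[symmetric] algebra_simps)
  also have "\<dots> \<le> exp (- \<gamma> * q) * (1 - \<gamma> * m + 2 * \<gamma>\<^sup>2 * K\<^sup>2 * exp (2 * \<gamma>) * h\<^sup>2)"
    using em by (intro mult_left_mono) auto
  also have "\<dots> = exp (- \<gamma> * q) - \<gamma> * m * exp (- \<gamma> * q) + exp (- \<gamma> * q) * (2 * \<gamma>\<^sup>2 * K\<^sup>2 * exp (2 * \<gamma>) * h\<^sup>2)"
    by (simp add: algebra_simps)
  also have "exp (- \<gamma> * q) * (2 * \<gamma>\<^sup>2 * K\<^sup>2 * exp (2 * \<gamma>) * h\<^sup>2) \<le> exp \<gamma> * (2 * \<gamma>\<^sup>2 * K\<^sup>2 * exp (2 * \<gamma>) * h\<^sup>2)"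
    using Eq by (intro mult_right_mono) auto
  also have "exp \<gamma> * (2 * \<gamma>\<^sup>2 * K\<^sup>2 * exp (2 * \<gamma>) * h\<^sup>2) = 2 * \<gamma>\<^sup>2 * K\<^sup>2 * exp (3 * \<gamma>) * h\<^sup>2"
  proof -
    have "exp (3 * \<gamma>) = exp \<gamma> * exp (2 * \<gamma>)" by (simp add: exp_add[symmetric])
    then show ?thesis by (simp only: mult_ac)
  qed
  finally have s1: "exp (- \<gamma> * Re z') \<le> exp (- \<gamma> * q) - \<gamma> * m * exp (- \<gamma> * q)
      + 2 * \<gamma>\<^sup>2 * K\<^sup>2 * exp (3 * \<gamma>) * h\<^sup>2" by simp
  have s2: "- (\<gamma> * m * exp (- \<gamma> * q)) \<le> - (\<gamma> * m * exp (- \<gamma> * x)) + 2 * \<gamma>\<^sup>2 * K * exp \<gamma> * (h * \<bar>\<Delta>\<bar>)"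
  proof -
    have "q - x = Re ((exp (\<i> * of_real \<Delta>) - exp (\<i> * of_real 0)) * w)"
      by (simp add: q_def x_def left_diff_distrib)
    then have "\<bar>q - x\<bar> \<le> cmod ((exp (\<i> * of_real \<Delta>) - exp (\<i> * of_real 0)) * w)"
      using abs_Re_le_cmod by metis
    also have "\<dots> \<le> \<bar>\<Delta> - 0\<bar> * 1"
      unfolding norm_mult by (intro mult_mono cmod_exp_ii_diff_le w) auto
    finally have qx: "\<bar>q - x\<bar> \<le> \<bar>\<Delta>\<bar>" by simp
    have "\<bar>exp (- \<gamma> * q) - exp (- \<gamma> * x)\<bar> \<le> exp \<gamma> * \<bar>- \<gamma> * q - - \<gamma> * x\<bar>"
      by (rule abs_exp_diff_le) (use Eq Ex in auto)
    also have "\<bar>- \<gamma> * q - - \<gamma> * x\<bar> = \<gamma> * \<bar>q - x\<bar>"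
      using \<gamma> by (simp add: abs_mult right_diff_distrib[symmetric] abs_minus_commute)
    also have "exp \<gamma> * (\<gamma> * \<bar>q - x\<bar>) \<le> exp \<gamma> * (\<gamma> * \<bar>\<Delta>\<bar>)"
      using qx \<gamma> by (intro mult_left_mono) auto
    finally have e: "\<bar>exp (- \<gamma> * q) - exp (- \<gamma> * x)\<bar> \<le> exp \<gamma> * (\<gamma> * \<bar>\<Delta>\<bar>)" .
    have "\<bar>m\<bar> * \<bar>exp (- \<gamma> * q) - exp (- \<gamma> * x)\<bar> \<le> (2 * K * h) * (exp \<gamma> * (\<gamma> * \<bar>\<Delta>\<bar>))"
      using K h by (intro mult_mono m1 e) auto
    then have "- m * (exp (- \<gamma> * q) - exp (- \<gamma> * x)) \<le> (2 * K * h) * (exp \<gamma> * (\<gamma> * \<bar>\<Delta>\<bar>))"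
      using abs_ge_self[of "- m * (exp (- \<gamma> * q) - exp (- \<gamma> * x))"] by (simp add: abs_mult)
    then have "\<gamma> * (- m * (exp (- \<gamma> * q) - exp (- \<gamma> * x))) \<le> \<gamma> * ((2 * K * h) * (exp \<gamma> * (\<gamma> * \<bar>\<Delta>\<bar>)))"
      using \<gamma> by (rule mult_left_mono)
    then show ?thesis by (simp add: algebra_simps power2_eq_square)
  qed
  have s3: "- (\<gamma> * m * exp (- \<gamma> * x)) \<le> - (\<gamma> * (h * K * (1 - x\<^sup>2 + y\<^sup>2)) * exp (- \<gamma> * x)) + \<gamma> * exp \<gamma> * R"
  proof -
    have "Re (of_real (h * K) * (1 - w\<^sup>2)) = h * K * (1 - x\<^sup>2 + y\<^sup>2)"
      by (simp add: x_def y_def power2_eq_square)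
    then have "\<bar>m - h * K * (1 - x\<^sup>2 + y\<^sup>2)\<bar> = \<bar>Re (z' - exp (\<i> * of_real \<Delta>) * w - of_real (h * K) * (1 - w\<^sup>2))\<bar>"
      by (simp only: m_def minus_complex.simps)
    also have "\<dots> \<le> R" using abs_Re_le_cmod 2 by (rule order_trans)
    finally have r: "\<bar>m - h * K * (1 - x\<^sup>2 + y\<^sup>2)\<bar> \<le> R" .
    then have "0 \<le> R" by linarith
    have "h * K * (1 - x\<^sup>2 + y\<^sup>2) - m \<le> R" using r by linarith
    then have "exp (- \<gamma> * x) * (h * K * (1 - x\<^sup>2 + y\<^sup>2) - m) \<le> exp (- \<gamma> * x) * R" by (intro mult_left_mono) auto
    also have "\<dots> \<le> exp \<gamma> * R" using Ex \<open>0 \<le> R\<close> by (intro mult_right_mono)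
    finally have "\<gamma> * (exp (- \<gamma> * x) * (h * K * (1 - x\<^sup>2 + y\<^sup>2) - m)) \<le> \<gamma> * (exp \<gamma> * R)"
      using \<gamma> by (rule mult_left_mono)
    then show ?thesis by (simp add: algebra_simps)
  qed
  have "exp (- \<gamma> * Re z') \<le> exp (- \<gamma> * q) + (- (\<gamma> * (h * K * (1 - x\<^sup>2 + y\<^sup>2)) * exp (- \<gamma> * x)) + \<gamma> * exp \<gamma> * R
      + 2 * \<gamma>\<^sup>2 * K * exp \<gamma> * (h * \<bar>\<Delta>\<bar>)) + 2 * \<gamma>\<^sup>2 * K\<^sup>2 * exp (3 * \<gamma>) * h\<^sup>2"
    using s1 s2 s3 by linarith
  moreover have "\<gamma> * (h * K * (1 - x\<^sup>2 + y\<^sup>2)) * exp (- \<gamma> * x) = \<gamma> * h * K * (exp (- \<gamma> * x) * (1 - x\<^sup>2 + y\<^sup>2))"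
    by (simp only: mult_ac)
  ultimately show ?thesis
    using exp_rotation_taylor[OF \<gamma> xy, of \<Delta>] unfolding q x_def[symmetric] y_def[symmetric] by linarith
qed

text \<open>The value of \<open>Re \<langle>\<psi>\<^sub>1, \<psi>\<^sub>2\<rangle>\<close> for unit vectors at distance \<open>r\<close>, cut off to \<open>[-1, 1]\<close>.\<close>

definition overlap :: "real \<Rightarrow> real" where
  "overlap r = 1 - min (r\<^sup>2) 4 / 2"

lemma overlap_bounds: "- 1 \<le> overlap r" "overlap r \<le> 1" "\<bar>overlap r\<bar> \<le> 1"
proof -
  show "- 1 \<le> overlap r" "overlap r \<le> 1" by (auto simp: overlap_def min_def)
  then show "\<bar>overlap r\<bar> \<le> 1" by linarith
qed

lemma continuous_on_overlap: "continuous_on UNIV overlap"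
  unfolding overlap_def[abs_def] by (intro continuous_intros) auto

text \<open>Composition with the cut-off overlap gives a bounded continuous function on the whole
  line, as convergence in distribution requires.\<close>

definition test_fun :: "real \<Rightarrow> real \<Rightarrow> real" where
  "test_fun \<gamma> r = exp (- \<gamma> * overlap r)"

text \<open>For \<open>\<gamma> = K / \<epsilon>^2\<close>, the generator applied to
  \<open>- test_fun \<gamma>\<close> and divided by \<open>K\<close>.\<close>

definition test_gen :: "real \<Rightarrow> real \<Rightarrow> real" where
  "test_gen \<gamma> r = exp (- \<gamma> * overlap r) * (\<gamma> * (1 - (overlap r)\<^sup>2) - overlap r)"

lemma continuous_on_test: "continuous_on UNIV (test_fun \<gamma>)" "continuous_on UNIV (test_gen \<gamma>)"
  unfolding test_fun_def[abs_def] test_gen_def[abs_def]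
  by (intro continuous_intros continuous_on_overlap)+

lemma abs_test_fun_le: "0 \<le> \<gamma> \<Longrightarrow> \<bar>test_fun \<gamma> r\<bar> \<le> exp \<gamma>"
  using overlap_bounds(1)[of r] mult_left_mono[of "- overlap r" 1 \<gamma>] by (simp add: test_fun_def)

lemma abs_test_gen_le: "0 \<le> \<gamma> \<Longrightarrow> \<bar>test_gen \<gamma> r\<bar> \<le> exp \<gamma> * (\<gamma> + 1)"
proof -
  assume \<gamma>: "0 \<le> \<gamma>"
  have o2: "0 \<le> (overlap r)\<^sup>2" "(overlap r)\<^sup>2 \<le> 1"
    using overlap_bounds(3)[of r] by (auto simp: abs_square_le_1)
  have "\<bar>\<gamma> * (1 - (overlap r)\<^sup>2) - overlap r\<bar> \<le> \<bar>\<gamma> * (1 - (overlap r)\<^sup>2)\<bar> + \<bar>overlap r\<bar>"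
    by (rule abs_triangle_ineq4)
  also have "\<bar>\<gamma> * (1 - (overlap r)\<^sup>2)\<bar> \<le> \<gamma>" using \<gamma> o2 by (simp add: abs_mult mult_left_le)
  also have "\<bar>overlap r\<bar> \<le> 1" by (rule overlap_bounds)
  finally have "\<bar>\<gamma> * (1 - (overlap r)\<^sup>2) - overlap r\<bar> \<le> \<gamma> + 1" by simp
  then have "exp (- \<gamma> * overlap r) * \<bar>\<gamma> * (1 - (overlap r)\<^sup>2) - overlap r\<bar> \<le> exp \<gamma> * (\<gamma> + 1)"
    using abs_test_fun_le[OF \<gamma>, of r] by (intro mult_mono) (auto simp: test_fun_def)
  then show ?thesis by (simp add: test_gen_def abs_mult)
qed

lemma bounded_range_real:
  fixes f :: "real \<Rightarrow> real"
  assumes "\<And>x. \<bar>f x\<bar> \<le> C"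
  shows "bounded (range f)"
  using assms by (auto simp: bounded_iff)


section \<open>The one-step estimate\<close>

locale lohe_solution = brownian_pair M F \<beta>1 \<beta>2
  for M :: "'w measure" and F :: "real \<Rightarrow> 'w measure" and \<beta>1 \<beta>2 :: "real \<Rightarrow> 'w \<Rightarrow> real" +
  fixes K \<epsilon> :: real and u :: "'a::euclidean_space L2 \<times> 'a L2"
    and \<psi> :: "real \<Rightarrow> 'w \<Rightarrow> 'a L2 \<times> 'a L2"
  assumes K: "K > 0" and \<epsilon>: "\<epsilon> > 0" and u1: "norm (fst u) = 1" and u2: "norm (snd u) = 1"
    and solution: "schroedinger_lohe_solution M F \<beta>1 \<beta>2 K \<epsilon> u \<psi>"
begin

definition correlation :: "real \<Rightarrow> 'w \<Rightarrow> complex" where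
  "correlation t \<omega> = cinner (fst (\<psi> t \<omega>)) (snd (\<psi> t \<omega>))"

definition separation :: "real \<Rightarrow> 'w \<Rightarrow> real" where
  "separation t \<omega> = norm (fst (\<psi> t \<omega>) - snd (\<psi> t \<omega>))"

definition \<gamma> :: real where "\<gamma> = K / \<epsilon>\<^sup>2"

lemma \<gamma>_pos: "\<gamma> > 0" using K \<epsilon> by (simp add: \<gamma>_def)

lemma \<gamma>_\<epsilon>: "\<gamma> * \<epsilon>\<^sup>2 = K" using \<epsilon> by (simp add: \<gamma>_def)

lemma adapted_compose:
  assumes "0 \<le> t" "continuous_on UNIV g"
  shows "(\<lambda>\<omega>. g (\<psi> t \<omega>)) \<in> borel_measurable (F t)"
  using solution assms by (intro borel_measurable_continuous_on[of g]) (auto simp: schroedinger_lohe_solution_def)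

lemma separation_adapted: "0 \<le> t \<Longrightarrow> separation t \<in> borel_measurable (F t)"
  unfolding separation_def[abs_def] by (rule adapted_compose) (auto intro!: continuous_intros)

lemma correlation_adapted: "0 \<le> t \<Longrightarrow> correlation t \<in> borel_measurable (F t)"
  unfolding correlation_def[abs_def] by (rule adapted_compose) (auto intro!: continuous_intros)

lemma separation_measurable: "0 \<le> t \<Longrightarrow> separation t \<in> borel_measurable M"
  using separation_adapted filtration_measurable by blast

definition step_error :: "real \<Rightarrow> real \<Rightarrow> real \<Rightarrow> 'w \<Rightarrow> real" where
  "step_error t h s \<omega> = 2 * K * (\<bar>\<epsilon> * B (t + h) \<omega> - \<epsilon> * B s \<omega>\<bar> + \<bar>\<epsilon> * B s \<omega> - \<epsilon> * B t \<omega>\<bar> + 2 * K * h)"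

text \<open>The equation is solved path by path, so a single exceptional null set serves all
  \<open>t\<close> and \<open>h\<close>.\<close>

lemma AE_path:
  "AE \<omega> in M. continuous_on {0..} (\<lambda>t. B t \<omega>) \<and> (\<forall>t\<ge>0. \<forall>h\<ge>0.
      norm (fst (\<psi> t \<omega>)) = 1 \<and> norm (snd (\<psi> t \<omega>)) = 1 \<and>
      cmod (correlation (t + h) \<omega> - exp (\<i> * of_real (\<epsilon> * B (t + h) \<omega> - \<epsilon> * B t \<omega>)) * correlation t \<omega>) \<le> 2 * K * h \<and>
      cmod (correlation (t + h) \<omega> - exp (\<i> * of_real (\<epsilon> * B (t + h) \<omega> - \<epsilon> * B t \<omega>)) * correlation t \<omega>
        - of_real (h * K) * (1 - (correlation t \<omega>)\<^sup>2)) \<le> integral {t..t + h} (\<lambda>s. step_error t h s \<omega>))"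
proof -
  have "AE \<omega> in M. continuous_on {0..} (\<lambda>t. \<beta>1 t \<omega>)" "AE \<omega> in M. continuous_on {0..} (\<lambda>t. \<beta>2 t \<omega>)"
    using bm1 bm2 by (auto simp: brownian_motion_def)
  moreover have "AE \<omega> in M.
      let \<phi>1 = (\<lambda>t. scaleC (exp (- \<i> * of_real (\<epsilon> * \<beta>1 t \<omega>))) (fst (\<psi> t \<omega>)));
          \<phi>2 = (\<lambda>t. scaleC (exp (- \<i> * of_real (\<epsilon> * \<beta>2 t \<omega>))) (snd (\<psi> t \<omega>)))
      in mild_solution (fst u) (\<lambda>s. coupling K (\<epsilon> * (\<beta>1 s \<omega> - \<beta>2 s \<omega>)) (\<phi>1 s) (\<phi>2 s)) \<phi>1 \<and>
         mild_solution (snd u) (\<lambda>s. coupling K (\<epsilon> * (\<beta>2 s \<omega> - \<beta>1 s \<omega>)) (\<phi>2 s) (\<phi>1 s)) \<phi>2"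
    using solution by (simp add: schroedinger_lohe_solution_def)
  ultimately show ?thesis
  proof eventually_elim
    case (elim \<omega>)
    note est = lohe_path_estimates[of K "\<lambda>t. \<beta>1 t \<omega>" "\<lambda>t. \<beta>2 t \<omega>" "fst u" "snd u" \<epsilon>
        "\<lambda>t. fst (\<psi> t \<omega>)" "\<lambda>t. snd (\<psi> t \<omega>)", OF less_imp_le[OF K] elim(1,2) u1 u2
        conjunct1[OF elim(3)[unfolded Let_def]] conjunct2[OF elim(3)[unfolded Let_def]]]
    show ?case
    proof (intro conjI allI impI)
      show "continuous_on {0..} (\<lambda>t. B t \<omega>)"
        unfolding B_def by (intro continuous_intros elim)
    qed (use est in \<open>simp_all only: correlation_def step_error_def B_def right_diff_distrib[symmetric]\<close>)
  qed
qed

text \<open>For unit vectors the squared distance is \<open>2 - 2 Re z\<close>, hence at most 4, so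
  the cutoff in \<open>overlap\<close> is inactive along the solution.\<close>

lemma unit_vector_facts:
  assumes "norm (fst (\<psi> t \<omega>)) = 1" "norm (snd (\<psi> t \<omega>)) = 1"
  shows "cmod (correlation t \<omega>) \<le> 1" and "Re (correlation t \<omega>) = overlap (separation t \<omega>)"
proof -
  show "cmod (correlation t \<omega>) \<le> 1"
    using norm_cinner_le[of "fst (\<psi> t \<omega>)" "snd (\<psi> t \<omega>)"] assms by (simp add: correlation_def)
  have "(separation t \<omega>)\<^sup>2 = 2 - 2 * Re (correlation t \<omega>)"
    using cinner_eq_norms[of "fst (\<psi> t \<omega>)" "snd (\<psi> t \<omega>)"] assms
    by (simp add: separation_def correlation_def field_simps)
  moreover have "separation t \<omega> \<le> 2"
    using norm_triangle_ineq4[of "fst (\<psi> t \<omega>)" "snd (\<psi> t \<omega>)"] assms by (simp add: separation_def)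
  then have "(separation t \<omega>)\<^sup>2 \<le> 2\<^sup>2" by (intro power_mono) (auto simp: separation_def)
  ultimately show "Re (correlation t \<omega>) = overlap (separation t \<omega>)"
    by (simp add: overlap_def diff_divide_distrib)
qed

text \<open>The constants sort the errors of \<open>exp_test_step\<close>: \<open>err3\<close>
  multiplies the cubed increment of \<open>B\<close>, \<open>err1\<close> the increment times
  \<open>h\<close>, \<open>err2\<close> the two increments inside \<open>step_error\<close>, and
  \<open>err0\<close> collects the terms in \<open>h^2\<close>, with \<open>4 K^2\<close> coming
  from the last summand of \<open>step_error\<close>. In \<open>err\<close> the first three carry
  the moment bounds 16, 2 and 2 + 2.\<close>

definition err3 :: real where "err3 = (\<gamma> + 3 * \<gamma>\<^sup>2 + \<gamma> ^ 3) * exp \<gamma> / 6 * \<epsilon> ^ 3"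
definition err1 :: real where "err1 = 2 * \<gamma>\<^sup>2 * K * exp \<gamma> * \<epsilon>"
definition err0 :: real where "err0 = 2 * \<gamma>\<^sup>2 * K\<^sup>2 * exp (3 * \<gamma>) + \<gamma> * exp \<gamma> * (4 * K\<^sup>2)"
definition err2 :: real where "err2 = \<gamma> * exp \<gamma> * (2 * K * \<epsilon>)"
definition err :: real where "err = 16 * err3 + 2 * err1 + 4 * err2 + err0"

lemma err_nonneg: "0 \<le> err3" "0 \<le> err1" "0 \<le> err0" "0 \<le> err2" "0 \<le> err"
  using K \<epsilon> \<gamma>_pos by (simp_all add: err3_def err1_def err0_def err2_def err_def)

text \<open>The error of one step per unit time: contributions independent of \<open>s\<close> are
  divided by \<open>h\<close>, so that integration over the step restores them and one bound on time
  integrals covers everything.\<close>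

definition total_error :: "real \<Rightarrow> real \<Rightarrow> real \<Rightarrow> 'w \<Rightarrow> real" where
  "total_error t h s \<omega> = err3 / h * \<bar>B (t + h) \<omega> - B t \<omega>\<bar> ^ 3 + err1 * \<bar>B (t + h) \<omega> - B t \<omega>\<bar>
    + err0 * h + err2 * (\<bar>B (t + h) \<omega> - B s \<omega>\<bar> + \<bar>B s \<omega> - B t \<omega>\<bar>)"

lemma expectation_le_nn_integral:
  assumes "f \<in> borel_measurable M" "\<And>\<omega>. 0 \<le> f \<omega>" "(\<integral>\<^sup>+\<omega>. ennreal (f \<omega>) \<partial>M) \<le> ennreal c" "0 \<le> c"
  shows "integrable M f" "expectation f \<le> c"
proof -
  show i: "integrable M f"
    using assms by (intro integrableI_nonneg) (auto simp: order_le_less_trans)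
  have "ennreal (expectation f) \<le> ennreal c"
    using nn_integral_eq_integral[OF i] assms by simp
  then show "expectation f \<le> c" using assms(4) by (simp add: ennreal_le_iff)
qed

text \<open>Every term has mean of order \<open>sqrt h\<close>: the cube contributes
  \<open>h sqrt h / h\<close>, single increments contribute \<open>sqrt h\<close>, and
  \<open>h \<le> sqrt h\<close> because \<open>h \<le> 1\<close>.\<close>

lemma nn_integral_total_error:
  assumes t: "0 \<le> t" and h: "0 < h" "h \<le> 1" and s: "s \<in> {t..t + h}"
  shows "total_error t h s \<in> borel_measurable M"
    and "(\<integral>\<^sup>+\<omega>. ennreal (total_error t h s \<omega>) \<partial>M) \<le> ennreal (err * sqrt h)"
proof -
  have [measurable]: "B t \<in> borel_measurable M" "B (t + h) \<in> borel_measurable M" "B s \<in> borel_measurable M"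
    using t h s by (auto intro: B_measurable)
  show "total_error t h s \<in> borel_measurable M" unfolding total_error_def[abs_def] by measurable
  have h3: "sqrt h ^ 3 = h * sqrt h" using h by (simp add: power3_eq_cube)
  have hs: "h \<le> sqrt h" using h by (metis less_eq_real_def mult_left_le real_sqrt_ge_0_iff real_sqrt_le_1_iff real_sqrt_mult_self abs_of_pos)
  have le: "ennreal (2 * sqrt r) \<le> ennreal (2 * sqrt h)" if "r \<le> h" for r
    using that by (intro ennreal_leI) simp
  have n3: "(\<integral>\<^sup>+\<omega>. ennreal (\<bar>B (t + h) \<omega> - B t \<omega>\<bar> ^ 3) \<partial>M) \<le> ennreal (16 * (h * sqrt h))"
    using t h nn_integral_B_increment_cubed[of t "t + h"] h3 by simp
  have n1: "(\<integral>\<^sup>+\<omega>. ennreal \<bar>B (t + h) \<omega> - B t \<omega>\<bar> \<partial>M) \<le> ennreal (2 * sqrt h)"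
    using t h nn_integral_B_increment[of t "t + h"] by simp
  have n2: "(\<integral>\<^sup>+\<omega>. ennreal \<bar>B (t + h) \<omega> - B s \<omega>\<bar> \<partial>M) \<le> ennreal (2 * sqrt h)"
    using t h s by (intro order_trans[OF nn_integral_B_increment le]) auto
  have n4: "(\<integral>\<^sup>+\<omega>. ennreal \<bar>B s \<omega> - B t \<omega>\<bar> \<partial>M) \<le> ennreal (2 * sqrt h)"
    using t h s by (intro order_trans[OF nn_integral_B_increment le]) auto
  have hn: "0 \<le> 16 * (h * sqrt h)" "0 \<le> 2 * sqrt h" using h by auto
  note c3 = expectation_le_nn_integral[OF _ _ n3 hn(1), simplified]
  note c1 = expectation_le_nn_integral[OF _ _ n1 hn(2), simplified]
  note c2 = expectation_le_nn_integral[OF _ _ n2 hn(2), simplified]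
  note c4 = expectation_le_nn_integral[OF _ _ n4 hn(2), simplified]
  have int: "integrable M (total_error t h s)"
    unfolding total_error_def[abs_def] using c1 c2 c3 c4 by simp
  have "expectation (total_error t h s) = err3 / h * expectation (\<lambda>\<omega>. \<bar>B (t + h) \<omega> - B t \<omega>\<bar> ^ 3)
      + err1 * expectation (\<lambda>\<omega>. \<bar>B (t + h) \<omega> - B t \<omega>\<bar>) + err0 * h
      + err2 * (expectation (\<lambda>\<omega>. \<bar>B (t + h) \<omega> - B s \<omega>\<bar>) + expectation (\<lambda>\<omega>. \<bar>B s \<omega> - B t \<omega>\<bar>))"
    unfolding total_error_def[abs_def] using c1 c2 c3 c4 by (simp add: prob_space)
  also have "\<dots> \<le> err3 / h * (16 * (h * sqrt h)) + err1 * (2 * sqrt h) + err0 * sqrt h + err2 * (2 * sqrt h + 2 * sqrt h)"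
    using c1 c2 c3 c4 hs h err_nonneg by (intro add_mono mult_left_mono) auto
  also have "\<dots> = err * sqrt h" using h by (simp add: err_def algebra_simps)
  finally have "expectation (total_error t h s) \<le> err * sqrt h" .
  moreover have "(\<integral>\<^sup>+\<omega>. ennreal (total_error t h s \<omega>) \<partial>M) = ennreal (expectation (total_error t h s))"
    using err_nonneg h by (intro nn_integral_eq_integral[OF int]) (simp add: total_error_def)
  ultimately show "(\<integral>\<^sup>+\<omega>. ennreal (total_error t h s \<omega>) \<partial>M) \<le> ennreal (err * sqrt h)"
    by (simp add: ennreal_leI)
qed

text \<open>
  With \<open>\<gamma> = K / \<epsilon>\<^sup>2\<close> the second-order contribution \<open>\<gamma>\<^sup>2 \<epsilon>\<^sup>2 (Im z)\<^sup>2\<close> of the noise cancels the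
  contribution \<open>\<gamma> K (Im z)\<^sup>2\<close> of the drift, so that only a function of \<open>Re z\<close> remains.
\<close>

lemma one_step:
  assumes t: "0 \<le> t" and h: "0 < h" "h \<le> 1"
  shows "expectation (\<lambda>\<omega>. test_fun \<gamma> (separation (t + h) \<omega>)) + h * K * expectation (\<lambda>\<omega>. test_gen \<gamma> (separation t \<omega>))
    \<le> expectation (\<lambda>\<omega>. test_fun \<gamma> (separation t \<omega>)) + err * sqrt h * h"
proof -
  define x where "x \<omega> = overlap (separation t \<omega>)" for \<omega>
  \<comment> \<open>Clipping changes \<open>Im z\<close> at most on a null set and yields a bound at
    every point of the space, as the expectation lemmas demand.\<close>
  define y where "y \<omega> = max (- 1) (min 1 (Im (correlation t \<omega>)))" for \<omega>
  define E where "E \<omega> = exp (- \<gamma> * x \<omega>)" for \<omega>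
  define D where "D \<omega> = B (t + h) \<omega> - B t \<omega>" for \<omega>
  \<comment> \<open>\<open>Y1\<close> and \<open>Y2\<close> are the coefficients of \<open>D\<close>
    and \<open>D^2\<close> in the Taylor expansion; both are bounded and known at time
    \<open>t\<close>.\<close>
  define Y1 where "Y1 \<omega> = E \<omega> * (\<gamma> * y \<omega> * \<epsilon>)" for \<omega>
  define Y2 where "Y2 \<omega> = E \<omega> * ((\<gamma> * x \<omega> + \<gamma>\<^sup>2 * (y \<omega>)\<^sup>2) / 2 * \<epsilon>\<^sup>2)" for \<omega>
  define Q where "Q \<omega> = \<gamma> * h * K * (E \<omega> * (1 - (x \<omega>)\<^sup>2 + (y \<omega>)\<^sup>2))" for \<omega>
  define N where "N \<omega> = test_fun \<gamma> (separation (t + h) \<omega>)" for \<omega>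
  have th: "0 \<le> t + h" using t h by simp
  have om [measurable]: "overlap \<in> borel_measurable borel"
    by (rule borel_measurable_continuous_onI[OF continuous_on_overlap])
  have xF [measurable]: "x \<in> borel_measurable (F t)"
    unfolding x_def using separation_adapted[OF t] by (rule measurable_compose[OF _ om])
  have yF [measurable]: "y \<in> borel_measurable (F t)"
    unfolding y_def using correlation_adapted[OF t] by measurable
  have EF [measurable]: "E \<in> borel_measurable (F t)" unfolding E_def by measurable
  have Y1F: "Y1 \<in> borel_measurable (F t)" unfolding Y1_def by measurable
  have Y2F: "Y2 \<in> borel_measurable (F t)" unfolding Y2_def by measurable
  have QF: "Q \<in> borel_measurable (F t)" unfolding Q_def by measurable
  have x1: "\<bar>x \<omega>\<bar> \<le> 1" for \<omega> by (simp add: x_def overlap_bounds)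
  have y1: "\<bar>y \<omega>\<bar> \<le> 1" for \<omega> by (auto simp: y_def)
  have x2: "(x \<omega>)\<^sup>2 \<le> 1" and y2: "(y \<omega>)\<^sup>2 \<le> 1" for \<omega>
    using x1[of \<omega>] y1[of \<omega>] by (auto simp: abs_square_le_1)
  have E1: "0 \<le> E \<omega>" "E \<omega> \<le> exp \<gamma>" for \<omega>
    using abs_test_fun_le[of \<gamma> "separation t \<omega>"] \<gamma>_pos by (auto simp: E_def x_def test_fun_def)
  have b1: "\<bar>Y1 \<omega>\<bar> \<le> exp \<gamma> * (\<gamma> * 1 * \<epsilon>)" for \<omega>
    unfolding Y1_def abs_mult using E1 y1 \<gamma>_pos \<epsilon> by (intro mult_mono) auto
  have b2: "\<bar>Y2 \<omega>\<bar> \<le> exp \<gamma> * ((\<gamma> * 1 + \<gamma>\<^sup>2 * 1) / 2 * \<epsilon>\<^sup>2)" for \<omega>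
  proof -
    have "\<bar>\<gamma> * x \<omega> + \<gamma>\<^sup>2 * (y \<omega>)\<^sup>2\<bar> \<le> \<bar>\<gamma> * x \<omega>\<bar> + \<bar>\<gamma>\<^sup>2 * (y \<omega>)\<^sup>2\<bar>" by (rule abs_triangle_ineq)
    also have "\<dots> \<le> \<gamma> * 1 + \<gamma>\<^sup>2 * 1"
      unfolding abs_mult using x1 y2 \<gamma>_pos by (intro add_mono mult_mono) auto
    finally have "\<bar>\<gamma> * x \<omega> + \<gamma>\<^sup>2 * (y \<omega>)\<^sup>2\<bar> / 2 \<le> (\<gamma> * 1 + \<gamma>\<^sup>2 * 1) / 2" by simp
    then show ?thesis
      unfolding Y2_def abs_mult abs_divide using E1 \<gamma>_pos by (intro mult_mono) auto
  qed
  have b3: "\<bar>Q \<omega>\<bar> \<le> \<gamma> * h * K * (exp \<gamma> * 2)" for \<omega>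
  proof -
    have "\<bar>1 - (x \<omega>)\<^sup>2 + (y \<omega>)\<^sup>2\<bar> \<le> 2" 
      using x2[of \<omega>] y2[of \<omega>] zero_le_power2[of "x \<omega>"] zero_le_power2[of "y \<omega>"]
      unfolding abs_le_iff by linarith
    then show ?thesis
      unfolding Q_def abs_mult using E1 \<gamma>_pos h K by (intro mult_mono) auto
  qed
  note meas = filtration_measurable[OF t]
  have bounded_int: "integrable M f" if "f \<in> borel_measurable M" "\<And>\<omega>. \<bar>f \<omega>\<bar> \<le> c" for f :: "'w \<Rightarrow> real" and c
    by (rule integrable_const_bound[where B=c]) (use that in auto)
  have E2: "\<bar>E \<omega>\<bar> \<le> exp \<gamma>" for \<omega> using E1[of \<omega>] by simp
  have iE: "integrable M E" by (rule bounded_int[OF meas[OF EF] E2])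
  have iY1: "integrable M Y1" by (rule bounded_int[OF meas[OF Y1F] b1])
  have iY2: "integrable M Y2" by (rule bounded_int[OF meas[OF Y2F] b2])
  have iQ: "integrable M Q" by (rule bounded_int[OF meas[OF QF] b3])
  have tm: "test_fun \<gamma> \<in> borel_measurable borel" by (rule borel_measurable_continuous_onI[OF continuous_on_test(1)])
  have iN: "integrable M N"
    unfolding N_def
    by (rule bounded_int[OF measurable_compose[OF separation_measurable[OF th] tm]])
      (rule abs_test_fun_le[OF less_imp_le[OF \<gamma>_pos]])
  have tth: "t \<le> t + h" using h by simp
  have iD: "integrable M (\<lambda>\<omega>. Y1 \<omega> * D \<omega>)" "integrable M (\<lambda>\<omega>. Y2 \<omega> * (D \<omega>)\<^sup>2)"
    unfolding D_def
    by (rule integrable_bounded_mult[OF meas[OF Y1F] b1 integrable_B_increment(1)[OF t tth]],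
        rule integrable_bounded_mult[OF meas[OF Y2F] b2 integrable_B_increment(2)[OF t tth]])
  define V where "V \<omega> = N \<omega> + Q \<omega> - (E \<omega> + Y1 \<omega> * D \<omega> + Y2 \<omega> * (D \<omega>)\<^sup>2)" for \<omega>
  have iV: "integrable M V" unfolding V_def using iN iQ iE iD by simp
  have "AE \<omega> in M. V \<omega> \<le> integral {t..t + h} (\<lambda>s. total_error t h s \<omega>)"
    using AE_path
  proof eventually_elim
    case (elim \<omega>)
    let ?D = "\<epsilon> * B (t + h) \<omega> - \<epsilon> * B t \<omega>"
    let ?I = "integral {t..t + h} (\<lambda>s. step_error t h s \<omega>)"
    have n: "norm (fst (\<psi> t \<omega>)) = 1" "norm (snd (\<psi> t \<omega>)) = 1"
      and n': "norm (fst (\<psi> (t + h) \<omega>)) = 1" "norm (snd (\<psi> (t + h) \<omega>)) = 1"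
      using elim t th h by auto
    note z = unit_vector_facts[OF n] and z' = unit_vector_facts[OF n']
    have "\<bar>Im (correlation t \<omega>)\<bar> \<le> 1" using abs_Im_le_cmod[of "correlation t \<omega>"] z(1) by linarith
    then have yz: "Im (correlation t \<omega>) = y \<omega>" by (simp add: y_def)
    have xz: "Re (correlation t \<omega>) = x \<omega>" using z(2) by (simp add: x_def)
    have e1: "cmod (correlation (t + h) \<omega> - exp (\<i> * of_real ?D) * correlation t \<omega>) \<le> 2 * K * h"
      and e2: "cmod (correlation (t + h) \<omega> - exp (\<i> * of_real ?D) * correlation t \<omega>
        - of_real (h * K) * (1 - (correlation t \<omega>)\<^sup>2)) \<le> ?I"
      using elim t less_imp_le[OF h(1)] by blast+
    have Dd: "?D = \<epsilon> * D \<omega>" by (simp add: D_def right_diff_distrib)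
    have absD: "\<bar>\<epsilon> * D \<omega>\<bar> = \<epsilon> * \<bar>D \<omega>\<bar>" using \<epsilon> by (simp add: abs_mult)
    have "N \<omega> + Q \<omega> \<le> E \<omega> * (1 + \<gamma> * y \<omega> * (\<epsilon> * D \<omega>) + (\<gamma> * x \<omega> + \<gamma>\<^sup>2 * (y \<omega>)\<^sup>2) / 2 * (\<epsilon> * D \<omega>)\<^sup>2)
      + (\<gamma> + 3 * \<gamma>\<^sup>2 + \<gamma> ^ 3) * exp \<gamma> / 6 * (\<epsilon> * \<bar>D \<omega>\<bar>) ^ 3 + 2 * \<gamma>\<^sup>2 * K * exp \<gamma> * (h * (\<epsilon> * \<bar>D \<omega>\<bar>))
      + 2 * \<gamma>\<^sup>2 * K\<^sup>2 * exp (3 * \<gamma>) * h\<^sup>2 + \<gamma> * exp \<gamma> * ?I"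
      using exp_test_step[OF less_imp_le[OF \<gamma>_pos] less_imp_le[OF K] less_imp_le[OF h(1)] z(1) z'(1) e1 e2]
      unfolding Dd absD xz z'(2) yz N_def Q_def E_def test_fun_def .
    then have "V \<omega> \<le> err3 * \<bar>D \<omega>\<bar> ^ 3 + err1 * (h * \<bar>D \<omega>\<bar>) + 2 * \<gamma>\<^sup>2 * K\<^sup>2 * exp (3 * \<gamma>) * h\<^sup>2 + \<gamma> * exp \<gamma> * ?I"
      unfolding V_def Y1_def Y2_def err3_def err1_def by (simp add: algebra_simps power_mult_distrib)
    also have "\<dots> = integral {t..t + h} (\<lambda>s. (err3 / h * \<bar>D \<omega>\<bar> ^ 3 + err1 * \<bar>D \<omega>\<bar> + 2 * \<gamma>\<^sup>2 * K\<^sup>2 * exp (3 * \<gamma>) * h)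
        + \<gamma> * exp \<gamma> * step_error t h s \<omega>)"
    proof -
      have cB: "continuous_on {t..t + h} (\<lambda>s. B s \<omega>)"
        by (rule continuous_on_subset[OF conjunct1[OF elim]]) (use t in auto)
      have "(\<lambda>s. \<gamma> * exp \<gamma> * step_error t h s \<omega>) integrable_on {t..t + h}"
        unfolding step_error_def by (intro integrable_continuous_real continuous_intros cB)
      then have "integral {t..t + h} (\<lambda>s. (err3 / h * \<bar>D \<omega>\<bar> ^ 3 + err1 * \<bar>D \<omega>\<bar> + 2 * \<gamma>\<^sup>2 * K\<^sup>2 * exp (3 * \<gamma>) * h)
        + \<gamma> * exp \<gamma> * step_error t h s \<omega>)
        = integral {t..t + h} (\<lambda>s. err3 / h * \<bar>D \<omega>\<bar> ^ 3 + err1 * \<bar>D \<omega>\<bar> + 2 * \<gamma>\<^sup>2 * K\<^sup>2 * exp (3 * \<gamma>) * h)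
          + integral {t..t + h} (\<lambda>s. \<gamma> * exp \<gamma> * step_error t h s \<omega>)"
        by (intro Henstock_Kurzweil_Integration.integral_add) auto
      also have "integral {t..t + h} (\<lambda>s. \<gamma> * exp \<gamma> * step_error t h s \<omega>) = \<gamma> * exp \<gamma> * ?I"
        by (rule Henstock_Kurzweil_Integration.integral_mult_right)
      also have "integral {t..t + h} (\<lambda>s. err3 / h * \<bar>D \<omega>\<bar> ^ 3 + err1 * \<bar>D \<omega>\<bar> + 2 * \<gamma>\<^sup>2 * K\<^sup>2 * exp (3 * \<gamma>) * h)
          = err3 * \<bar>D \<omega>\<bar> ^ 3 + err1 * (h * \<bar>D \<omega>\<bar>) + 2 * \<gamma>\<^sup>2 * K\<^sup>2 * exp (3 * \<gamma>) * h\<^sup>2"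
        using h by (simp add: algebra_simps power2_eq_square)
      finally show ?thesis by simp
    qed
    also have "\<dots> = integral {t..t + h} (\<lambda>s. total_error t h s \<omega>)"
    proof (rule arg_cong[where f="integral {t..t + h}"], rule ext)
      fix s
      have "\<bar>\<epsilon> * B (t + h) \<omega> - \<epsilon> * B s \<omega>\<bar> = \<epsilon> * \<bar>B (t + h) \<omega> - B s \<omega>\<bar>"
        "\<bar>\<epsilon> * B s \<omega> - \<epsilon> * B t \<omega>\<bar> = \<epsilon> * \<bar>B s \<omega> - B t \<omega>\<bar>"
        using \<epsilon> by (simp_all add: abs_mult right_diff_distrib[symmetric])
      then show "(err3 / h * \<bar>D \<omega>\<bar> ^ 3 + err1 * \<bar>D \<omega>\<bar> + 2 * \<gamma>\<^sup>2 * K\<^sup>2 * exp (3 * \<gamma>) * h)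
        + \<gamma> * exp \<gamma> * step_error t h s \<omega> = total_error t h s \<omega>"
        unfolding step_error_def total_error_def D_def err0_def err2_def
        by (simp add: algebra_simps power2_eq_square)
    qed
    finally show ?case .
  qed
  then have "(\<integral>\<^sup>+\<omega>. ennreal (V \<omega>) \<partial>M) \<le> (\<integral>\<^sup>+\<omega>. ennreal (integral {t..t + h} (\<lambda>s. total_error t h s \<omega>)) \<partial>M)"
    by (intro nn_integral_mono_AE) (auto elim!: eventually_mono intro: ennreal_leI)
  also have "\<dots> \<le> ennreal (err * sqrt h * (t + h - t))"
  proof (rule nn_integral_time_integral_le)
    show "AE \<omega> in M. continuous_on {t..t + h} (\<lambda>s. total_error t h s \<omega>)"
      using AE_path
    proof eventually_elim
      case (elim \<omega>)
      have cB: "continuous_on {t..t + h} (\<lambda>s. B s \<omega>)"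
        by (rule continuous_on_subset[OF conjunct1[OF elim]]) (use t in auto)
      show ?case unfolding total_error_def by (intro continuous_intros cB)
    qed
    show "0 \<le> total_error t h s \<omega>" for s \<omega>
      using err_nonneg h by (auto simp: total_error_def)
  qed (use t h err_nonneg nn_integral_total_error in auto)
  finally have nn: "(\<integral>\<^sup>+\<omega>. ennreal (V \<omega>) \<partial>M) \<le> ennreal (err * sqrt h * h)" by simp
  have "expectation V \<le> err * sqrt h * h"
  proof -
    \<comment> \<open>\<open>ennreal\<close> sends negative values to 0, so the bound on the
      nonnegative integral controls the positive part of \<open>V\<close>, which is enough for an
      upper estimate.\<close>
    have "expectation V \<le> expectation (\<lambda>\<omega>. max 0 (V \<omega>))"
      using iV by (intro integral_mono) auto
    also have "\<dots> \<le> err * sqrt h * h"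
    proof (rule expectation_le_nn_integral(2))
      show "(\<integral>\<^sup>+\<omega>. ennreal (max 0 (V \<omega>)) \<partial>M) \<le> ennreal (err * sqrt h * h)"
        using nn by (simp add: ennreal_max_0)
    qed (use iV err_nonneg h in auto)
    finally show ?thesis .
  qed
  moreover have "expectation V = expectation N + expectation Q - (expectation E
      + expectation (\<lambda>\<omega>. Y1 \<omega> * D \<omega>) + expectation (\<lambda>\<omega>. Y2 \<omega> * (D \<omega>)\<^sup>2))"
    unfolding V_def using iN iQ iE iD by simp
  moreover have "expectation (\<lambda>\<omega>. Y1 \<omega> * D \<omega>) = 0"
    unfolding D_def by (rule expectation_mult_B_increment[OF t tth Y1F b1])
  moreover have "expectation (\<lambda>\<omega>. Y2 \<omega> * (D \<omega>)\<^sup>2) = 2 * h * expectation Y2"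
    unfolding D_def using expectation_mult_B_increment2[OF t tth Y2F b2] by simp
  moreover have "expectation Q - 2 * h * expectation Y2 = h * K * expectation (\<lambda>\<omega>. test_gen \<gamma> (separation t \<omega>))"
  proof -
    have "expectation Q - 2 * h * expectation Y2 = expectation (\<lambda>\<omega>. Q \<omega> - 2 * h * Y2 \<omega>)"
      using iQ iY2 by simp
    also have "\<dots> = expectation (\<lambda>\<omega>. h * K * test_gen \<gamma> (separation t \<omega>))"
    proof (intro Bochner_Integration.integral_cong refl)
      fix \<omega>
      have "2 * h * Y2 \<omega> = h * E \<omega> * ((\<gamma> * \<epsilon>\<^sup>2) * x \<omega> + \<gamma> * (\<gamma> * \<epsilon>\<^sup>2) * (y \<omega>)\<^sup>2)"
        by (simp add: Y2_def power2_eq_square field_simps)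
      also have "\<dots> = h * E \<omega> * (K * x \<omega> + \<gamma> * K * (y \<omega>)\<^sup>2)" by (simp only: \<gamma>_\<epsilon>)
      finally have "Q \<omega> - 2 * h * Y2 \<omega> = h * K * (E \<omega> * (\<gamma> * (1 - (x \<omega>)\<^sup>2) - x \<omega>))"
        by (simp add: Q_def algebra_simps)
      then show "Q \<omega> - 2 * h * Y2 \<omega> = h * K * test_gen \<gamma> (separation t \<omega>)"
        by (simp add: test_gen_def E_def x_def)
    qed
    also have "\<dots> = h * K * expectation (\<lambda>\<omega>. test_gen \<gamma> (separation t \<omega>))" by simp
    finally show ?thesis .
  qed
  moreover have "E = (\<lambda>\<omega>. test_fun \<gamma> (separation t \<omega>))"
    by (simp add: fun_eq_iff E_def x_def test_fun_def)
  moreover have "N = (\<lambda>\<omega>. test_fun \<gamma> (separation (t + h) \<omega>))"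
    by (simp add: fun_eq_iff N_def)
  ultimately show ?thesis by simp
qed

text \<open>The means of the test function at \<open>t\<close> and at \<open>t + h\<close> converge
  to the same integral and cancel. Uniformity of the error in \<open>t\<close> is what permits the
  limit in \<open>t\<close> at fixed \<open>h\<close> before \<open>h\<close> tends to 0.\<close>

lemma limit_law_test_gen_nonpos:
  assumes lim: "conv_in_distribution (\<lambda>t. distr M borel (separation t)) \<nu> at_top"
  shows "(\<integral>r. test_gen \<gamma> r \<partial>\<nu>) \<le> 0"
proof -
  have conv: "((\<lambda>t. expectation (\<lambda>\<omega>. g (separation t \<omega>))) \<longlongrightarrow> (\<integral>r. g r \<partial>\<nu>)) at_top"
    if g: "continuous_on UNIV g" "bounded (range g)" for g :: "real \<Rightarrow> real"
  proof -
    have "((\<lambda>t. \<integral>r. g r \<partial>distr M borel (separation t)) \<longlongrightarrow> (\<integral>r. g r \<partial>\<nu>)) at_top"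
      using lim g by (auto simp: conv_in_distribution_def)
    \<comment> \<open>Measurability of the distance is available for \<open>t \<ge> 0\<close>, so
      the change of variables holds eventually.\<close>
    moreover have "\<forall>\<^sub>F t in at_top. (\<integral>r. g r \<partial>distr M borel (separation t)) = expectation (\<lambda>\<omega>. g (separation t \<omega>))"
      using eventually_ge_at_top[of 0]
      by eventually_elim (intro integral_distr separation_measurable borel_measurable_continuous_onI g)
    ultimately show ?thesis by (rule Lim_transform_eventually)
  qed
  note tf = conv[OF continuous_on_test(1) bounded_range_real[OF abs_test_fun_le[OF less_imp_le[OF \<gamma>_pos]]]]
  note tg = conv[OF continuous_on_test(2) bounded_range_real[OF abs_test_gen_le[OF less_imp_le[OF \<gamma>_pos]]]]
  have step: "K * (\<integral>r. test_gen \<gamma> r \<partial>\<nu>) \<le> err * sqrt h" if h: "0 < h" "h \<le> 1" for h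
  proof -
    have "((\<lambda>t. expectation (\<lambda>\<omega>. test_fun \<gamma> (separation (t + h) \<omega>))) \<longlongrightarrow> (\<integral>r. test_fun \<gamma> r \<partial>\<nu>)) at_top"
      using filterlim_tendsto_add_at_top[OF tendsto_const[of h] filterlim_ident]
      by (intro filterlim_compose[OF tf]) (simp add: add.commute)
    then have "((\<lambda>t. expectation (\<lambda>\<omega>. test_fun \<gamma> (separation (t + h) \<omega>)) + h * K * expectation (\<lambda>\<omega>. test_gen \<gamma> (separation t \<omega>)))
        \<longlongrightarrow> (\<integral>r. test_fun \<gamma> r \<partial>\<nu>) + h * K * (\<integral>r. test_gen \<gamma> r \<partial>\<nu>)) at_top"
      by (intro tendsto_intros tg)
    moreover have "((\<lambda>t. expectation (\<lambda>\<omega>. test_fun \<gamma> (separation t \<omega>)) + err * sqrt h * h)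
        \<longlongrightarrow> (\<integral>r. test_fun \<gamma> r \<partial>\<nu>) + err * sqrt h * h) at_top"
      by (intro tendsto_intros tf)
    moreover have "\<forall>\<^sub>F t in at_top. expectation (\<lambda>\<omega>. test_fun \<gamma> (separation (t + h) \<omega>)) + h * K * expectation (\<lambda>\<omega>. test_gen \<gamma> (separation t \<omega>))
        \<le> expectation (\<lambda>\<omega>. test_fun \<gamma> (separation t \<omega>)) + err * sqrt h * h"
      using eventually_ge_at_top[of 0] by eventually_elim (rule one_step[OF _ h])
    ultimately have "(\<integral>r. test_fun \<gamma> r \<partial>\<nu>) + h * K * (\<integral>r. test_gen \<gamma> r \<partial>\<nu>) \<le> (\<integral>r. test_fun \<gamma> r \<partial>\<nu>) + err * sqrt h * h"
      by (intro tendsto_le[OF trivial_limit_at_top_linorder])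
    then have "h * (K * (\<integral>r. test_gen \<gamma> r \<partial>\<nu>)) \<le> h * (err * sqrt h)" by (simp add: mult_ac)
    then show ?thesis using h by simp
  qed
  have "K * (\<integral>r. test_gen \<gamma> r \<partial>\<nu>) \<le> 0"
  proof (rule field_le_epsilon)
    fix e :: real assume e: "e > 0"
    define r where "r = min 1 (e / (err + 1))"
    have r: "0 < r" "r \<le> 1" using e err_nonneg(5) by (auto simp: r_def)
    \<comment> \<open>Applied with \<open>h = r^2\<close>, which makes the error linear in
      \<open>r\<close>.\<close>
    have "K * (\<integral>r. test_gen \<gamma> r \<partial>\<nu>) \<le> err * sqrt (r\<^sup>2)" using r by (intro step) (auto simp: power_le_one)
    also have "\<dots> = err * r" using r by simp
    also have "\<dots> \<le> err * (e / (err + 1))" using err_nonneg(5) by (intro mult_left_mono) (auto simp: r_def)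
    also have "\<dots> \<le> e" using e err_nonneg(5) by (simp add: field_simps)
    finally show "K * (\<integral>r. test_gen \<gamma> r \<partial>\<nu>) \<le> 0 + e" by simp
  qed
  then show ?thesis using K by (simp add: mult_le_0_iff)
qed

end


section \<open>Concentration at the origin\<close>

text \<open>In terms of \<open>p = 1 - x\<close>, half the cut-off squared distance, and after
  multiplication by \<open>exp \<gamma>\<close>, the exponent becomes \<open>\<gamma> p\<close>,
  which is nonnegative for positive \<open>\<gamma>\<close> and zero at the origin.\<close>

lemma test_gen_eq:
  "exp \<gamma> * test_gen \<gamma> r = exp (\<gamma> * (1 - overlap r))
    * (\<gamma> * (1 - overlap r) * (2 - (1 - overlap r)) - 1 + (1 - overlap r))"
proof -
  have "exp \<gamma> * exp (- \<gamma> * overlap r) = exp (\<gamma> * (1 - overlap r))"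
    by (simp add: exp_add[symmetric] algebra_simps)
  moreover have "\<gamma> * (1 - (overlap r)\<^sup>2) - overlap r
      = \<gamma> * (1 - overlap r) * (2 - (1 - overlap r)) - 1 + (1 - overlap r)"
    by (simp add: algebra_simps power2_eq_square)
  ultimately show ?thesis by (simp only: test_gen_def mult.assoc[symmetric])
qed

text \<open>Since \<open>\<gamma> p \<ge> 2\<close>, the factor is at least
  \<open>2 (2 - p) - 1 + p = 3 - p\<close>, and \<open>p \<le> 2\<close>.\<close>

lemma concave_factor_ge_one:
  fixes p \<gamma> :: real
  assumes "p \<le> 2" "2 \<le> \<gamma> * p"
  shows "1 \<le> \<gamma> * p * (2 - p) - 1 + p"
proof -
  have *: "1 \<le> X - 1 + p" if "2 * (2 - p) \<le> X" for X using that assms(1) by (simp add: algebra_simps)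
  show ?thesis by (rule *) (use assms in \<open>intro mult_right_mono; simp\<close>)
qed

text \<open>The threshold \<open>\<gamma> p = 2\<close> separates two regimes. Above it the
  polynomial factor is at least 1; below it that factor is still at least -1 while the exponential
  stays below \<open>exp 2\<close>.\<close>

lemma test_gen_lower_bounds:
  assumes \<gamma>: "0 < \<gamma>"
  shows "- exp 2 \<le> exp \<gamma> * test_gen \<gamma> r"
    and "2 \<le> \<gamma> * \<kappa> \<Longrightarrow> \<kappa> \<le> 1 - overlap r \<Longrightarrow> exp (\<gamma> * \<kappa>) \<le> exp \<gamma> * test_gen \<gamma> r"
proof -
  define p where "p = 1 - overlap r"
  have p: "0 \<le> p" "p \<le> 2" using overlap_bounds[of r] by (auto simp: p_def)
  have eq: "exp \<gamma> * test_gen \<gamma> r = exp (\<gamma> * p) * (\<gamma> * p * (2 - p) - 1 + p)"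
    unfolding p_def by (rule test_gen_eq)
  show "- exp 2 \<le> exp \<gamma> * test_gen \<gamma> r"
  proof (cases "2 \<le> \<gamma> * p")
    case True
    then have "0 \<le> exp (\<gamma> * p) * (\<gamma> * p * (2 - p) - 1 + p)"
      using concave_factor_ge_one[OF p(2) True] by (intro mult_nonneg_nonneg) auto
    then show ?thesis unfolding eq by (simp add: order_trans[of _ 0])
  next
    case False
    have "- 1 \<le> \<gamma> * p * (2 - p) - 1 + p"
      using p \<gamma> mult_nonneg_nonneg[of "\<gamma> * p" "2 - p"] by simp
    then have "exp (\<gamma> * p) * (- 1) \<le> exp (\<gamma> * p) * (\<gamma> * p * (2 - p) - 1 + p)"
      by (intro mult_left_mono) auto
    moreover have "exp (\<gamma> * p) \<le> exp 2" using False by simp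
    ultimately show ?thesis unfolding eq by linarith
  qed
  assume \<kappa>: "2 \<le> \<gamma> * \<kappa>" "\<kappa> \<le> 1 - overlap r"
  then have kp: "\<gamma> * \<kappa> \<le> \<gamma> * p" using \<gamma> by (intro mult_left_mono) (auto simp: p_def)
  then have "1 \<le> \<gamma> * p * (2 - p) - 1 + p"
    using \<kappa> by (intro concave_factor_ge_one p) auto
  then have "exp (\<gamma> * \<kappa>) * 1 \<le> exp (\<gamma> * p) * (\<gamma> * p * (2 - p) - 1 + p)"
    using kp by (intro mult_mono) auto
  then show "exp (\<gamma> * \<kappa>) \<le> exp \<gamma> * test_gen \<gamma> r" unfolding eq by simp
qed

text \<open>A Markov-type argument: \<open>|f - f 0|\<close> is majorised pointwise by
  \<open>\<delta>\<close> plus a multiple of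
  \<open>exp \<gamma> * test_gen \<gamma> + exp 2\<close>, a nonnegative function whose integral is
  at most \<open>exp 2\<close> because the generator has nonpositive mean.\<close>

lemma integral_near_origin:
  fixes f :: "real \<Rightarrow> real"
  assumes \<nu>: "real_distribution \<nu>" and \<gamma>: "0 < \<gamma>" and gen: "(\<integral>r. test_gen \<gamma> r \<partial>\<nu>) \<le> 0"
    and f: "continuous_on UNIV f" and C: "\<And>x. \<bar>f x\<bar> \<le> C"
    and \<delta>: "0 \<le> \<delta>" and near: "\<And>r. 1 - overlap r < \<kappa> \<Longrightarrow> \<bar>f r - f 0\<bar> \<le> \<delta>" and \<kappa>: "2 \<le> \<gamma> * \<kappa>"
  shows "\<bar>(\<integral>r. f r \<partial>\<nu>) - f 0\<bar> \<le> \<delta> + 2 * C * exp (2 - \<gamma> * \<kappa>)"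
proof -
  interpret real_distribution \<nu> by (rule \<nu>)
  have C0: "0 \<le> C" using C[of 0] by linarith
  \<comment> \<open>Chosen so that \<open>c exp(\<gamma> \<kappa>) = 2 C\<close>, the trivial bound
    on \<open>|f r - f 0|\<close>.\<close>
  define c where "c = 2 * C * exp (- (\<gamma> * \<kappa>))"
  have c0: "0 \<le> c" using C0 by (simp add: c_def)
  have meas: "g \<in> borel_measurable \<nu>" if "continuous_on UNIV g" for g :: "real \<Rightarrow> real"
    using borel_measurable_continuous_onI[OF that] by simp
  have fint: "integrable \<nu> f" by (rule integrable_const_bound[where B=C]) (use C meas[OF f] in auto)
  have gint: "integrable \<nu> (test_gen \<gamma>)"
    by (rule integrable_const_bound[where B="exp \<gamma> * (\<gamma> + 1)"])
      (use abs_test_gen_le \<gamma> meas[OF continuous_on_test(2)] in auto)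
  have "\<bar>f r - f 0\<bar> \<le> \<delta> + c * (exp \<gamma> * test_gen \<gamma> r + exp 2)" for r
  proof (cases "1 - overlap r < \<kappa>")
    case True
    have "0 \<le> c * (exp \<gamma> * test_gen \<gamma> r + exp 2)"
      using test_gen_lower_bounds(1)[OF \<gamma>, of r] c0 by (intro mult_nonneg_nonneg) auto
    then show ?thesis using near[OF True] by linarith
  next
    case False
    have "\<bar>f r - f 0\<bar> \<le> 2 * C" using C[of r] C[of 0] by linarith
    also have "\<dots> = c * exp (\<gamma> * \<kappa>)" by (simp add: c_def exp_minus)
    also have "\<dots> \<le> c * (exp \<gamma> * test_gen \<gamma> r + exp 2)"
      using test_gen_lower_bounds(2)[OF \<gamma> \<kappa>, of r] False c0
      by (intro mult_left_mono) (auto simp: add_increasing2)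
    finally show ?thesis using \<delta> by simp
  qed
  note pt = this
  have "\<bar>(\<integral>r. f r \<partial>\<nu>) - f 0\<bar> = \<bar>\<integral>r. f r - f 0 \<partial>\<nu>\<bar>" using fint prob_space by simp
  also have "\<dots> \<le> (\<integral>r. \<bar>f r - f 0\<bar> \<partial>\<nu>)" by (rule integral_abs_bound)
  also have "\<dots> \<le> (\<integral>r. \<delta> + c * (exp \<gamma> * test_gen \<gamma> r + exp 2) \<partial>\<nu>)"
    using fint gint pt by (intro integral_mono) auto
  also have "\<dots> = \<delta> + c * (exp \<gamma> * (\<integral>r. test_gen \<gamma> r \<partial>\<nu>) + exp 2)"
    using gint prob_space by simp
  also have "\<dots> \<le> \<delta> + c * (exp \<gamma> * 0 + exp 2)"
    using gen c0 by (intro add_left_mono mult_left_mono add_right_mono) auto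
  also have "\<dots> = \<delta> + 2 * C * exp (2 - \<gamma> * \<kappa>)"
    by (simp add: c_def exp_add[symmetric])
  finally show ?thesis .
qed

theorem proposition4:
  fixes M :: "'w measure"
    and F :: "real \<Rightarrow> 'w measure"
    and \<beta>1 \<beta>2 :: "real \<Rightarrow> 'w \<Rightarrow> real"
    and u :: "real \<Rightarrow> real \<Rightarrow> (real ^ 'd) L2 \<times> (real ^ 'd) L2"
    and \<psi> :: "real \<Rightarrow> real \<Rightarrow> real \<Rightarrow> 'w \<Rightarrow> (real ^ 'd) L2 \<times> (real ^ 'd) L2"
    and \<nu> :: "real \<Rightarrow> real \<Rightarrow> real measure"
  assumes "stochastic_basis M F"
    and "brownian_motion M F \<beta>1" and "brownian_motion M F \<beta>2"
    and "independent_processes M \<beta>1 \<beta>2"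
    and "\<And>K \<epsilon>. K > 0 \<Longrightarrow> \<epsilon> > 0 \<Longrightarrow> norm (fst (u K \<epsilon>)) = 1 \<and> norm (snd (u K \<epsilon>)) = 1"
    and "\<And>K \<epsilon>. K > 0 \<Longrightarrow> \<epsilon> > 0 \<Longrightarrow>
      schroedinger_lohe_solution M F \<beta>1 \<beta>2 K \<epsilon> (u K \<epsilon>) (\<psi> K \<epsilon>)"
    and "\<And>K \<epsilon>. K > 0 \<Longrightarrow> \<epsilon> > 0 \<Longrightarrow> real_distribution (\<nu> K \<epsilon>)"
    and "\<And>K \<epsilon>. K > 0 \<Longrightarrow> \<epsilon> > 0 \<Longrightarrow>
      conv_in_distribution
        (\<lambda>t. distr M borel (\<lambda>\<omega>. norm (fst (\<psi> K \<epsilon> t \<omega>) - snd (\<psi> K \<epsilon> t \<omega>)))) (\<nu> K \<epsilon>) at_top"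
  shows "conv_in_distribution (\<lambda>(K, \<epsilon>). \<nu> K \<epsilon>) (return borel 0)
    (filtercomap (\<lambda>(K, \<epsilon>). \<epsilon>\<^sup>2 / K) (at_right 0) \<sqinter> principal ({0<..} \<times> {0<..}))"
proof -
  have gen: "(\<integral>r. test_gen (K / \<epsilon>\<^sup>2) r \<partial>\<nu> K \<epsilon>) \<le> 0" if pos: "K > 0" "\<epsilon> > 0" for K \<epsilon>
  proof -
    interpret stochastic_basis M F by fact
    interpret lohe_solution M F \<beta>1 \<beta>2 K \<epsilon> "u K \<epsilon>" "\<psi> K \<epsilon>"
      by unfold_locales (use assms pos in auto)
    show ?thesis
      using limit_law_test_gen_nonpos[of "\<nu> K \<epsilon>"] assms(8)[OF pos]
      by (simp add: separation_def[abs_def] \<gamma>_def)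
  qed
  show ?thesis
    unfolding conv_in_distribution_def
  proof (intro allI impI)
    fix f :: "real \<Rightarrow> real"
    assume f: "continuous_on UNIV f" and "bounded (range f)"
    then obtain C where C: "\<And>x. \<bar>f x\<bar> \<le> C" by (auto simp: bounded_iff)
    have C0: "0 \<le> C" using C[of 0] by linarith
    have f0: "(\<integral>x. f x \<partial>return borel 0) = f 0"
      by (rule integral_return) (use borel_measurable_continuous_onI[OF f] in auto)
    show "((\<lambda>i. \<integral>x. f x \<partial>(case i of (K, \<epsilon>) \<Rightarrow> \<nu> K \<epsilon>)) \<longlongrightarrow> (\<integral>x. f x \<partial>return borel 0))
      (filtercomap (\<lambda>(K, \<epsilon>). \<epsilon>\<^sup>2 / K) (at_right 0) \<sqinter> principal ({0<..} \<times> {0<..}))"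
      unfolding f0
    proof (rule tendstoI)
      fix e :: real assume e: "e > 0"
      have "isCont f 0" using f by (simp add: continuous_on_eq_continuous_at)
      then obtain \<eta> where \<eta>: "\<eta> > 0" "\<And>r. \<bar>r\<bar> < \<eta> \<Longrightarrow> \<bar>f r - f 0\<bar> < e / 2"
        using e unfolding continuous_at_eps_delta dist_real_def by (metis diff_zero half_gt_zero)
      \<comment> \<open>The cap at 1 keeps \<open>2 \<kappa>\<close> below the cutoff value 4 in
        \<open>overlap\<close>, so that \<open>1 - overlap r < \<kappa>\<close> really forces
        \<open>r^2 < \<eta>^2\<close>.\<close>
      define \<kappa> where "\<kappa> = min (\<eta>\<^sup>2) 1 / 2"
      have \<kappa>: "\<kappa> > 0" using \<eta>(1) by (simp add: \<kappa>_def)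
      have near: "\<bar>f r - f 0\<bar> \<le> e / 2" if "1 - overlap r < \<kappa>" for r
      proof -
        have "r\<^sup>2 < \<eta>\<^sup>2" using that by (auto simp: overlap_def \<kappa>_def min_def split: if_splits)
        then have "\<bar>r\<bar> < \<eta>" using \<eta>(1) by (intro power_less_imp_less_base[of "\<bar>r\<bar>" 2 \<eta>]) auto
        then show ?thesis using \<eta>(2) less_imp_le by blast
      qed
      \<comment> \<open>The first bound yields \<open>\<gamma> \<kappa> \<ge> 2\<close>; the second
        makes the tail smaller than \<open>e / 2\<close> by means of
        \<open>exp(- s) \<le> 1 / s\<close> with \<open>s = \<kappa> / \<sigma>\<close>. Using
        \<open>C + 1\<close> avoids a vanishing denominator.\<close>
      define b where "b = min (\<kappa> / 2) (e * \<kappa> / (4 * (C + 1) * exp 2))"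
      have b: "b > 0" using \<kappa> e C0 by (auto simp: b_def)
      have main: "dist (\<integral>x. f x \<partial>\<nu> K \<epsilon>) (f 0) < e"
        if pos: "K > 0" "\<epsilon> > 0" and small: "\<epsilon>\<^sup>2 / K < b" for K \<epsilon>
      proof -
        define \<sigma> where "\<sigma> = \<epsilon>\<^sup>2 / K"
        have \<sigma>: "0 < \<sigma>" "\<sigma> < b" "K / \<epsilon>\<^sup>2 = 1 / \<sigma>" using pos small by (auto simp: \<sigma>_def)
        have two: "2 \<le> 1 / \<sigma> * \<kappa>" using \<sigma> by (simp add: b_def field_simps)
        have "\<bar>(\<integral>x. f x \<partial>\<nu> K \<epsilon>) - f 0\<bar> \<le> e / 2 + 2 * C * exp (2 - 1 / \<sigma> * \<kappa>)"
          using gen[OF pos] e \<sigma> two near assms(7)[OF pos] C f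
          by (intro integral_near_origin) auto
        also have "2 * C * exp (2 - 1 / \<sigma> * \<kappa>) < e / 2"
        proof -
          have "\<kappa> / \<sigma> \<le> exp (\<kappa> / \<sigma>)" using exp_ge_add_one_self[of "\<kappa> / \<sigma>"] by linarith
          then have "exp (- (\<kappa> / \<sigma>)) \<le> \<sigma> / \<kappa>"
            using \<kappa> \<sigma> by (simp add: exp_minus field_simps)
          then have "exp 2 * exp (- (\<kappa> / \<sigma>)) \<le> exp 2 * (\<sigma> / \<kappa>)" by (intro mult_left_mono) auto
          then have "exp (2 - 1 / \<sigma> * \<kappa>) \<le> exp 2 * (\<sigma> / \<kappa>)" by (simp add: exp_add[symmetric])
          then have "2 * C * exp (2 - 1 / \<sigma> * \<kappa>) \<le> 2 * C * (exp 2 * (\<sigma> / \<kappa>))"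
            using C0 by (intro mult_left_mono) auto
          also have "\<dots> \<le> 2 * (C + 1) * (exp 2 * (\<sigma> / \<kappa>))"
            using \<sigma> \<kappa> by (intro mult_right_mono) auto
          also have "\<dots> < 2 * (C + 1) * (exp 2 * ((e * \<kappa> / (4 * (C + 1) * exp 2)) / \<kappa>))"
            using \<sigma> \<kappa> C0 by (intro mult_strict_left_mono divide_strict_right_mono) (auto simp: b_def)
          also have "\<dots> = e / 2"
          proof -
            have "2 * a * (y * ((e * \<kappa> / (4 * a * y)) / \<kappa>)) = e / 2" if "a > 0" "y > 0" for a y :: real
              using \<kappa> that by (simp add: field_simps)
            from this[of "C + 1" "exp 2"] show ?thesis using C0 by (simp only: exp_gt_zero add_nonneg_pos zero_less_one)
          qed
          finally show ?thesis .
        qed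
        finally show ?thesis by (simp add: dist_real_def)
      qed
      show "\<forall>\<^sub>F i in filtercomap (\<lambda>(K, \<epsilon>). \<epsilon>\<^sup>2 / K) (at_right 0) \<sqinter> principal ({0<..} \<times> {0<..}).
          dist (\<integral>x. f x \<partial>(case i of (K, \<epsilon>) \<Rightarrow> \<nu> K \<epsilon>)) (f 0) < e"
        unfolding eventually_inf_principal eventually_filtercomap
      proof (intro exI[of _ "\<lambda>s. s < b"] conjI allI impI)
        show "\<forall>\<^sub>F s in at_right 0. s < b"
          using b by (auto simp: eventually_at_right)
        show "dist (\<integral>x. f x \<partial>(case i of (K, \<epsilon>) \<Rightarrow> \<nu> K \<epsilon>)) (f 0) < e"
          if "(case i of (K, \<epsilon>) \<Rightarrow> \<epsilon>\<^sup>2 / K) < b" "i \<in> {0<..} \<times> {0<..}" for i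
          using that main by (cases i) auto
      qed
    qed
  qed
qed

end
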